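(* Let $A\in\mathbb{R}^{d\times d}$, $B\in\mathbb{R}^{d\times n}$, $C\in\mathbb{R}^{m\times d}$, $D\in\mathbb{R}^{m\times n}$, let $$\mathcal{B}_s=\{(\mathbf{u},\mathbf{y},\mathbf{x})\in\mathcal{L}_2^{\rm loc}(\mathbb{R},\mathbb{R}^n)\times\mathcal{L}_2^{\rm loc}(\mathbb{R},\mathbb{R}^m)\times\mathcal{L}_2^{\rm loc}(\mathbb{R},\mathbb{R}^d): \tfrac{d\mathbf{x}}{dt}=A\mathbf{x}+B\mathbf{u},\ \mathbf{y}=C\mathbf{x}+D\mathbf{u}\},$$ let $V_o=\mathrm{col}(C,CA,\dots,CA^{d-1})$ and $H(\xi)=D+C(\xi I-A)^{-1}B$. Fix $t_0\in\mathbb{R}$ and for $\mathbf{x}_0\in\mathbb{R}^d$ let $S_a^{\sigma_g}(\mathbf{x}_0)$ be the supremum of $\int_{t_0}^{t_1}(\mathbf{y}^T\mathbf{y}-\mathbf{u}^T\mathbf{u})(t)\,dt$ over all $t_1\ge t_0$ and $(\mathbf{u},\mathbf{y},\mathbf{x})\in\mathcal{B}_s$ with $\mathbf{x}(t_0)=\mathbf{x}_0$ ($=\infty$ if unbounded above). The following are equivalent: 1. $S_a^{\sigma_g}(\mathbf{x}_0)<\infty$ for all $\mathbf{x}_0\in\mathbb{R}^d$. 2. There exists $X_-\in\mathbb{R}^{d\times d}_s$ such that (i) $X_-\ge0$; (ii) if $\mathbf{z}\in\mathbb{R}^d$ and $V_o\mathbf{z}=0$ then $X_-\mathbf{z}=0$;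 (iii) there exist real matrices $L,W$ with (iiia) $-A^TX_--X_-A-C^TC=L^TL$, $-D^TC-B^TX_-=W^TL$, $I-D^TD=W^TW$, and (iiib) $Z(\xi):=W+L(\xi I-A)^{-1}B$ is a spectral factor of $I-H^\star H$. Moreover, if these conditions hold (with $X_-$ any matrix as in condition 2), then $S_a^{\sigma_g}(\mathbf{x}_0)=\mathbf{x}_0^TX_-\mathbf{x}_0$ for all $\mathbf{x}_0$.
   Context: $\mathbb{R}^{d\times d}_s$ denotes real symmetric matrices; $M\ge0$ means positive semidefinite. For a real rational matrix $G$, $G^\star(\xi):=G(-\xi)^T$. If $Z\in\mathbb{R}^{r\times n}(\xi)$ and $F=Z^\star Z$, $Z$ is called a spectral factor of $F$ if $Z$ is analytic in the open right half-plane and $Z(\lambda)$ has full row rank for every $\lambda$ in the open right half-plane. $\mathcal{L}_2^{\rm loc}$ denotes locally square-integrable functions; the differential equation is interpreted in the weak sense. No controllability or observability assumption is made. *)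

theory Defs
  imports "HOL-Analysis.Analysis" "HOL-Probability.Probability"
    "Jordan_Normal_Form.DL_Rank"
begin

definition cmat :: "real mat \<Rightarrow> complex mat" where
  "cmat M = map_mat complex_of_real M"

text \<open>Resolvent (s I - A)^{-1}, computed via the adjugate; meaningful when
  det (s I - A) is nonzero.\<close>
definition resolvent :: "real mat \<Rightarrow> complex \<Rightarrow> complex mat" where
  "resolvent A s =
     (1 / Determinant.det (s \<cdot>\<^sub>m 1\<^sub>m (dim_row A) - cmat A))
       \<cdot>\<^sub>m adj_mat (s \<cdot>\<^sub>m 1\<^sub>m (dim_row A) - cmat A)"

definition transfer :: "real mat \<Rightarrow> real mat \<Rightarrow> real mat \<Rightarrow> real mat \<Rightarrow> complex \<Rightarrow> complex mat" where
  "transfer A B C D s = cmat D + cmat C * resolvent A s * cmat B"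

definition para :: "(complex \<Rightarrow> complex mat) \<Rightarrow> complex \<Rightarrow> complex mat" where
  "para G s = transpose_mat (G (- s))"

text \<open>Points where the state-space formulas (with matrix A) for G(s) or G^star(s) may be
  undefined: eigenvalues of A and their negatives (a finite set).\<close>
definition ss_poles :: "real mat \<Rightarrow> complex set" where
  "ss_poles A = {s. Determinant.det (s \<cdot>\<^sub>m 1\<^sub>m (dim_row A) - cmat A) = 0
                  \<or> Determinant.det ((- s) \<cdot>\<^sub>m 1\<^sub>m (dim_row A) - cmat A) = 0}"

text \<open>Z (an r x k rational matrix, given by a formula valid outside the finite set P)
  is a spectral factor of F: F = Z^star Z as rational functions, and Z is analytic in the
  open right half-plane (i.e. extends holomorphically there) with full row rank at every
  point of the open right half-plane.\<close>
definition spectral_factor ::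
  "nat \<Rightarrow> nat \<Rightarrow> complex set \<Rightarrow> (complex \<Rightarrow> complex mat) \<Rightarrow> (complex \<Rightarrow> complex mat) \<Rightarrow> bool" where
  "spectral_factor r k P Z F \<longleftrightarrow>
     finite P \<and>
     (\<forall>s. s \<notin> P \<longrightarrow> para Z s * Z s = F s) \<and>
     (\<exists>G. (\<forall>i<r. \<forall>j<k. (\<lambda>s. G s $$ (i, j)) holomorphic_on {s. 0 < Re s}) \<and>
          (\<forall>s. 0 < Re s \<longrightarrow> G s \<in> carrier_mat r k \<and> vec_space.rank r (G s) = r) \<and>
          (\<forall>s. 0 < Re s \<and> s \<notin> P \<longrightarrow> G s = Z s))"

definition L2loc :: "nat \<Rightarrow> (real \<Rightarrow> real vec) \<Rightarrow> bool" where
  "L2loc k u \<longleftrightarrow> (\<forall>t. u t \<in> carrier_vec k) \<and>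
     (\<forall>i<k. (\<lambda>t. u t $ i) \<in> borel_measurable lborel \<and>
            (\<forall>a b. set_integrable lborel {a..b} (\<lambda>t. (u t $ i)^2)))"

text \<open>Weak solutions: x is (the absolutely continuous representative) satisfying
  x(t1) - x(t0) = integral of A x + B u, and y = C x + D u almost everywhere.\<close>
definition in_Bs :: "real mat \<Rightarrow> real mat \<Rightarrow> real mat \<Rightarrow> real mat \<Rightarrow>
    (real \<Rightarrow> real vec) \<Rightarrow> (real \<Rightarrow> real vec) \<Rightarrow> (real \<Rightarrow> real vec) \<Rightarrow> bool" where
  "in_Bs A B C D u y x \<longleftrightarrow>
     L2loc (dim_col B) u \<and> L2loc (dim_row C) y \<and> L2loc (dim_row A) x \<and>
     (\<forall>t0 t1. \<forall>i<dim_row A.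
        x t1 $ i - x t0 $ i = (LBINT s=t0..t1. (A *\<^sub>v x s + B *\<^sub>v u s) $ i)) \<and>
     (AE t in lborel. y t = C *\<^sub>v x t + D *\<^sub>v u t)"

definition avail_storage :: "real mat \<Rightarrow> real mat \<Rightarrow> real mat \<Rightarrow> real mat \<Rightarrow> real \<Rightarrow> real vec \<Rightarrow> ereal" where
  "avail_storage A B C D t0 x0 =
     Sup {ereal (LBINT t=t0..t1. y t \<bullet> y t - u t \<bullet> u t) | t1 u y x.
            t0 \<le> t1 \<and> in_Bs A B C D u y x \<and> x t0 = x0}"

definition obs_mat :: "real mat \<Rightarrow> real mat \<Rightarrow> real mat" where
  "obs_mat C A = mat (dim_row C * dim_row A) (dim_row A)
      (\<lambda>(i, j). (C * A ^\<^sub>m (i div dim_row C)) $$ (i mod dim_row C, j))"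

end

theory Submission
  imports Defs "Jordan_Normal_Form.Spectral_Radius"
begin

text \<open>
  Trajectories can be shifted in time, concatenated and superposed. Hence a finite available storage
  satisfies the dissipation inequality and the parallelogram law, so it is a quadratic form
  \<open>x\<^sup>T Q x\<close>, and every positive semidefinite \<open>X\<close> with the dissipation inequality dominates it.
  For a constant input the infinitesimal dissipation inequality says that a block matrix in \<open>Q\<close> is
  positive semidefinite; a rank factorization of it yields \<open>L\<close> and \<open>W\<close>.

  The spectral factor condition becomes: no \<open>v \<noteq> 0\<close> satisfies \<open>v\<^sup>T Z(\<lambda>) = 0\<close> with \<open>Re \<lambda> > 0\<close>. Such a
  \<open>v\<close> comes with \<open>p\<close> solving \<open>p\<^sup>T (\<lambda> I - A) = v\<^sup>T L\<close>, \<open>p\<^sup>T B = - v\<^sup>T W\<close>, and a small multiple of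
  \<open>Re (p p\<^sup>*)\<close> could be subtracted from \<open>Q\<close> without losing dissipativity, against minimality.
  Conversely, if \<open>X\<close> satisfies the conditions and \<open>X - Q = S\<^sup>T S \<noteq> 0\<close>, then \<open>y = S x\<close> obeys an equation
  \<open>y' = Ah y + Gm (L x + W u)\<close>, and a left eigenvector of \<open>Ah\<close> produces such a pair \<open>(p, v)\<close>.
  Unobservable unstable modes do not interfere: they lie in the kernel of \<open>X\<close> and cancel in \<open>Z\<close>.
\<close>

unbundle no inner_syntax and no vec_syntax

section \<open>Vectors, matrices and positive semidefinite forms\<close>

text \<open>Two degeneracies shape the argument. \<open>I - D^T D\<close> may be singular, so the
  storage matrix need not solve a Riccati equation; the output \<open>L x + W u\<close> of a rank
  factorization replaces it, and independence of the rows of \<open>(L W)\<close> makes a left null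
  pair with \<open>p = 0\<close> trivial. Moreover \<open>A\<close> may have eigenvalues in the
  right half-plane, where the state-space formula for \<open>Z\<close> breaks down. Hence the rank
  condition is expressed by pairs \<open>(p, v)\<close> with \<open>p\<close> vanishing on the
  kernel of \<open>X\<close>, and analyticity comes from a modified \<open>A\<close> whose resolvent
  exists on the whole open right half-plane. The inequality for \<open>y = S x\<close> can be tested
  freely only once \<open>(S x, L x + W u)\<close> is known to take all values. An annihilator of
  these values would itself give a left null pair at some real \<lambda> > 0, so the rank condition
  is used a second time here. The matrices are real and \<lambda> = \<alpha> + i \<beta> is complex,
  so vectors occur in pairs of real and imaginary parts, and multiplication by \<lambda> becomes the
  map \<open>(a, b)\<close> to
  \<open>(\<alpha> a - \<beta> b, \<beta> a + \<alpha> b)\<close>.\<close>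

lemma sp_add_left: "dim_vec a = dim_vec c \<Longrightarrow> dim_vec b = dim_vec c \<Longrightarrow> (a + b) \<bullet> c = a \<bullet> c + b \<bullet> c"
  for a b c :: "'a::comm_ring_1 vec"
  by (rule add_scalar_prod_distrib[of _ "dim_vec c"]) (auto intro!: carrier_vecI carrier_matI)

lemma sp_add_right: "dim_vec b = dim_vec a \<Longrightarrow> dim_vec c = dim_vec a \<Longrightarrow> a \<bullet> (b + c) = a \<bullet> b + a \<bullet> c"
  for a b c :: "'a::comm_ring_1 vec"
  by (rule scalar_prod_add_distrib[of _ "dim_vec a"]) (auto intro!: carrier_vecI carrier_matI)

lemma sp_minus_left: "dim_vec a = dim_vec c \<Longrightarrow> dim_vec b = dim_vec c \<Longrightarrow> (a - b) \<bullet> c = a \<bullet> c - b \<bullet> c"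
  for a b c :: "'a::comm_ring_1 vec"
  by (rule minus_scalar_prod_distrib[of _ "dim_vec c"]) (auto intro!: carrier_vecI carrier_matI)

lemma sp_minus_right: "dim_vec b = dim_vec a \<Longrightarrow> dim_vec c = dim_vec a \<Longrightarrow> a \<bullet> (b - c) = a \<bullet> b - a \<bullet> c"
  for a b c :: "'a::comm_ring_1 vec"
  by (rule scalar_prod_minus_distrib[of _ "dim_vec a"]) (auto intro!: carrier_vecI carrier_matI)

lemma sp_comm: "dim_vec a = dim_vec b \<Longrightarrow> a \<bullet> b = b \<bullet> a"
  for a b :: "'a::comm_ring_1 vec"
  by (rule comm_scalar_prod[of _ "dim_vec b"]) (auto intro!: carrier_vecI carrier_matI)

lemma mv_add: "dim_vec x = dim_col A \<Longrightarrow> dim_vec y = dim_col A \<Longrightarrow> A *\<^sub>v (x + y) = A *\<^sub>v x + A *\<^sub>v y"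
  for A :: "'a::comm_ring_1 mat"
  by (rule mult_add_distrib_mat_vec[of _ "dim_row A" "dim_col A"]) (auto intro!: carrier_vecI carrier_matI)

lemma mv_minus: "dim_vec x = dim_col A \<Longrightarrow> dim_vec y = dim_col A \<Longrightarrow> A *\<^sub>v (x - y) = A *\<^sub>v x - A *\<^sub>v y"
  for A :: "'a::comm_ring_1 mat"
  by (rule mult_minus_distrib_mat_vec[of _ "dim_row A" "dim_col A"]) (auto intro!: carrier_vecI carrier_matI)

lemma mv_smult: "dim_vec x = dim_col A \<Longrightarrow> A *\<^sub>v (k \<cdot>\<^sub>v x) = k \<cdot>\<^sub>v (A *\<^sub>v x)"
  for A :: "'a::comm_ring_1 mat"
  by (intro eq_vecI) (auto simp: scalar_prod_def sum_distrib_left ac_simps)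

lemma mv_mult: "dim_row B = dim_col A \<Longrightarrow> dim_vec x = dim_col B \<Longrightarrow> (A * B) *\<^sub>v x = A *\<^sub>v (B *\<^sub>v x)"
  for A :: "'a::comm_ring_1 mat"
  by (rule assoc_mult_mat_vec[of _ "dim_row A" "dim_col A" _ "dim_col B"]) (auto intro!: carrier_vecI carrier_matI)

lemma mv_madd: "dim_row A = dim_row B \<Longrightarrow> dim_col A = dim_col B \<Longrightarrow> dim_vec x = dim_col B \<Longrightarrow> (A + B) *\<^sub>v x = A *\<^sub>v x + B *\<^sub>v x"
  for A :: "'a::comm_ring_1 mat"
  by (rule add_mult_distrib_mat_vec[of _ "dim_row B" "dim_col B"]) (auto intro!: carrier_vecI carrier_matI)

lemma mv_mminus: "dim_row A = dim_row B \<Longrightarrow> dim_col A = dim_col B \<Longrightarrow> dim_vec x = dim_col B \<Longrightarrow> (A - B) *\<^sub>v x = A *\<^sub>v x - B *\<^sub>v x"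
  for A :: "'a::comm_ring_1 mat"
  by (rule minus_mult_distrib_mat_vec[of _ "dim_row B" "dim_col B"]) (auto intro!: carrier_vecI carrier_matI)

lemma mv_msmult: "dim_vec x = dim_col A \<Longrightarrow> (k \<cdot>\<^sub>m A) *\<^sub>v x = k \<cdot>\<^sub>v (A *\<^sub>v x)"
  for A :: "'a::comm_ring_1 mat"
  by (intro eq_vecI) (auto simp: scalar_prod_def sum_distrib_left ac_simps)

lemma mv_transpose: "dim_vec x = dim_col A \<Longrightarrow> dim_vec y = dim_row A \<Longrightarrow> (transpose_mat A *\<^sub>v y) \<bullet> x = y \<bullet> (A *\<^sub>v x)"
  for A :: "'a::comm_ring_1 mat"
  by (rule transpose_vec_mult_scalar[of _ "dim_row A" "dim_col A"]) (auto intro!: carrier_vecI carrier_matI)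

lemma mv_transpose': "dim_vec x = dim_col A \<Longrightarrow> dim_vec y = dim_row A \<Longrightarrow> x \<bullet> (transpose_mat A *\<^sub>v y) = (A *\<^sub>v x) \<bullet> y"
  for A :: "'a::comm_ring_1 mat"
  using mv_transpose[of x A y] sp_comm[of x "transpose_mat A *\<^sub>v y"] sp_comm[of y "A *\<^sub>v x"] by simp

lemmas mv_simps = sp_add_left sp_add_right sp_minus_left sp_minus_right mv_add mv_minus mv_smult
  mv_mult mv_madd mv_mminus mv_msmult

lemma sp_sum: "x \<bullet> y = (\<Sum>i<dim_vec y. x $ i * y $ i)"
  by (simp add: scalar_prod_def atLeast0LessThan)

lemma mv_index: "i < dim_row A \<Longrightarrow> dim_vec x = dim_col A \<Longrightarrow> (A *\<^sub>v x) $ i = (\<Sum>j<dim_col A. A $$ (i,j) * x $ j)"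
  by (simp add: sp_sum)

lemma sp_self_nonneg: "0 \<le> x \<bullet> x" for x :: "real vec"
  by (simp add: sp_sum sum_nonneg)

lemma sp_self_eq_0: "x \<bullet> x = 0 \<longleftrightarrow> x = 0\<^sub>v (dim_vec x)" for x :: "real vec"
  by (auto simp: sp_sum sum_nonneg_eq_0_iff Matrix.vec_eq_iff)

lemma vec_eq_sp:
  fixes x :: "'a::comm_ring_1 vec"
  assumes "x \<in> carrier_vec k" "y \<in> carrier_vec k" "\<And>z. z \<in> carrier_vec k \<Longrightarrow> x \<bullet> z = y \<bullet> z"
  shows "x = y"
proof (rule eq_vecI)
  show "dim_vec x = dim_vec y" using assms by simp
  fix i assume "i < dim_vec y"
  then show "x $ i = y $ i" using assms(3)[of "unit_vec k i"] assms(1,2) by auto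
qed

lemma mat_eq_mv:
  fixes A :: "'a::comm_ring_1 mat"
  assumes "A \<in> carrier_mat r k" "B \<in> carrier_mat r k" "\<And>z. z \<in> carrier_vec k \<Longrightarrow> A *\<^sub>v z = B *\<^sub>v z"
  shows "A = B"
proof (rule eq_matI)
  fix i j assume ij: "i < dim_row B" "j < dim_col B"
  have "(A *\<^sub>v unit_vec k j) $ i = (B *\<^sub>v unit_vec k j) $ i" using assms(3)[of "unit_vec k j"] by simp
  then show "A $$ (i,j) = B $$ (i,j)" using ij assms(1,2) by simp
qed (use assms in auto)

section \<open>Finite families of linear functionals\<close>

text \<open>Induction on the number of functionals. If \<open>T p\<close> does not vanish on the
  common kernel of its predecessors, some \<open>x0\<close> there has
  \<open>T p x0 \<noteq> 0\<close>, and \<open>f - g * T p\<close> with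
  \<open>g = f x0 / T p x0\<close> satisfies the induction hypothesis. The vector space is a set
  \<open>V\<close> with a single operation \<open>comb c x y\<close>, standing for
  \<open>x + c y\<close>, because vectors of a fixed dimension do not form a type; later
  \<open>V\<close> consists of pairs of a state and an input.\<close>

lemma functional_in_span:
  fixes T :: "nat \<Rightarrow> 'v \<Rightarrow> 'a::field" and comb :: "'a \<Rightarrow> 'v \<Rightarrow> 'v \<Rightarrow> 'v"
  assumes cl: "\<And>c x y. x \<in> V \<Longrightarrow> y \<in> V \<Longrightarrow> comb c x y \<in> V"
    and T: "\<And>a c x y. a < p \<Longrightarrow> x \<in> V \<Longrightarrow> y \<in> V \<Longrightarrow> T a (comb c x y) = T a x + c * T a y"
    and f: "\<And>c x y. x \<in> V \<Longrightarrow> y \<in> V \<Longrightarrow> f (comb c x y) = f x + c * f y"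
    and ker: "\<And>x. x \<in> V \<Longrightarrow> (\<forall>a<p. T a x = 0) \<Longrightarrow> f x = 0"
  shows "\<exists>y. \<forall>x\<in>V. f x = (\<Sum>a<p. y a * T a x)"
  using T f ker
proof (induction p arbitrary: f)
  case 0
  then show ?case by auto
next
  case (Suc p)
  show ?case
  proof (cases "\<forall>x\<in>V. (\<forall>a<p. T a x = 0) \<longrightarrow> T p x = 0")
    case True
    then have "\<exists>y. \<forall>x\<in>V. f x = (\<Sum>a<p. y a * T a x)"
    proof (intro Suc.IH)
      fix x assume "x \<in> V" "\<forall>a<p. T a x = 0"
      then show "f x = 0" using Suc.prems(3)[of x] True less_Suc_eq by metis
    qed (simp_all add: Suc.prems(1,2))
    then obtain y where y: "\<forall>x\<in>V. f x = (\<Sum>a<p. y a * T a x)" by (elim exE)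
    show ?thesis
    proof (intro exI[of _ "y(p := 0)"] ballI)
      fix x assume "x \<in> V"
      then show "f x = (\<Sum>a<Suc p. (y(p := 0)) a * T a x)" using y by simp
    qed
  next
    case False
    then obtain x0 where x0: "x0 \<in> V" "\<forall>a<p. T a x0 = 0" "T p x0 \<noteq> 0" by auto
    define g where "g = f x0 / T p x0"
    have "\<exists>y. \<forall>x\<in>V. f x - g * T p x = (\<Sum>a<p. y a * T a x)"
    proof (intro Suc.IH)
      fix x assume x: "x \<in> V" "\<forall>a<p. T a x = 0"
      \<comment> \<open>Moving along \<open>x0\<close> cancels the value of \<open>T p\<close> and
        leaves the other functionals at 0.\<close>
      define x' where "x' = comb (- T p x / T p x0) x x0"
      have x': "x' \<in> V" using cl x x0 by (auto simp: x'_def)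
      have "f x' = 0"
      proof (rule Suc.prems(3)[OF x'], intro allI impI)
        fix a assume "a < Suc p"
        then show "T a x' = 0" using x x0 Suc.prems(1)[of a x x0] by (auto simp: x'_def less_Suc_eq)
      qed
      then show "f x - g * T p x = 0"
        using Suc.prems(2)[OF x(1) x0(1)] by (simp add: x'_def g_def)
    next
      fix c x y assume "x \<in> V" "y \<in> V"
      then show "f (comb c x y) - g * T p (comb c x y) = f x - g * T p x + c * (f y - g * T p y)"
        using Suc.prems(1)[of p x y] Suc.prems(2)[of x y] by (simp add: algebra_simps)
    qed (simp_all add: Suc.prems(1))
    then obtain y where y: "\<forall>x\<in>V. f x - g * T p x = (\<Sum>a<p. y a * T a x)" by (elim exE)
    show ?thesis
    proof (intro exI[of _ "y(p := g)"] ballI)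
      fix x assume "x \<in> V"
      then have "f x - g * T p x = (\<Sum>a<p. y a * T a x)" using y by simp
      then show "f x = (\<Sum>a<Suc p. (y(p := g)) a * T a x)" by (simp add: algebra_simps)
    qed
  qed
qed

text \<open>Without a linear relation, \<open>T p\<close> is not a combination of its predecessors,
  so by \<open>functional_in_span\<close> some point is killed by them but not by
  \<open>T p\<close>. A multiple of it corrects the last value without disturbing the
  others.\<close>

lemma annihilator_or_surjective:
  fixes T :: "nat \<Rightarrow> 'v \<Rightarrow> 'a::field" and comb :: "'a \<Rightarrow> 'v \<Rightarrow> 'v \<Rightarrow> 'v"
  assumes cl: "\<And>c x y. x \<in> V \<Longrightarrow> y \<in> V \<Longrightarrow> comb c x y \<in> V" and ne: "V \<noteq> {}"
    and T: "\<And>a c x y. a < p \<Longrightarrow> x \<in> V \<Longrightarrow> y \<in> V \<Longrightarrow> T a (comb c x y) = T a x + c * T a y"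
    and noann: "\<And>y. (\<forall>x\<in>V. (\<Sum>a<p. y a * T a x) = 0) \<Longrightarrow> \<forall>a<p. y a = 0"
  shows "\<exists>x\<in>V. \<forall>a<p. T a x = c a"
  using T noann
proof (induction p)
  case 0
  then show ?case using ne by auto
next
  case (Suc p)
  have "\<exists>x\<in>V. \<forall>a<p. T a x = c a"
  proof (rule Suc.IH)
    fix y assume y: "\<forall>x\<in>V. (\<Sum>a<p. y a * T a x) = 0"
    have "\<forall>a<Suc p. (y(p := 0)) a = 0" using y by (intro Suc.prems(2)) auto
    then show "\<forall>a<p. y a = 0" by (auto simp: less_Suc_eq split: if_splits)
  qed (use Suc.prems in auto)
  then obtain x where x: "x \<in> V" "\<forall>a<p. T a x = c a" by auto
  have "\<not> (\<forall>x\<in>V. (\<forall>a<p. T a x = 0) \<longrightarrow> T p x = 0)"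
  proof
    assume k: "\<forall>x\<in>V. (\<forall>a<p. T a x = 0) \<longrightarrow> T p x = 0"
    have "\<exists>y. \<forall>x\<in>V. T p x = (\<Sum>a<p. y a * T a x)"
      by (rule functional_in_span[where comb = comb]) (use cl k in \<open>auto simp: Suc.prems(1)\<close>)
    then obtain y where y: "\<forall>x\<in>V. T p x = (\<Sum>a<p. y a * T a x)" by auto
    \<comment> \<open>The representation of \<open>T p\<close> by its predecessors is a relation
      with last coefficient -1.\<close>
    have "\<forall>a<Suc p. (y(p := -1)) a = 0" using y by (intro Suc.prems(2)) auto
    then show False by auto
  qed
  then obtain x0 where x0: "x0 \<in> V" "\<forall>a<p. T a x0 = 0" "T p x0 \<noteq> 0" by auto
  show ?case
  proof (intro bexI allI impI)
    show "comb ((c p - T p x) / T p x0) x x0 \<in> V" using cl x x0 by auto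
    fix a assume "a < Suc p"
    then show "T a (comb ((c p - T p x) / T p x0) x x0) = c a"
      using x x0 Suc.prems(1)[of a x x0] by (auto simp: less_Suc_eq)
  qed
qed

lemma mv_surj:
  fixes R :: "'a::field mat"
  assumes R: "R \<in> carrier_mat r k"
    and ind: "\<And>v. v \<in> carrier_vec r \<Longrightarrow> transpose_mat R *\<^sub>v v = 0\<^sub>v k \<Longrightarrow> v = 0\<^sub>v r"
    and c: "c \<in> carrier_vec r"
  shows "\<exists>x\<in>carrier_vec k. R *\<^sub>v x = c"
proof -
  have "\<exists>x\<in>carrier_vec k. \<forall>a<r. (R *\<^sub>v x) $ a = c $ a"
  proof (rule annihilator_or_surjective[where comb = "\<lambda>c x y. x + c \<cdot>\<^sub>v y"])
    fix y :: "nat \<Rightarrow> 'a" assume y: "\<forall>x\<in>carrier_vec k. (\<Sum>a<r. y a * (R *\<^sub>v x) $ a) = 0"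
    have "vec r y = 0\<^sub>v r"
    proof (rule ind)
      show "transpose_mat R *\<^sub>v vec r y = 0\<^sub>v k"
      proof (rule vec_eq_sp)
        fix z :: "'a vec" assume z: "z \<in> carrier_vec k"
        have "(transpose_mat R *\<^sub>v vec r y) \<bullet> z = vec r y \<bullet> (R *\<^sub>v z)"
          using R z by (intro mv_transpose) auto
        also have "\<dots> = (\<Sum>a<r. y a * (R *\<^sub>v z) $ a)" using R by (simp add: sp_sum)
        finally show "(transpose_mat R *\<^sub>v vec r y) \<bullet> z = 0\<^sub>v k \<bullet> z" using y z by simp
      qed (use R in auto)
    qed auto
    then have "vec r y $ a = 0" if "a < r" for a using that by simp
    then show "\<forall>a<r. y a = 0" by simp
  qed (use R in \<open>auto simp: mv_simps dest: equals0D[where a = "0\<^sub>v k"]\<close>)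
  then show ?thesis using R c by (auto intro!: bexI eq_vecI)
qed

lemma right_inverse:
  fixes R :: "'a::field mat"
  assumes R: "R \<in> carrier_mat r k"
    and ind: "\<And>v. v \<in> carrier_vec r \<Longrightarrow> transpose_mat R *\<^sub>v v = 0\<^sub>v k \<Longrightarrow> v = 0\<^sub>v r"
  shows "\<exists>P\<in>carrier_mat k r. R * P = 1\<^sub>m r"
proof -
  have "\<forall>j. \<exists>x\<in>carrier_vec k. R *\<^sub>v x = unit_vec r j" using mv_surj[OF R ind] by auto
  then obtain X where X: "\<And>j. X j \<in> carrier_vec k" "\<And>j. R *\<^sub>v X j = unit_vec r j" by metis
  define P where "P = mat k r (\<lambda>(i,j). X j $ i)"
  have "R * P = 1\<^sub>m r"
  proof (rule eq_matI)
    fix i j assume ij: "i < dim_row (1\<^sub>m r :: 'a mat)" "j < dim_col (1\<^sub>m r :: 'a mat)"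
    have "col P j = X j" using ij X(1)[of j] by (intro eq_vecI) (auto simp: P_def)
    then have "(R * P) $$ (i,j) = (R *\<^sub>v X j) $ i" using ij R by (simp add: P_def)
    then show "(R * P) $$ (i,j) = 1\<^sub>m r $$ (i,j)" using X ij by auto
  qed (use R in \<open>auto simp: P_def\<close>)
  then show ?thesis by (auto simp: P_def)
qed

section \<open>Positive semidefinite matrices and rank factorization\<close>

definition psd :: "nat \<Rightarrow> real mat \<Rightarrow> bool" where
  "psd k M \<longleftrightarrow> M \<in> carrier_mat k k \<and> transpose_mat M = M \<and> (\<forall>z\<in>carrier_vec k. 0 \<le> z \<bullet> (M *\<^sub>v z))"

lemma sym_sp:
  fixes M :: "'a::comm_ring_1 mat"
  assumes "M \<in> carrier_mat k k" "transpose_mat M = M" "x \<in> carrier_vec k" "y \<in> carrier_vec k"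
  shows "x \<bullet> (M *\<^sub>v y) = y \<bullet> (M *\<^sub>v x)"
  using mv_transpose[of y M x] assms sp_comm[of "M *\<^sub>v x" y] by auto

lemma unit_form: "M \<in> carrier_mat k k \<Longrightarrow> i < k \<Longrightarrow> j < k \<Longrightarrow> unit_vec k i \<bullet> (M *\<^sub>v unit_vec k j) = M $$ (i,j)"
  for M :: "'a::comm_ring_1 mat"
  by (subst scalar_prod_left_unit[of _ k]) auto

lemma psd_diag_nonneg: "psd k M \<Longrightarrow> i < k \<Longrightarrow> 0 \<le> M $$ (i,i)"
  unfolding psd_def using unit_form[of M k i i] by (metis unit_vec_carrier)

text \<open>The form at \<open>y + t x\<close> is affine in \<open>t\<close> when it vanishes at
  \<open>x\<close>, and a nonnegative affine function is constant.\<close>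

lemma psd_cauchy_0:
  assumes M: "psd k M" and x: "x \<in> carrier_vec k" and y: "y \<in> carrier_vec k" and 0: "x \<bullet> (M *\<^sub>v x) = 0"
  shows "y \<bullet> (M *\<^sub>v x) = 0"
proof (rule ccontr)
  define b where "b = y \<bullet> (M *\<^sub>v x)"
  define a where "a = y \<bullet> (M *\<^sub>v y)"
  assume "y \<bullet> (M *\<^sub>v x) \<noteq> 0"
  then have b: "b \<noteq> 0" by (simp add: b_def)
  have Mc: "M \<in> carrier_mat k k" "transpose_mat M = M" using M by (auto simp: psd_def)
  have "0 \<le> (y + t \<cdot>\<^sub>v x) \<bullet> (M *\<^sub>v (y + t \<cdot>\<^sub>v x))" for t using M x y by (simp add: psd_def)
  moreover have "(y + t \<cdot>\<^sub>v x) \<bullet> (M *\<^sub>v (y + t \<cdot>\<^sub>v x)) = a + 2 * t * b" for t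
    using Mc x y 0 sym_sp[OF Mc x y] by (simp add: mv_simps a_def b_def algebra_simps)
  ultimately have *: "0 \<le> a + 2 * t * b" for t by metis
  \<comment> \<open>At this \<open>t\<close> the affine function has the value -1.\<close>
  show False using *[of "- (a + 1) / (2 * b)"] b by (simp add: field_simps)
qed

lemma psd_ker: "psd k M \<Longrightarrow> x \<in> carrier_vec k \<Longrightarrow> x \<bullet> (M *\<^sub>v x) = 0 \<Longrightarrow> M *\<^sub>v x = 0\<^sub>v k"
  using psd_cauchy_0[of k M x] by (intro vec_eq_sp[of _ k]) (auto simp: psd_def, metis carrier_matD(1) carrier_vecD dim_mult_mat_vec sp_comm)

text \<open>Cholesky elimination, by induction on the number of nonzero diagonal entries. With zero
  diagonal the matrix vanishes. Otherwise a pivot \<open>m = M $$ (i,i)\<close> is split off, the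
  Schur complement is again positive semidefinite, and the pivot column divided by
  \<open>sqrt m\<close> becomes a new row of \<open>F\<close>. The last conjunct, independence of
  the rows of \<open>F\<close>, is what gives \<open>F\<close> a right inverse and later rules out
  trivial null vectors.\<close>

lemma rank_factorization:
  "psd k M \<Longrightarrow> \<exists>r F. F \<in> carrier_mat r k \<and> M = transpose_mat F * F \<and>
     (\<forall>v\<in>carrier_vec r. transpose_mat F *\<^sub>v v = 0\<^sub>v k \<longrightarrow> v = 0\<^sub>v r)"
proof (induction "card {i. i < k \<and> M $$ (i,i) \<noteq> 0}" arbitrary: M rule: less_induct)
  case less
  have M: "M \<in> carrier_mat k k" "transpose_mat M = M" using less.prems by (auto simp: psd_def)
  have sym: "M $$ (i,j) = M $$ (j,i)" if "i < k" "j < k" for i j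
    using M that by (metis carrier_matD index_transpose_mat(1))
  have z: "M $$ (j,i) = 0" if "i < k" "j < k" "M $$ (i,i) = 0" for i j
    using psd_cauchy_0[OF less.prems, of "unit_vec k i" "unit_vec k j"] that unit_form[OF M(1)] by simp
  show ?case
  proof (cases "\<exists>i<k. M $$ (i,i) \<noteq> 0")
    case False
    define F where "F = (0\<^sub>m 0 k :: real mat)"
    have "M = transpose_mat F * F" using False z M by (intro eq_matI) (auto simp: F_def sp_sum)
    then show ?thesis by (intro exI[of _ 0] exI[of _ F]) (auto simp: F_def)
  next
    case True
    then obtain i where i: "i < k" "M $$ (i,i) \<noteq> 0" by auto
    define m where "m = M $$ (i,i)"
    have m: "m > 0" using psd_diag_nonneg[OF less.prems i(1)] i by (simp add: m_def)
    \<comment> \<open>The Schur complement, kept at size \<open>k\<close>: its row and column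
      \<open>i\<close> are zero.\<close>
    define M1 where "M1 = mat k k (\<lambda>(a,b). M $$ (a,b) - M $$ (a,i) * M $$ (b,i) / m)"
    have M1c: "M1 \<in> carrier_mat k k" by (simp add: M1_def)
    have M1: "psd k M1" unfolding psd_def
    proof (intro conjI ballI)
      show "transpose_mat M1 = M1"
      proof (rule eq_matI)
        fix a b assume "a < dim_row M1" "b < dim_col M1"
        then have "a < k" "b < k" by (simp_all add: M1_def)
        then show "transpose_mat M1 $$ (a,b) = M1 $$ (a,b)" using sym[of a b] by (simp add: M1_def mult.commute)
      qed (simp_all add: M1_def)
      fix x :: "real vec" assume x: "x \<in> carrier_vec k"
      define c where "c = unit_vec k i \<bullet> (M *\<^sub>v x)"
      have c: "c = (\<Sum>a<k. x $ a * M $$ (a,i))"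
      proof -
        have "c = (\<Sum>a<k. M $$ (i,a) * x $ a)" unfolding c_def using M(1) x i(1) by (subst scalar_prod_left_unit[of _ k]) (auto simp: sp_sum)
        also have "\<dots> = (\<Sum>a<k. x $ a * M $$ (a,i))" using sym[OF i(1)] by (intro sum.cong refl) simp
        finally show ?thesis .
      qed
      have "x \<bullet> (M1 *\<^sub>v x) = (\<Sum>a<k. x $ a * (\<Sum>b<k. M1 $$ (a,b) * x $ b))"
        using x M1c by (simp add: sp_sum)
      also have "\<dots> = (\<Sum>a<k. x $ a * (\<Sum>b<k. M $$ (a,b) * x $ b) - (x $ a * M $$ (a,i)) * (c / m))"
      proof (rule sum.cong[OF refl])
        fix a assume "a \<in> {..<k}"
        then have "(\<Sum>b<k. M1 $$ (a,b) * x $ b) = (\<Sum>b<k. M $$ (a,b) * x $ b - (x $ b * M $$ (b,i)) * (M $$ (a,i) / m))"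
          by (intro sum.cong refl) (simp add: M1_def algebra_simps)
        also have "\<dots> = (\<Sum>b<k. M $$ (a,b) * x $ b) - c * (M $$ (a,i) / m)"
          unfolding sum_subtractf c by (simp only: sum_distrib_right)
        finally have e: "(\<Sum>b<k. M1 $$ (a,b) * x $ b) = (\<Sum>b<k. M $$ (a,b) * x $ b) - c * (M $$ (a,i) / m)" .
        show "x $ a * (\<Sum>b<k. M1 $$ (a,b) * x $ b) = x $ a * (\<Sum>b<k. M $$ (a,b) * x $ b) - (x $ a * M $$ (a,i)) * (c / m)"
          unfolding e by (simp add: right_diff_distrib)
      qed
      also have "\<dots> = (\<Sum>a<k. x $ a * (\<Sum>b<k. M $$ (a,b) * x $ b)) - c * (c / m)"
        unfolding sum_subtractf sum_distrib_right[symmetric] c[symmetric] ..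
      also have "(\<Sum>a<k. x $ a * (\<Sum>b<k. M $$ (a,b) * x $ b)) = x \<bullet> (M *\<^sub>v x)"
        using x M by (simp add: sp_sum)
      finally have 1: "x \<bullet> (M1 *\<^sub>v x) = x \<bullet> (M *\<^sub>v x) - c * c / m" by simp
      have xm: "x \<bullet> (M *\<^sub>v unit_vec k i) = c" using sym_sp[OF M x, of "unit_vec k i"] by (simp add: c_def)
      \<comment> \<open>The minimiser of the form of \<open>M\<close> on the line
        \<open>x + t * unit_vec k i\<close>; the minimum is the form of \<open>M1\<close> at
        \<open>x\<close>.\<close>
      define t where "t = - c / m"
      have "0 \<le> (x + t \<cdot>\<^sub>v unit_vec k i) \<bullet> (M *\<^sub>v (x + t \<cdot>\<^sub>v unit_vec k i))"
        using less.prems x by (simp add: psd_def)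
      also have "\<dots> = x \<bullet> (M *\<^sub>v x) + t * c + t * (c + t * m)"
        using x M(1) xm unit_form[OF M(1) i(1) i(1), folded m_def] c_def[symmetric]
        by (simp add: mv_simps del: scalar_prod_left_unit scalar_prod_right_unit index_mult_mat_vec)
      also have "\<dots> = x \<bullet> (M *\<^sub>v x) - c * c / m" using m by (simp add: t_def)
      finally show "0 \<le> x \<bullet> (M1 *\<^sub>v x)" using 1 by simp
    qed (rule M1c)
    have M1ii: "M1 $$ (i,i) = 0" using i m by (simp add: M1_def m_def)
    have "{j. j < k \<and> M1 $$ (j,j) \<noteq> 0} \<subset> {j. j < k \<and> M $$ (j,j) \<noteq> 0}"
    proof
      show "{j. j < k \<and> M1 $$ (j,j) \<noteq> 0} \<subseteq> {j. j < k \<and> M $$ (j,j) \<noteq> 0}"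
      proof (intro subsetI CollectI conjI notI; elim CollectE conjE)
        fix j assume j: "j < k" "M1 $$ (j,j) \<noteq> 0" and 0: "M $$ (j,j) = 0"
        show False using z[OF j(1) i(1) 0] sym[OF i(1) j(1)] j 0 by (simp add: M1_def)
      qed
      show "{j. j < k \<and> M1 $$ (j,j) \<noteq> 0} \<noteq> {j. j < k \<and> M $$ (j,j) \<noteq> 0}" using i M1ii by blast
    qed
    then have "card {j. j < k \<and> M1 $$ (j,j) \<noteq> 0} < card {j. j < k \<and> M $$ (j,j) \<noteq> 0}"
      by (intro psubset_card_mono) auto
    from less.hyps[OF this M1] obtain r F1 where "F1 \<in> carrier_mat r k \<and> M1 = transpose_mat F1 * F1 \<and>
      (\<forall>v\<in>carrier_vec r. transpose_mat F1 *\<^sub>v v = 0\<^sub>v k \<longrightarrow> v = 0\<^sub>v r)" by (elim exE)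
    then have F1: "F1 \<in> carrier_mat r k" "M1 = transpose_mat F1 * F1"
      and ind: "\<And>v. v \<in> carrier_vec r \<Longrightarrow> transpose_mat F1 *\<^sub>v v = 0\<^sub>v k \<Longrightarrow> v = 0\<^sub>v r" by simp_all
    define F where "F = mat (Suc r) k (\<lambda>(a,b). if a < r then F1 $$ (a,b) else M $$ (b,i) / sqrt m)"
    have F: "F \<in> carrier_mat (Suc r) k" by (simp add: F_def)
    have M1e: "M1 $$ (a,b) = (\<Sum>l<r. F1 $$ (l,a) * F1 $$ (l,b))" if "a < k" "b < k" for a b
      using that F1 by (auto simp: sp_sum)
    have "M = transpose_mat F * F"
    proof (rule eq_matI)
      fix a b assume ab: "a < dim_row (transpose_mat F * F)" "b < dim_col (transpose_mat F * F)"
      then have ab': "a < k" "b < k" using F by auto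
      have "(transpose_mat F * F) $$ (a,b) = (\<Sum>l<Suc r. F $$ (l,a) * F $$ (l,b))"
        using F ab' by (simp add: sp_sum)
      also have "\<dots> = M1 $$ (a,b) + M $$ (a,i) / sqrt m * (M $$ (b,i) / sqrt m)"
        using ab' unfolding M1e[OF ab'] sum.lessThan_Suc using ab' by (auto simp: F_def intro!: sum.cong)
      also have "\<dots> = M $$ (a,b)" using ab' m by (simp add: M1_def)
      finally show "M $$ (a,b) = (transpose_mat F * F) $$ (a,b)" ..
    qed (use F M in simp_all)
    moreover have "v = 0\<^sub>v (Suc r)" if v: "v \<in> carrier_vec (Suc r)" and e: "transpose_mat F *\<^sub>v v = 0\<^sub>v k" for v
    proof -
      \<comment> \<open>The zero diagonal entry of \<open>M1\<close> makes column \<open>i\<close>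
        of \<open>F1\<close> vanish. Coordinate \<open>i\<close> of the relation then involves the
        new row alone and gives \<open>v $ r = 0\<close>.\<close>
      have "(\<Sum>l<r. F1 $$ (l,i) * F1 $$ (l,i)) = 0" using M1e[OF i(1) i(1)] M1ii by simp
      then have "\<forall>l\<in>{..<r}. F1 $$ (l,i) * F1 $$ (l,i) = 0" by (subst (asm) sum_nonneg_eq_0_iff) simp_all
      then have F1i: "F1 $$ (l,i) = 0" if "l < r" for l using that by simp
      have ev: "(\<Sum>l<Suc r. F $$ (l,a) * v $ l) = 0" if "a < k" for a
      proof -
        have "(transpose_mat F *\<^sub>v v) $ a = (\<Sum>l<Suc r. F $$ (l,a) * v $ l)"
          using that F v by (simp add: sp_sum)
        then show ?thesis using e that by simp
      qed
      have vr: "v $ r = 0" using ev[OF i(1)] F1i i m by (simp add: F_def m_def)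
      define v' where "v' = vec r (\<lambda>l. v $ l)"
      have "v' = 0\<^sub>v r"
      proof (rule ind)
        show "transpose_mat F1 *\<^sub>v v' = 0\<^sub>v k"
        proof (rule eq_vecI)
          fix a assume "a < dim_vec (0\<^sub>v k :: real vec)"
          then have a: "a < k" by simp
          then have "(transpose_mat F1 *\<^sub>v v') $ a = (\<Sum>l<r. F1 $$ (l,a) * v $ l)"
            using F1 by (simp add: sp_sum v'_def)
          also have "\<dots> = 0" using ev[OF a] vr a by (simp add: F_def)
          finally show "(transpose_mat F1 *\<^sub>v v') $ a = 0\<^sub>v k $ a" using a by simp
        qed (use F1 in auto)
      qed (simp add: v'_def)
      then have "v' $ l = 0" if "l < r" for l using that by simp
      then have "v $ l = 0" if "l < r" for l using that by (simp add: v'_def)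
      then show ?thesis using v vr by (intro eq_vecI) (auto simp: less_Suc_eq)
    qed
    ultimately show ?thesis using F by blast
  qed
qed

lemma mv_zero: "dim_col A = k \<Longrightarrow> A *\<^sub>v 0\<^sub>v k = 0\<^sub>v (dim_row A)"
  for A :: "'a::comm_ring_1 mat"
  by (intro eq_vecI) (auto simp: sp_sum)

lemma psd_cauchy_schwarz:
  assumes M: "psd k M" and x: "x \<in> carrier_vec k" and y: "y \<in> carrier_vec k"
  shows "(x \<bullet> (M *\<^sub>v y))\<^sup>2 \<le> (x \<bullet> (M *\<^sub>v x)) * (y \<bullet> (M *\<^sub>v y))"
proof -
  have Mc: "M \<in> carrier_mat k k" "transpose_mat M = M" using M by (auto simp: psd_def)
  define b where "b = x \<bullet> (M *\<^sub>v y)"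
  define a where "a = x \<bullet> (M *\<^sub>v x)"
  define c where "c = y \<bullet> (M *\<^sub>v y)"
  have "y \<bullet> (M *\<^sub>v x) = b" using sym_sp[OF Mc y x] by (simp add: b_def)
  then have e: "(x + t \<cdot>\<^sub>v y) \<bullet> (M *\<^sub>v (x + t \<cdot>\<^sub>v y)) = a + 2 * t * b + t\<^sup>2 * c" for t
    using Mc x y by (simp add: mv_simps a_def b_def c_def algebra_simps power2_eq_square)
  have q: "0 \<le> a + 2 * t * b + t\<^sup>2 * c" for t
  proof -
    have "0 \<le> (x + t \<cdot>\<^sub>v y) \<bullet> (M *\<^sub>v (x + t \<cdot>\<^sub>v y))" using M x y by (simp add: psd_def)
    then show ?thesis unfolding e .
  qed
  have c0: "0 \<le> c" using M y by (simp add: psd_def c_def)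
  show ?thesis
  proof (cases "c = 0")
    case True
    then have "b = 0" using psd_cauchy_0[OF M y x] by (simp add: b_def c_def)
    then show ?thesis using True by (simp add: a_def b_def c_def)
  next
    case False
    then have c1: "c > 0" using c0 by simp
    have "0 \<le> a + 2 * (- b / c) * b + (- b / c)\<^sup>2 * c" by (rule q)
    also have "\<dots> = a - b\<^sup>2 / c" using c1 by (simp add: field_simps power2_eq_square)
    finally have "b\<^sup>2 \<le> a * c" using c1 by (simp add: field_simps)
    then show ?thesis by (simp add: a_def b_def c_def)
  qed
qed

lemma psd_one: "psd k (1\<^sub>m k)"
  by (auto simp: psd_def sp_self_nonneg)

lemma cauchy_schwarz_vec:
  fixes x y :: "real vec"
  assumes "x \<in> carrier_vec k" "y \<in> carrier_vec k"
  shows "(x \<bullet> y)\<^sup>2 \<le> (x \<bullet> x) * (y \<bullet> y)"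
  using psd_cauchy_schwarz[OF psd_one assms] assms by simp

text \<open>The range of a symmetric matrix is the annihilator of its kernel. With
  \<open>X = F^T F\<close> and a right inverse \<open>P\<close> of \<open>F\<close>, a preimage of
  \<open>p\<close> is \<open>P P^T p\<close>: the difference \<open>z - P F z\<close> lies in the
  kernel, so \<open>p\<close> takes the same value at \<open>z\<close> and at
  \<open>P F z\<close>.\<close>

lemma ker_functional:
  assumes X: "psd k X" and p: "p \<in> carrier_vec k"
    and k: "\<And>z. z \<in> carrier_vec k \<Longrightarrow> X *\<^sub>v z = 0\<^sub>v k \<Longrightarrow> p \<bullet> z = 0"
  shows "\<exists>g\<in>carrier_vec k. X *\<^sub>v g = p"
proof -
  from rank_factorization[OF X] obtain r F where F': "F \<in> carrier_mat r k \<and> X = transpose_mat F * F \<and>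
     (\<forall>v\<in>carrier_vec r. transpose_mat F *\<^sub>v v = 0\<^sub>v k \<longrightarrow> v = 0\<^sub>v r)" by (elim exE)
  then have F: "F \<in> carrier_mat r k" "X = transpose_mat F * F" by auto
  obtain P where P: "P \<in> carrier_mat k r" "F * P = 1\<^sub>m r" using right_inverse[OF F(1)] F' by auto
  have FP: "F *\<^sub>v (P *\<^sub>v v) = v" if "v \<in> carrier_vec r" for v
    using that F(1) P mv_mult[of P F v] by simp
  define g where "g = P *\<^sub>v (transpose_mat P *\<^sub>v p)"
  have g: "g \<in> carrier_vec k" using P p by (simp add: g_def)
  have Xg: "X *\<^sub>v g = transpose_mat F *\<^sub>v (transpose_mat P *\<^sub>v p)"
    using F(1) P p g FP[of "transpose_mat P *\<^sub>v p"] by (simp add: F(2) mv_mult g_def)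
  have "transpose_mat F *\<^sub>v (transpose_mat P *\<^sub>v p) = p"
  proof (rule vec_eq_sp)
    fix z :: "real vec" assume z: "z \<in> carrier_vec k"
    define z' where "z' = z - P *\<^sub>v (F *\<^sub>v z)"
    have z': "z' \<in> carrier_vec k" using z P F(1) by (simp add: z'_def)
    have "F *\<^sub>v z' = 0\<^sub>v r" using FP[of "F *\<^sub>v z"] z P F(1) by (simp add: z'_def mv_simps)
    then have "X *\<^sub>v z' = 0\<^sub>v k" using z' F(1) by (simp add: F(2) mv_mult mv_zero)
    then have "p \<bullet> z' = 0" using k z' by blast
    then have "p \<bullet> z = p \<bullet> (P *\<^sub>v (F *\<^sub>v z))" using z P F(1) p by (simp add: z'_def mv_simps)
    also have "\<dots> = (transpose_mat F *\<^sub>v (transpose_mat P *\<^sub>v p)) \<bullet> z"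
      using z P F(1) p by (simp add: mv_transpose)
    finally show "(transpose_mat F *\<^sub>v (transpose_mat P *\<^sub>v p)) \<bullet> z = p \<bullet> z" ..
  qed (use F(1) P p in auto)
  then show ?thesis using g Xg by auto
qed

section \<open>The three matrix equations as one bilinear identity\<close>

text \<open>The matrix equations are the blocks of a single identity between quadratic forms in
  (state, input), polarised here. Independent arguments on the two sides allow a pairing of
  responses at the frequencies \<open>- s\<close> and \<open>s\<close>; the general ring covers both
  the real identity and its complexification.\<close>

lemma lmi_bilinear:
  fixes A B C D L W X :: "'a::comm_ring_1 mat"
  assumes dims: "A \<in> carrier_mat d d" "B \<in> carrier_mat d n" "C \<in> carrier_mat m d" "D \<in> carrier_mat m n"
    "L \<in> carrier_mat r d" "W \<in> carrier_mat r n" "X \<in> carrier_mat d d" and sym: "transpose_mat X = X"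
    and e1: "- transpose_mat A * X - X * A - transpose_mat C * C = transpose_mat L * L"
    and e2: "- transpose_mat D * C - transpose_mat B * X = transpose_mat W * L"
    and e3: "1\<^sub>m n - transpose_mat D * D = transpose_mat W * W"
    and zu: "z \<in> carrier_vec d" "u \<in> carrier_vec n" "z' \<in> carrier_vec d" "u' \<in> carrier_vec n"
  shows "(L *\<^sub>v z + W *\<^sub>v u) \<bullet> (L *\<^sub>v z' + W *\<^sub>v u') =
    u \<bullet> u' - (C *\<^sub>v z + D *\<^sub>v u) \<bullet> (C *\<^sub>v z' + D *\<^sub>v u')
      - (A *\<^sub>v z + B *\<^sub>v u) \<bullet> (X *\<^sub>v z') - z \<bullet> (X *\<^sub>v (A *\<^sub>v z' + B *\<^sub>v u'))"
proof -
  have LL: "(L *\<^sub>v z) \<bullet> (L *\<^sub>v z') = - ((A *\<^sub>v z) \<bullet> (X *\<^sub>v z')) - z \<bullet> (X *\<^sub>v (A *\<^sub>v z')) - (C *\<^sub>v z) \<bullet> (C *\<^sub>v z')"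
  proof -
    have "(L *\<^sub>v z) \<bullet> (L *\<^sub>v z') = z \<bullet> ((transpose_mat L * L) *\<^sub>v z')"
      using dims zu by (simp add: mv_mult mv_transpose')
    also have "\<dots> = z \<bullet> ((- transpose_mat A * X - X * A - transpose_mat C * C) *\<^sub>v z')" by (simp only: e1)
    also have "\<dots> = - ((A *\<^sub>v z) \<bullet> (X *\<^sub>v z')) - z \<bullet> (X *\<^sub>v (A *\<^sub>v z')) - (C *\<^sub>v z) \<bullet> (C *\<^sub>v z')"
      using dims zu by (simp add: mv_simps mv_transpose')
    finally show ?thesis .
  qed
  have WL: "(W *\<^sub>v u) \<bullet> (L *\<^sub>v z') = - ((D *\<^sub>v u) \<bullet> (C *\<^sub>v z')) - (B *\<^sub>v u) \<bullet> (X *\<^sub>v z')"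
    if "u \<in> carrier_vec n" "z' \<in> carrier_vec d" for u z'
  proof -
    have "(W *\<^sub>v u) \<bullet> (L *\<^sub>v z') = u \<bullet> ((transpose_mat W * L) *\<^sub>v z')"
      using dims that by (simp add: mv_mult mv_transpose')
    also have "\<dots> = u \<bullet> ((- transpose_mat D * C - transpose_mat B * X) *\<^sub>v z')" by (simp only: e2)
    also have "\<dots> = - ((D *\<^sub>v u) \<bullet> (C *\<^sub>v z')) - (B *\<^sub>v u) \<bullet> (X *\<^sub>v z')"
      using dims that by (simp add: mv_simps mv_transpose')
    finally show ?thesis .
  qed
  have WW: "(W *\<^sub>v u) \<bullet> (W *\<^sub>v u') = u \<bullet> u' - (D *\<^sub>v u) \<bullet> (D *\<^sub>v u')"
  proof -
    have "(W *\<^sub>v u) \<bullet> (W *\<^sub>v u') = u \<bullet> ((transpose_mat W * W) *\<^sub>v u')"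
      using dims zu by (simp add: mv_mult mv_transpose')
    also have "\<dots> = u \<bullet> ((1\<^sub>m n - transpose_mat D * D) *\<^sub>v u')" by (simp only: e3)
    also have "\<dots> = u \<bullet> u' - (D *\<^sub>v u) \<bullet> (D *\<^sub>v u')"
      using dims zu by (simp add: mv_simps mv_transpose')
    finally show ?thesis .
  qed
  have c1: "(L *\<^sub>v z) \<bullet> (W *\<^sub>v u') = - ((C *\<^sub>v z) \<bullet> (D *\<^sub>v u')) - z \<bullet> (X *\<^sub>v (B *\<^sub>v u'))"
    using WL[OF zu(4,1)] sp_comm[of "L *\<^sub>v z" "W *\<^sub>v u'"] sp_comm[of "C *\<^sub>v z" "D *\<^sub>v u'"]
      sym_sp[OF dims(7) sym zu(1), of "B *\<^sub>v u'"] dims zu by simp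
  show ?thesis using dims zu by (simp add: mv_simps LL WL[OF zu(2,3)] WW c1 algebra_simps)
qed

section \<open>Eigenvectors and resolvent points of real matrices\<close>

text \<open>\<open>qa\<close> and \<open>qb\<close> are the real and imaginary parts of an
  eigenvector of the complexified matrix, with eigenvalue
  \<open>\<alpha> + i \<beta>\<close>.\<close>

lemma real_eigenvector_pair:
  fixes M :: "real mat"
  assumes M: "M \<in> carrier_mat e e" and e: "0 < e"
  shows "\<exists>\<alpha> \<beta> qa qb. qa \<in> carrier_vec e \<and> qb \<in> carrier_vec e \<and> (qa \<noteq> 0\<^sub>v e \<or> qb \<noteq> 0\<^sub>v e) \<and>
    M *\<^sub>v qa = \<alpha> \<cdot>\<^sub>v qa - \<beta> \<cdot>\<^sub>v qb \<and> M *\<^sub>v qb = \<beta> \<cdot>\<^sub>v qa + \<alpha> \<cdot>\<^sub>v qb"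
proof -
  have cM: "cmat M \<in> carrier_mat e e" using M by (simp add: cmat_def)
  obtain l where "l \<in> spectrum (cmat M)" using spectrum_non_empty[OF cM e] by auto
  then obtain v where v: "v \<in> carrier_vec e" "v \<noteq> 0\<^sub>v e" "cmat M *\<^sub>v v = l \<cdot>\<^sub>v v"
    using cM by (auto simp: spectrum_def eigenvalue_def eigenvector_def)
  define qa qb where "qa = map_vec Re v" and "qb = map_vec Im v"
  have q: "qa \<in> carrier_vec e" "qb \<in> carrier_vec e" using v by (auto simp: qa_def qb_def)
  have ev: "(\<Sum>j<e. complex_of_real (M $$ (i,j)) * v $ j) = l * v $ i" if "i < e" for i
  proof -
    have "(cmat M *\<^sub>v v) $ i = l * v $ i" using v that by simp
    then show ?thesis using that M v(1) by (simp add: sp_sum cmat_def)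
  qed
  have "qa \<noteq> 0\<^sub>v e \<or> qb \<noteq> 0\<^sub>v e"
  proof (rule ccontr)
    assume "\<not> ?thesis"
    then have "qa $ i = 0" "qb $ i = 0" if "i < e" for i using that by auto
    then have "v $ i = 0" if "i < e" for i
      using that v by (auto simp: qa_def qb_def complex_eq_iff)
    then have "v = 0\<^sub>v e" using v by (intro eq_vecI) auto
    then show False using v by simp
  qed
  moreover have "M *\<^sub>v qa = Re l \<cdot>\<^sub>v qa - Im l \<cdot>\<^sub>v qb"
  proof (rule eq_vecI)
    fix i assume "i < dim_vec (Re l \<cdot>\<^sub>v qa - Im l \<cdot>\<^sub>v qb)"
    then have i: "i < e" using q by simp
    have "(M *\<^sub>v qa) $ i = (\<Sum>j<e. M $$ (i,j) * Re (v $ j))" using M i v by (simp add: sp_sum qa_def)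
    also have "\<dots> = Re (l * v $ i)" unfolding ev[OF i, symmetric] by simp
    finally show "(M *\<^sub>v qa) $ i = (Re l \<cdot>\<^sub>v qa - Im l \<cdot>\<^sub>v qb) $ i" using i v by (simp add: qa_def qb_def)
  qed (use M v in \<open>auto simp: qa_def qb_def\<close>)
  moreover have "M *\<^sub>v qb = Im l \<cdot>\<^sub>v qa + Re l \<cdot>\<^sub>v qb"
  proof (rule eq_vecI)
    fix i assume "i < dim_vec (Im l \<cdot>\<^sub>v qa + Re l \<cdot>\<^sub>v qb)"
    then have i: "i < e" using q by simp
    have "(M *\<^sub>v qb) $ i = (\<Sum>j<e. M $$ (i,j) * Im (v $ j))" using M i v by (simp add: sp_sum qb_def)
    also have "\<dots> = Im (l * v $ i)" unfolding ev[OF i, symmetric] by simp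
    finally show "(M *\<^sub>v qb) $ i = (Im l \<cdot>\<^sub>v qa + Re l \<cdot>\<^sub>v qb) $ i" using i v by (simp add: qa_def qb_def)
  qed (use M v in \<open>auto simp: qa_def qb_def\<close>)
  ultimately show ?thesis using q by blast
qed

text \<open>The spectrum is finite, so some \<mu> > 0 is not an eigenvalue of \<open>M\<close>. Then
  \<open>M - \<mu> I\<close> is injective and its transpose is surjective.\<close>

lemma positive_resolvent_point:
  fixes M :: "real mat"
  assumes M: "M \<in> carrier_mat e e"
  shows "\<exists>\<mu>>0. \<forall>a\<in>carrier_vec e. \<exists>q\<in>carrier_vec e. transpose_mat M *\<^sub>v q - \<mu> \<cdot>\<^sub>v q = a"
proof -
  have "infinite ({0<..} - spectrum M)"
    using card_finite_spectrum(1)[OF M] infinite_Ioi[of "0::real"] by (simp add: Diff_infinite_finite)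
  then obtain \<mu> where \<mu>: "\<mu> > 0" "\<mu> \<notin> spectrum M" by (metis Diff_iff all_not_in_conv finite.emptyI greaterThan_iff)
  define R where "R = transpose_mat M - \<mu> \<cdot>\<^sub>m 1\<^sub>m e"
  have R: "R \<in> carrier_mat e e" using M by (auto simp: R_def)
  have TR: "transpose_mat R = M - \<mu> \<cdot>\<^sub>m 1\<^sub>m e" using M by (intro eq_matI) (auto simp: R_def)
  have ind: "v = 0\<^sub>v e" if v: "v \<in> carrier_vec e" "transpose_mat R *\<^sub>v v = 0\<^sub>v e" for v
  proof (rule ccontr)
    assume "v \<noteq> 0\<^sub>v e"
    have "M *\<^sub>v v - \<mu> \<cdot>\<^sub>v v = 0\<^sub>v e" using v M unfolding TR by (simp add: mv_simps)
    then have "M *\<^sub>v v = \<mu> \<cdot>\<^sub>v v" using M v(1) by (auto simp: Matrix.vec_eq_iff)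
    then show False using \<mu> \<open>v \<noteq> 0\<^sub>v e\<close> v M by (auto simp: spectrum_def eigenvalue_def eigenvector_def)
  qed
  have "\<exists>q\<in>carrier_vec e. transpose_mat M *\<^sub>v q - \<mu> \<cdot>\<^sub>v q = a" if a: "a \<in> carrier_vec e" for a
  proof -
    obtain q where "q \<in> carrier_vec e" "R *\<^sub>v q = a" using mv_surj[OF R ind a] by auto
    then show ?thesis using M by (intro bexI[of _ q]) (auto simp: R_def mv_simps)
  qed
  then show ?thesis using \<mu> by auto
qed

lemma mv_carrier[simp]: "dim_row A = k \<Longrightarrow> A *\<^sub>v x \<in> carrier_vec k"
  by (intro carrier_vecI) simp

lemma smult_vec_add: "dim_vec x = dim_vec y \<Longrightarrow> k \<cdot>\<^sub>v (x + y) = k \<cdot>\<^sub>v x + k \<cdot>\<^sub>v y"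
  for x y :: "'a::comm_ring_1 vec"
  by (intro eq_vecI) (auto simp: algebra_simps)

lemma add_vec_assoc: "dim_vec a = dim_vec b \<Longrightarrow> dim_vec b = dim_vec c \<Longrightarrow> a + b + c = a + (b + c)"
  for a b c :: "'a::comm_ring_1 vec"
  by (intro eq_vecI) (auto simp: algebra_simps)

lemma sum_lessThan_add: "(\<Sum>a<e + r. f a) = (\<Sum>a<e. f a) + (\<Sum>a<r. f (e + a))"
  for f :: "nat \<Rightarrow> 'a::comm_monoid_add"
  by (induction r) (auto simp: add.assoc)

lemma smult_vec_zero[simp]: "k \<cdot>\<^sub>v 0\<^sub>v n = (0\<^sub>v n :: 'a::comm_ring_1 vec)"
  by (intro eq_vecI) auto

section \<open>Storage matrices and left null vectors\<close>

locale lti =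
  fixes A B C D :: "real mat" and d n m :: nat
  assumes A[simp]: "A \<in> carrier_mat d d" and B[simp]: "B \<in> carrier_mat d n"
    and C[simp]: "C \<in> carrier_mat m d" and D[simp]: "D \<in> carrier_mat m n"
begin

lemma lti_dims[simp]: "dim_row A = d" "dim_col A = d" "dim_row B = d" "dim_col B = n"
  "dim_row C = m" "dim_col C = d" "dim_row D = m" "dim_col D = n"
  using carrier_matD[OF A] carrier_matD[OF B] carrier_matD[OF C] carrier_matD[OF D] by simp_all

definition supply_rate :: "real vec \<Rightarrow> real vec \<Rightarrow> real" where
  "supply_rate x u = (C *\<^sub>v x + D *\<^sub>v u) \<bullet> (C *\<^sub>v x + D *\<^sub>v u) - u \<bullet> u"

text \<open>For symmetric \<open>X\<close> the derivative of \<open>x \<bullet> X x\<close> along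
  the motion is \<open>2 * (x \<bullet> X (A x + B u))\<close>, so this is the pointwise form of the
  inequality "payoff plus gain in storage is at most 0".\<close>

definition dissipative :: "real mat \<Rightarrow> bool" where
  "dissipative X \<longleftrightarrow> (\<forall>x\<in>carrier_vec d. \<forall>u\<in>carrier_vec n. supply_rate x u + 2 * (x \<bullet> (X *\<^sub>v (A *\<^sub>v x + B *\<^sub>v u))) \<le> 0)"

end

text \<open>A candidate storage matrix with its factor. The matrix equations enter only in the
  polarised form \<open>lw\<close>. Unobservability is expressed by all powers of \<open>A\<close>,
  which describes an \<open>A\<close>-invariant subspace by its form alone; the observability matrix
  stops at the power \<open>d - 1\<close>.\<close>

locale storage = lti +
  fixes L W X :: "real mat" and r :: nat
  assumes L[simp]: "L \<in> carrier_mat r d" and W[simp]: "W \<in> carrier_mat r n" and X: "psd d X"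
    and lw: "\<And>z u z' u'. \<lbrakk>z \<in> carrier_vec d; u \<in> carrier_vec n; z' \<in> carrier_vec d; u' \<in> carrier_vec n\<rbrakk> \<Longrightarrow>
      (L *\<^sub>v z + W *\<^sub>v u) \<bullet> (L *\<^sub>v z' + W *\<^sub>v u') =
        u \<bullet> u' - (C *\<^sub>v z + D *\<^sub>v u) \<bullet> (C *\<^sub>v z' + D *\<^sub>v u')
        - (A *\<^sub>v z + B *\<^sub>v u) \<bullet> (X *\<^sub>v z') - z \<bullet> (X *\<^sub>v (A *\<^sub>v z' + B *\<^sub>v u'))"
    and obs: "\<And>z. z \<in> carrier_vec d \<Longrightarrow> (\<And>k. C *\<^sub>v (((*\<^sub>v) A ^^ k) z) = 0\<^sub>v m) \<Longrightarrow> X *\<^sub>v z = 0\<^sub>v d"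
begin

lemma LWX_dims[simp]: "dim_row L = r" "dim_col L = d" "dim_row W = r" "dim_col W = n"
  "dim_row X = d" "dim_col X = d" and Xc[simp]: "X \<in> carrier_mat d d" and Xsym: "transpose_mat X = X"
  using carrier_matD[OF L] carrier_matD[OF W] X by (auto simp: psd_def)

lemma X_nonneg: "z \<in> carrier_vec d \<Longrightarrow> 0 \<le> z \<bullet> (X *\<^sub>v z)"
  using X by (simp add: psd_def)

lemma lw_free:
  assumes "z \<in> carrier_vec d" "z' \<in> carrier_vec d"
  shows "(L *\<^sub>v z) \<bullet> (L *\<^sub>v z') = - ((C *\<^sub>v z) \<bullet> (C *\<^sub>v z')) - (A *\<^sub>v z) \<bullet> (X *\<^sub>v z') - z \<bullet> (X *\<^sub>v (A *\<^sub>v z'))"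
  using lw[of z "0\<^sub>v n" z' "0\<^sub>v n"] assms by (simp add: mv_simps mv_zero)

lemma lw_quadratic:
  assumes "z \<in> carrier_vec d" "u \<in> carrier_vec n"
  shows "(L *\<^sub>v z + W *\<^sub>v u) \<bullet> (L *\<^sub>v z + W *\<^sub>v u) = - supply_rate z u - 2 * (z \<bullet> (X *\<^sub>v (A *\<^sub>v z + B *\<^sub>v u)))"
  using lw[OF assms assms] sym_sp[OF Xc Xsym assms(1), of "A *\<^sub>v z + B *\<^sub>v u"] assms
  by (simp add: supply_rate_def)

text \<open>When both outputs vanish at \<open>g\<close>, the polarised Lyapunov equation against an
  arbitrary \<open>y\<close> retains only its two terms with \<open>X\<close>. This determines how
  \<open>A\<close> moves a mode along which nothing is dissipated.\<close>

lemma null_output: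
  assumes g: "g \<in> carrier_vec d" and C0: "C *\<^sub>v g = 0\<^sub>v m" and L0: "L *\<^sub>v g = 0\<^sub>v r"
  shows "X *\<^sub>v (A *\<^sub>v g) = - (transpose_mat A *\<^sub>v (X *\<^sub>v g))"
proof (rule vec_eq_sp)
  fix y :: "real vec" assume y: "y \<in> carrier_vec d"
  have "(X *\<^sub>v (A *\<^sub>v g)) \<bullet> y = (A *\<^sub>v g) \<bullet> (X *\<^sub>v y)"
    using sym_sp[OF Xc Xsym y, of "A *\<^sub>v g"] g y sp_comm[of y "X *\<^sub>v (A *\<^sub>v g)"] by simp
  also have "\<dots> = - (g \<bullet> (X *\<^sub>v (A *\<^sub>v y)))" using lw_free[OF g y] C0 L0 g y by simp
  also have "g \<bullet> (X *\<^sub>v (A *\<^sub>v y)) = (transpose_mat A *\<^sub>v (X *\<^sub>v g)) \<bullet> y"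
    using sym_sp[OF Xc Xsym g, of "A *\<^sub>v y"] g y sp_comm[of "A *\<^sub>v y" "X *\<^sub>v g"] by (simp add: mv_transpose)
  finally show "(X *\<^sub>v (A *\<^sub>v g)) \<bullet> y = (- (transpose_mat A *\<^sub>v (X *\<^sub>v g))) \<bullet> y" using g y by simp
qed (use g in auto)

text \<open>The Lyapunov equation at \<open>z\<close> says that a sum of two squares is 0. So the
  kernel of \<open>X\<close> is an \<open>A\<close>-invariant subspace seen by neither output, and
  the later arguments work modulo it.\<close>

lemma ker_X:
  assumes z: "z \<in> carrier_vec d" "X *\<^sub>v z = 0\<^sub>v d"
  shows "C *\<^sub>v z = 0\<^sub>v m" "L *\<^sub>v z = 0\<^sub>v r" "X *\<^sub>v (A *\<^sub>v z) = 0\<^sub>v d"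
proof -
  have "z \<bullet> (X *\<^sub>v (A *\<^sub>v z)) = 0" using sym_sp[OF Xc Xsym z(1), of "A *\<^sub>v z"] z by simp
  then have "(L *\<^sub>v z) \<bullet> (L *\<^sub>v z) = - ((C *\<^sub>v z) \<bullet> (C *\<^sub>v z))" using lw_free[OF z(1) z(1)] z by simp
  then have "(L *\<^sub>v z) \<bullet> (L *\<^sub>v z) = 0" "(C *\<^sub>v z) \<bullet> (C *\<^sub>v z) = 0"
    using sp_self_nonneg[of "L *\<^sub>v z"] sp_self_nonneg[of "C *\<^sub>v z"] by linarith+
  then show 0: "C *\<^sub>v z = 0\<^sub>v m" "L *\<^sub>v z = 0\<^sub>v r" by (simp_all add: sp_self_eq_0)
  show "X *\<^sub>v (A *\<^sub>v z) = 0\<^sub>v d" using null_output[OF z(1) 0] z by (simp add: mv_zero)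
qed

text \<open>Modulo the unobservable subspace \<open>A\<close> is Hurwitz; this is stated for a complex left
  eigenvector \<open>pa + i pb\<close> of \<open>A\<close> with eigenvalue \<open>\<alpha> + i \<beta>\<close>.\<close>
lemma no_unstable_observable_mode:
  assumes g: "ga \<in> carrier_vec d" "gb \<in> carrier_vec d" and \<alpha>: "0 \<le> \<alpha>"
    and pa: "transpose_mat A *\<^sub>v (X *\<^sub>v ga) = \<alpha> \<cdot>\<^sub>v (X *\<^sub>v ga) - \<beta> \<cdot>\<^sub>v (X *\<^sub>v gb)"
    and pb: "transpose_mat A *\<^sub>v (X *\<^sub>v gb) = \<beta> \<cdot>\<^sub>v (X *\<^sub>v ga) + \<alpha> \<cdot>\<^sub>v (X *\<^sub>v gb)"
  shows "X *\<^sub>v ga = 0\<^sub>v d" "X *\<^sub>v gb = 0\<^sub>v d"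
proof -
  have e: "z \<bullet> (X *\<^sub>v (A *\<^sub>v z)) = (transpose_mat A *\<^sub>v (X *\<^sub>v z)) \<bullet> z" if "z \<in> carrier_vec d" for z
    using sym_sp[OF Xc Xsym that, of "A *\<^sub>v z"] that sp_comm[of "A *\<^sub>v z" "X *\<^sub>v z"] by (simp add: mv_transpose)
  have s: "(X *\<^sub>v gb) \<bullet> ga = (X *\<^sub>v ga) \<bullet> gb"
    using sym_sp[OF Xc Xsym g] g sp_comm[of "X *\<^sub>v gb" ga] sp_comm[of "X *\<^sub>v ga" gb] by simp
  have n: "0 \<le> (X *\<^sub>v g) \<bullet> g" if "g \<in> carrier_vec d" for g
    using X_nonneg[OF that] that sp_comm[of "X *\<^sub>v g" g] by simp
  \<comment> \<open>The Hermitian form at \<open>ga + i gb\<close>: the \<beta> terms cancel by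
    symmetry of \<open>X\<close>, and \<alpha> \<ge> 0 makes the rest nonnegative. The Lyapunov
    equation \<open>q\<close> makes the same sum nonpositive, so all outputs vanish.\<close>
  have "ga \<bullet> (X *\<^sub>v (A *\<^sub>v ga)) + gb \<bullet> (X *\<^sub>v (A *\<^sub>v gb)) = \<alpha> * ((X *\<^sub>v ga) \<bullet> ga + (X *\<^sub>v gb) \<bullet> gb)"
    unfolding e[OF g(1)] e[OF g(2)] pa pb using g s by (simp add: mv_simps algebra_simps)
  also have "\<dots> \<ge> 0" using \<alpha> n g by simp
  finally have pos: "0 \<le> ga \<bullet> (X *\<^sub>v (A *\<^sub>v ga)) + gb \<bullet> (X *\<^sub>v (A *\<^sub>v gb))" .
  have q: "(L *\<^sub>v z) \<bullet> (L *\<^sub>v z) + (C *\<^sub>v z) \<bullet> (C *\<^sub>v z) = - 2 * (z \<bullet> (X *\<^sub>v (A *\<^sub>v z)))" if "z \<in> carrier_vec d" for z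
    using lw_free[OF that that] sym_sp[OF Xc Xsym that, of "A *\<^sub>v z"] that by simp
  have "(L *\<^sub>v ga) \<bullet> (L *\<^sub>v ga) = 0 \<and> (C *\<^sub>v ga) \<bullet> (C *\<^sub>v ga) = 0 \<and> (L *\<^sub>v gb) \<bullet> (L *\<^sub>v gb) = 0 \<and> (C *\<^sub>v gb) \<bullet> (C *\<^sub>v gb) = 0"
    using q[OF g(1)] q[OF g(2)] pos sp_self_nonneg[of "L *\<^sub>v ga"] sp_self_nonneg[of "C *\<^sub>v ga"]
      sp_self_nonneg[of "L *\<^sub>v gb"] sp_self_nonneg[of "C *\<^sub>v gb"] by linarith
  then have z: "L *\<^sub>v ga = 0\<^sub>v r" "C *\<^sub>v ga = 0\<^sub>v m" "L *\<^sub>v gb = 0\<^sub>v r" "C *\<^sub>v gb = 0\<^sub>v m"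
    by (simp_all add: sp_self_eq_0)
  have Aga: "X *\<^sub>v (A *\<^sub>v ga) = - \<alpha> \<cdot>\<^sub>v (X *\<^sub>v ga) + \<beta> \<cdot>\<^sub>v (X *\<^sub>v gb)"
    unfolding null_output[OF g(1) z(2,1)] pa using g by (intro eq_vecI) auto
  have Agb: "X *\<^sub>v (A *\<^sub>v gb) = - \<beta> \<cdot>\<^sub>v (X *\<^sub>v ga) - \<alpha> \<cdot>\<^sub>v (X *\<^sub>v gb)"
    unfolding null_output[OF g(2) z(4,3)] pb using g by (intro eq_vecI) auto
  \<comment> \<open>The span of \<open>ga\<close> and \<open>gb\<close> plus the kernel of
    \<open>X\<close>. It is \<open>A\<close>-invariant and contained in the kernel of
    \<open>C\<close>, hence consists of unobservable states, on which \<open>X\<close> is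
    zero.\<close>
  define K where "K = {x \<in> carrier_vec d. \<exists>s t. X *\<^sub>v (x - s \<cdot>\<^sub>v ga - t \<cdot>\<^sub>v gb) = 0\<^sub>v d}"
  have KC: "C *\<^sub>v x = 0\<^sub>v m" and KA: "A *\<^sub>v x \<in> K" if xK: "x \<in> K" for x
  proof -
    obtain s t where x: "x \<in> carrier_vec d" and st: "X *\<^sub>v (x - s \<cdot>\<^sub>v ga - t \<cdot>\<^sub>v gb) = 0\<^sub>v d"
      using xK unfolding K_def by blast
    have v: "x - s \<cdot>\<^sub>v ga - t \<cdot>\<^sub>v gb \<in> carrier_vec d" using x g by simp
    have "C *\<^sub>v x - s \<cdot>\<^sub>v (C *\<^sub>v ga) - t \<cdot>\<^sub>v (C *\<^sub>v gb) = 0\<^sub>v m" using ker_X(1)[OF v st] x g by (simp add: mv_simps)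
    then show "C *\<^sub>v x = 0\<^sub>v m" using z x by (auto simp: Matrix.vec_eq_iff)
    have "X *\<^sub>v (A *\<^sub>v x) - s \<cdot>\<^sub>v (X *\<^sub>v (A *\<^sub>v ga)) - t \<cdot>\<^sub>v (X *\<^sub>v (A *\<^sub>v gb)) = 0\<^sub>v d"
      using ker_X(3)[OF v st] x g by (simp add: mv_simps)
    moreover have "X *\<^sub>v (A *\<^sub>v x) - s \<cdot>\<^sub>v (X *\<^sub>v (A *\<^sub>v ga)) - t \<cdot>\<^sub>v (X *\<^sub>v (A *\<^sub>v gb)) =
      X *\<^sub>v (A *\<^sub>v x) - (- s * \<alpha> - t * \<beta>) \<cdot>\<^sub>v (X *\<^sub>v ga) - (s * \<beta> - t * \<alpha>) \<cdot>\<^sub>v (X *\<^sub>v gb)"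
      unfolding Aga Agb by (intro eq_vecI) (simp_all add: algebra_simps del: index_mult_mat_vec)
    ultimately have "X *\<^sub>v (A *\<^sub>v x) - (- s * \<alpha> - t * \<beta>) \<cdot>\<^sub>v (X *\<^sub>v ga) - (s * \<beta> - t * \<alpha>) \<cdot>\<^sub>v (X *\<^sub>v gb) = 0\<^sub>v d"
      by simp
    then have "X *\<^sub>v (A *\<^sub>v x - (- s * \<alpha> - t * \<beta>) \<cdot>\<^sub>v ga - (s * \<beta> - t * \<alpha>) \<cdot>\<^sub>v gb) = 0\<^sub>v d"
      using x g by (simp add: mv_simps)
    then show "A *\<^sub>v x \<in> K" using x by (auto simp: K_def simp del: index_mult_mat_vec)
  qed
  have Xg: "X *\<^sub>v x = 0\<^sub>v d" if x: "x \<in> K" for x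
  proof (rule obs)
    show "x \<in> carrier_vec d" using x by (simp add: K_def)
    show "C *\<^sub>v (((*\<^sub>v) A ^^ k) x) = 0\<^sub>v m" for k
    proof -
      have "((*\<^sub>v) A ^^ k) x \<in> K" by (induction k) (use x KA in auto)
      then show ?thesis by (rule KC)
    qed
  qed
  have "ga - 1 \<cdot>\<^sub>v ga - 0 \<cdot>\<^sub>v gb = 0\<^sub>v d" "gb - 0 \<cdot>\<^sub>v ga - 1 \<cdot>\<^sub>v gb = 0\<^sub>v d"
    using g by (auto intro!: eq_vecI)
  then have "X *\<^sub>v (ga - 1 \<cdot>\<^sub>v ga - 0 \<cdot>\<^sub>v gb) = 0\<^sub>v d" "X *\<^sub>v (gb - 0 \<cdot>\<^sub>v ga - 1 \<cdot>\<^sub>v gb) = 0\<^sub>v d"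
    by (simp_all add: mv_zero)
  then have "ga \<in> K" "gb \<in> K" using g unfolding K_def by blast+
  then show "X *\<^sub>v ga = 0\<^sub>v d" "X *\<^sub>v gb = 0\<^sub>v d" using Xg by auto
qed

text \<open>\<open>left_null \<alpha> \<beta> pa pb va vb\<close> is the real form of \<open>p\<^sup>T(\<lambda> I - A) = v\<^sup>T L\<close>,
  \<open>p\<^sup>T B = - v\<^sup>T W\<close> with \<open>\<lambda> = \<alpha> + i \<beta>\<close>, i.e. of \<open>v\<^sup>T Z(\<lambda>) = 0\<close>.\<close>
definition left_null :: "real \<Rightarrow> real \<Rightarrow> real vec \<Rightarrow> real vec \<Rightarrow> real vec \<Rightarrow> real vec \<Rightarrow> bool" where
  "left_null \<alpha> \<beta> pa pb va vb \<longleftrightarrow>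
     pa \<in> carrier_vec d \<and> pb \<in> carrier_vec d \<and> va \<in> carrier_vec r \<and> vb \<in> carrier_vec r \<and>
     (\<forall>z\<in>carrier_vec d. X *\<^sub>v z = 0\<^sub>v d \<longrightarrow> pa \<bullet> z = 0 \<and> pb \<bullet> z = 0) \<and>
     transpose_mat A *\<^sub>v pa = \<alpha> \<cdot>\<^sub>v pa - \<beta> \<cdot>\<^sub>v pb - transpose_mat L *\<^sub>v va \<and>
     transpose_mat A *\<^sub>v pb = \<beta> \<cdot>\<^sub>v pa + \<alpha> \<cdot>\<^sub>v pb - transpose_mat L *\<^sub>v vb \<and>
     transpose_mat B *\<^sub>v pa = - (transpose_mat W *\<^sub>v va) \<and>
     transpose_mat B *\<^sub>v pb = - (transpose_mat W *\<^sub>v vb)"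

text \<open>Phrased through \<open>p\<close>, the condition makes sense also at right half-plane
  eigenvalues of \<open>A\<close>, where \<open>(\<lambda> I - A)^{-1}\<close> does not
  exist.\<close>

definition full_row_rank_rhp :: bool where
  "full_row_rank_rhp \<longleftrightarrow> (\<forall>\<alpha> \<beta> pa pb va vb. \<alpha> > 0 \<longrightarrow> left_null \<alpha> \<beta> pa pb va vb \<longrightarrow> va = 0\<^sub>v r \<and> vb = 0\<^sub>v r)"

text \<open>With \<open>v = 0\<close> the null equations say that \<open>p\<close>, if nonzero, is a
  left eigenvector of \<open>A\<close> with real part \<alpha> \<ge> 0. It vanishes on the kernel of
  \<open>X\<close> and so lies in the range of \<open>X\<close>, where there is no such mode. For
  \<alpha> = 0 the rank condition is silent, and \<open>v = 0\<close> has to be supplied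
  separately.\<close>

lemma left_null_zero:
  assumes fr: full_row_rank_rhp and ln: "left_null \<alpha> \<beta> pa pb va vb"
    and \<alpha>: "0 < \<alpha> \<or> 0 \<le> \<alpha> \<and> va = 0\<^sub>v r \<and> vb = 0\<^sub>v r"
  shows "va = 0\<^sub>v r" "vb = 0\<^sub>v r" "pa = 0\<^sub>v d" "pb = 0\<^sub>v d"
proof -
  show v: "va = 0\<^sub>v r" "vb = 0\<^sub>v r" using fr ln \<alpha> unfolding full_row_rank_rhp_def by blast+
  have p: "pa \<in> carrier_vec d" "pb \<in> carrier_vec d" using ln by (auto simp: left_null_def)
  obtain ga where ga: "ga \<in> carrier_vec d" "X *\<^sub>v ga = pa"
    using ker_functional[OF X p(1)] ln by (auto simp: left_null_def)
  obtain gb where gb: "gb \<in> carrier_vec d" "X *\<^sub>v gb = pb"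
    using ker_functional[OF X p(2)] ln by (auto simp: left_null_def)
  have "transpose_mat A *\<^sub>v pa = \<alpha> \<cdot>\<^sub>v pa - \<beta> \<cdot>\<^sub>v pb" "transpose_mat A *\<^sub>v pb = \<beta> \<cdot>\<^sub>v pa + \<alpha> \<cdot>\<^sub>v pb"
    using ln v p by (simp_all add: left_null_def mv_zero)
  then have "X *\<^sub>v ga = 0\<^sub>v d" "X *\<^sub>v gb = 0\<^sub>v d"
    using no_unstable_observable_mode[OF ga(1) gb(1), of \<alpha> \<beta>] \<alpha> unfolding ga(2) gb(2) by auto
  then show "pa = 0\<^sub>v d" "pb = 0\<^sub>v d" using ga gb by auto
qed

text \<open>By \<open>lw_quadratic\<close> this says that \<open>X - E\<close> is again positive semidefinite and dissipative.\<close>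
definition slack :: "real mat \<Rightarrow> bool" where
  "slack E \<longleftrightarrow> psd d E \<and> (\<forall>z\<in>carrier_vec d. z \<bullet> (E *\<^sub>v z) \<le> z \<bullet> (X *\<^sub>v z)) \<and>
    (\<forall>z\<in>carrier_vec d. \<forall>u\<in>carrier_vec n.
      0 \<le> (L *\<^sub>v z + W *\<^sub>v u) \<bullet> (L *\<^sub>v z + W *\<^sub>v u) + 2 * (z \<bullet> (E *\<^sub>v (A *\<^sub>v z + B *\<^sub>v u))))"

text \<open>\<open>S (A z + B u)\<close> depends only on \<open>S z\<close> and
  \<open>L z + W u\<close>. If both are 0, consider the state \<open>y + t z\<close> and the input
  \<open>t u\<close>, where \<open>y = A z + B u\<close>: the output \<open>L y\<close> is unchanged
  and the velocity \<open>A y\<close> gains \<open>t y\<close>. As \<open>E z = 0\<close>, the slack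
  inequality is affine in \<open>t\<close> with slope \<open>2 * (y \<bullet> E y)\<close>, which
  must be 0, so \<open>S y = 0\<close>. The coefficients of \<open>Ah\<close> and \<open>Gm\<close>
  are those of \<open>functional_in_span\<close>, row by row.\<close>

lemma slack_factor:
  assumes E: "slack E" and S: "S \<in> carrier_mat e d" "E = transpose_mat S * S"
  shows "\<exists>Ah Gm. Ah \<in> carrier_mat e e \<and> Gm \<in> carrier_mat e r \<and> (\<forall>z\<in>carrier_vec d. \<forall>u\<in>carrier_vec n.
    S *\<^sub>v (A *\<^sub>v z + B *\<^sub>v u) = Ah *\<^sub>v (S *\<^sub>v z) + Gm *\<^sub>v (L *\<^sub>v z + W *\<^sub>v u))"
proof -
  have Epsd: "psd d E" using E by (simp add: slack_def)
  then have Ec: "E \<in> carrier_mat d d" "transpose_mat E = E" by (auto simp: psd_def)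
  define T :: "nat \<Rightarrow> real vec \<times> real vec \<Rightarrow> real" where
    "T a zu = (if a < e then (S *\<^sub>v fst zu) $ a else (L *\<^sub>v fst zu + W *\<^sub>v snd zu) $ (a - e))" for a zu
  define V :: "(real vec \<times> real vec) set" where "V = carrier_vec d \<times> carrier_vec n"
  define comb where "comb c zu zu' = (fst zu + c \<cdot>\<^sub>v fst zu', snd zu + c \<cdot>\<^sub>v snd zu')"
    for c :: real and zu zu' :: "real vec \<times> real vec"
  have ker: "S *\<^sub>v (A *\<^sub>v z + B *\<^sub>v u) = 0\<^sub>v e"
    if z: "z \<in> carrier_vec d" and u: "u \<in> carrier_vec n" and Sz: "S *\<^sub>v z = 0\<^sub>v e" and w: "L *\<^sub>v z + W *\<^sub>v u = 0\<^sub>v r" for z u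
  proof -
    define y where "y = A *\<^sub>v z + B *\<^sub>v u"
    have y: "y \<in> carrier_vec d" using z u by (simp add: y_def)
    have Ez: "E *\<^sub>v z = 0\<^sub>v d" using S z Sz by (simp add: mv_mult mv_zero)
    have zE: "z \<bullet> (E *\<^sub>v v) = 0" if "v \<in> carrier_vec d" for v
      using sym_sp[OF Ec z that] Ez that by simp
    define a where "a = (L *\<^sub>v y) \<bullet> (L *\<^sub>v y) + 2 * (y \<bullet> (E *\<^sub>v (A *\<^sub>v y)))"
    have "0 \<le> a + t * (2 * (y \<bullet> (E *\<^sub>v y)))" for t
    proof -
      have w': "L *\<^sub>v (y + t \<cdot>\<^sub>v z) + W *\<^sub>v (t \<cdot>\<^sub>v u) = L *\<^sub>v y"
      proof -
        have "L *\<^sub>v (y + t \<cdot>\<^sub>v z) + W *\<^sub>v (t \<cdot>\<^sub>v u) = L *\<^sub>v y + t \<cdot>\<^sub>v (L *\<^sub>v z + W *\<^sub>v u)"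
          using y z u by (simp add: mv_simps smult_vec_add add_vec_assoc)
        then show ?thesis using y by (simp add: w)
      qed
      have y': "A *\<^sub>v (y + t \<cdot>\<^sub>v z) + B *\<^sub>v (t \<cdot>\<^sub>v u) = A *\<^sub>v y + t \<cdot>\<^sub>v y"
        using y z u by (simp add: mv_simps smult_vec_add add_vec_assoc y_def)
      have q: "0 \<le> (L *\<^sub>v z + W *\<^sub>v u) \<bullet> (L *\<^sub>v z + W *\<^sub>v u) + 2 * (z \<bullet> (E *\<^sub>v (A *\<^sub>v z + B *\<^sub>v u)))"
        if "z \<in> carrier_vec d" "u \<in> carrier_vec n" for z u using E that by (simp add: slack_def)
      have "0 \<le> (L *\<^sub>v y) \<bullet> (L *\<^sub>v y) + 2 * ((y + t \<cdot>\<^sub>v z) \<bullet> (E *\<^sub>v (A *\<^sub>v y + t \<cdot>\<^sub>v y)))"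
        using q[of "y + t \<cdot>\<^sub>v z" "t \<cdot>\<^sub>v u"] y z u unfolding w' y' by simp
      also have "(y + t \<cdot>\<^sub>v z) \<bullet> (E *\<^sub>v (A *\<^sub>v y + t \<cdot>\<^sub>v y)) = y \<bullet> (E *\<^sub>v (A *\<^sub>v y)) + t * (y \<bullet> (E *\<^sub>v y))"
        using y z Ec zE[of "A *\<^sub>v y + t \<cdot>\<^sub>v y"] by (simp add: mv_simps zE)
      finally show ?thesis by (simp add: a_def algebra_simps)
    qed
    note lin = this
    have "y \<bullet> (E *\<^sub>v y) = 0"
    proof (rule ccontr)
      assume "y \<bullet> (E *\<^sub>v y) \<noteq> 0"
      then show False using lin[of "- (a + 1) / (2 * (y \<bullet> (E *\<^sub>v y)))"] by (simp add: field_simps)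
    qed
    moreover have "y \<bullet> (E *\<^sub>v y) = (S *\<^sub>v y) \<bullet> (S *\<^sub>v y)" using S y by (simp add: mv_mult mv_transpose')
    ultimately show ?thesis using S y by (simp add: sp_self_eq_0 y_def)
  qed
  have fac: "\<exists>y. \<forall>zu\<in>V. (S *\<^sub>v (A *\<^sub>v fst zu + B *\<^sub>v snd zu)) $ i = (\<Sum>a<e + r. y a * T a zu)" if i: "i < e" for i
  proof (rule functional_in_span[where comb = comb])
    fix zu assume zu: "zu \<in> V" and 0: "\<forall>a<e + r. T a zu = 0"
    have "S *\<^sub>v fst zu = 0\<^sub>v e"
    proof (rule eq_vecI)
      fix a assume "a < dim_vec (0\<^sub>v e :: real vec)"
      then show "(S *\<^sub>v fst zu) $ a = 0\<^sub>v e $ a" using 0[rule_format, of a] by (simp add: T_def del: index_mult_mat_vec)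
    qed (use S(1) in simp)
    moreover have "L *\<^sub>v fst zu + W *\<^sub>v snd zu = 0\<^sub>v r"
    proof (rule eq_vecI)
      fix a assume "a < dim_vec (0\<^sub>v r :: real vec)"
      then show "(L *\<^sub>v fst zu + W *\<^sub>v snd zu) $ a = 0\<^sub>v r $ a" using 0[rule_format, of "e + a"] by (simp add: T_def del: index_mult_mat_vec)
    qed simp
    moreover have "fst zu \<in> carrier_vec d" "snd zu \<in> carrier_vec n" using zu by (auto simp: V_def mem_Times_iff)
    ultimately have "S *\<^sub>v (A *\<^sub>v fst zu + B *\<^sub>v snd zu) = 0\<^sub>v e" by (intro ker)
    then show "(S *\<^sub>v (A *\<^sub>v fst zu + B *\<^sub>v snd zu)) $ i = 0" using i by simp
  next
    fix c :: real and zu zu' assume zu: "zu \<in> V" "zu' \<in> V"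
    then have dv: "dim_vec (fst zu) = d" "dim_vec (snd zu) = n" "dim_vec (fst zu') = d" "dim_vec (snd zu') = n"
      by (auto simp: V_def mem_Times_iff)
    show "comb c zu zu' \<in> V" using zu by (simp add: comb_def V_def mem_Times_iff)
    have "S *\<^sub>v (A *\<^sub>v fst (comb c zu zu') + B *\<^sub>v snd (comb c zu zu')) =
      S *\<^sub>v (A *\<^sub>v fst zu + B *\<^sub>v snd zu) + c \<cdot>\<^sub>v (S *\<^sub>v (A *\<^sub>v fst zu' + B *\<^sub>v snd zu'))"
      using dv carrier_matD[OF S(1)] by (intro eq_vecI) (simp_all add: comb_def mv_simps distrib_left del: index_mult_mat_vec)
    then show "(S *\<^sub>v (A *\<^sub>v fst (comb c zu zu') + B *\<^sub>v snd (comb c zu zu'))) $ i =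
       (S *\<^sub>v (A *\<^sub>v fst zu + B *\<^sub>v snd zu)) $ i + c * (S *\<^sub>v (A *\<^sub>v fst zu' + B *\<^sub>v snd zu')) $ i"
      using i carrier_matD[OF S(1)] by (simp del: index_mult_mat_vec)
    fix a assume a: "a < e + r"
    show "T a (comb c zu zu') = T a zu + c * T a zu'"
      using a dv carrier_matD[OF S(1)] by (simp add: T_def comb_def mv_simps distrib_left del: index_mult_mat_vec)
  qed
  have "\<forall>i. \<exists>y. i < e \<longrightarrow> (\<forall>zu\<in>V. (S *\<^sub>v (A *\<^sub>v fst zu + B *\<^sub>v snd zu)) $ i = (\<Sum>a<e + r. y a * T a zu))"
  proof
    fix i show "\<exists>y. i < e \<longrightarrow> (\<forall>zu\<in>V. (S *\<^sub>v (A *\<^sub>v fst zu + B *\<^sub>v snd zu)) $ i = (\<Sum>a<e + r. y a * T a zu))"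
      using fac[of i] by (cases "i < e") (simp_all del: index_mult_mat_vec)
  qed
  from choice[OF this] obtain y where y: "\<forall>i. i < e \<longrightarrow>
    (\<forall>zu\<in>V. (S *\<^sub>v (A *\<^sub>v fst zu + B *\<^sub>v snd zu)) $ i = (\<Sum>a<e + r. y i a * T a zu))" by (elim exE)
  define Ah where "Ah = mat e e (\<lambda>(i,j). y i j)"
  define Gm where "Gm = mat e r (\<lambda>(i,j). y i (e + j))"
  have "S *\<^sub>v (A *\<^sub>v z + B *\<^sub>v u) = Ah *\<^sub>v (S *\<^sub>v z) + Gm *\<^sub>v (L *\<^sub>v z + W *\<^sub>v u)"
    if z: "z \<in> carrier_vec d" and u: "u \<in> carrier_vec n" for z u
  proof (rule eq_vecI)
    fix i assume "i < dim_vec (Ah *\<^sub>v (S *\<^sub>v z) + Gm *\<^sub>v (L *\<^sub>v z + W *\<^sub>v u))"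
    then have i: "i < e" by (simp add: Gm_def)
    have "(S *\<^sub>v (A *\<^sub>v z + B *\<^sub>v u)) $ i = (\<Sum>a<e + r. y i a * T a (z,u))" using y[rule_format, OF i, of "(z,u)"] z u by (simp add: V_def)
    also have "\<dots> = (\<Sum>a<e. y i a * T a (z,u)) + (\<Sum>a<r. y i (e + a) * T (e + a) (z,u))"
      by (rule sum_lessThan_add)
    also have "(\<Sum>a<e. y i a * T a (z,u)) = (Ah *\<^sub>v (S *\<^sub>v z)) $ i"
      using i S by (simp add: mv_index Ah_def T_def del: index_mult_mat_vec)
    also have "(\<Sum>a<r. y i (e + a) * T (e + a) (z,u)) = (Gm *\<^sub>v (L *\<^sub>v z + W *\<^sub>v u)) $ i"
      using i by (simp add: mv_index Gm_def T_def del: index_mult_mat_vec)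
    finally show "(S *\<^sub>v (A *\<^sub>v z + B *\<^sub>v u)) $ i = (Ah *\<^sub>v (S *\<^sub>v z) + Gm *\<^sub>v (L *\<^sub>v z + W *\<^sub>v u)) $ i"
      using i by (simp add: Ah_def Gm_def)
  qed (use S in \<open>simp add: Gm_def\<close>)
  moreover have "Ah \<in> carrier_mat e e" "Gm \<in> carrier_mat e r" by (auto simp: Ah_def Gm_def)
  ultimately show ?thesis by blast
qed

text \<open>The sign of the eigenvalue comes from the slack inequality. Tested at
  \<open>S z = q\<close> and \<open>L z + W u = - Gm^T q\<close> it reads
  \<open>|Gm^T q|^2 \<le> 2 * (Ah^T q \<bullet> q)\<close>, so eigenvalues of \<open>Ah\<close> have
  nonnegative real part. Such a test requires \<open>S z\<close> and \<open>L z + W u\<close> to be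
  prescribable at will, and this is where the rank condition is used at a real point as
  well.\<close>

lemma slack_zero:
  assumes fr: full_row_rank_rhp and E: "slack E"
  shows "E = 0\<^sub>m d d"
proof -
  have "psd d E" using E by (simp add: slack_def)
  from rank_factorization[OF this] obtain e S where "S \<in> carrier_mat e d \<and> E = transpose_mat S * S \<and>
    (\<forall>v\<in>carrier_vec e. transpose_mat S *\<^sub>v v = 0\<^sub>v d \<longrightarrow> v = 0\<^sub>v e)" by (elim exE)
  then have S: "S \<in> carrier_mat e d" and ES: "E = transpose_mat S * S"
    and ind: "\<And>v. v \<in> carrier_vec e \<Longrightarrow> transpose_mat S *\<^sub>v v = 0\<^sub>v d \<Longrightarrow> v = 0\<^sub>v e" by simp_all
  have Sd[simp]: "dim_row S = e" "dim_col S = d" using carrier_matD[OF S] by simp_all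
  from slack_factor[OF E S ES] obtain Ah Gm where "Ah \<in> carrier_mat e e \<and> Gm \<in> carrier_mat e r \<and>
    (\<forall>z\<in>carrier_vec d. \<forall>u\<in>carrier_vec n. S *\<^sub>v (A *\<^sub>v z + B *\<^sub>v u) = Ah *\<^sub>v (S *\<^sub>v z) + Gm *\<^sub>v (L *\<^sub>v z + W *\<^sub>v u))"
    by (elim exE)
  then have Ah: "Ah \<in> carrier_mat e e" and Gm: "Gm \<in> carrier_mat e r"
    and AG: "\<And>z u. z \<in> carrier_vec d \<Longrightarrow> u \<in> carrier_vec n \<Longrightarrow>
      S *\<^sub>v (A *\<^sub>v z + B *\<^sub>v u) = Ah *\<^sub>v (S *\<^sub>v z) + Gm *\<^sub>v (L *\<^sub>v z + W *\<^sub>v u)" by simp_all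
  have AGd[simp]: "dim_row Ah = e" "dim_col Ah = e" "dim_row Gm = e" "dim_col Gm = r"
    using carrier_matD[OF Ah] carrier_matD[OF Gm] by simp_all
  have zES: "z \<bullet> (E *\<^sub>v y) = (S *\<^sub>v z) \<bullet> (S *\<^sub>v y)" if "z \<in> carrier_vec d" "y \<in> carrier_vec d" for z y
    using that by (simp add: ES mv_mult mv_transpose')
  have killX: "S *\<^sub>v z = 0\<^sub>v e" if z: "z \<in> carrier_vec d" "X *\<^sub>v z = 0\<^sub>v d" for z
  proof -
    have "z \<bullet> (E *\<^sub>v z) \<le> z \<bullet> (X *\<^sub>v z)" using E z(1) by (simp add: slack_def)
    then have "(S *\<^sub>v z) \<bullet> (S *\<^sub>v z) \<le> 0" using z by (simp add: zES)
    then have "(S *\<^sub>v z) \<bullet> (S *\<^sub>v z) = 0" using sp_self_nonneg[of "S *\<^sub>v z"] by simp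
    then show ?thesis by (simp add: sp_self_eq_0)
  qed
  \<comment> \<open>A consequence of \<open>E \<le> X\<close>: each \<open>S^T q\<close> vanishes on
    the kernel of \<open>X\<close>, as \<open>left_null\<close> demands of \<open>p\<close>.\<close>
  have kill: "(transpose_mat S *\<^sub>v q) \<bullet> z = 0" if "q \<in> carrier_vec e" "z \<in> carrier_vec d" "X *\<^sub>v z = 0\<^sub>v d" for q z
    using that killX by (simp add: mv_transpose)
  have split: "q \<bullet> (S *\<^sub>v (A *\<^sub>v z + B *\<^sub>v u)) =
      (transpose_mat Ah *\<^sub>v q) \<bullet> (S *\<^sub>v z) + (transpose_mat Gm *\<^sub>v q) \<bullet> (L *\<^sub>v z + W *\<^sub>v u)"
    if "q \<in> carrier_vec e" "z \<in> carrier_vec d" "u \<in> carrier_vec n" for q z u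
    unfolding AG[OF that(2,3)] using that by (simp add: mv_simps mv_transpose del: index_mult_mat_vec)
  \<comment> \<open>An identity in all \<open>z\<close> and \<open>u\<close>; its values at
    \<open>u = 0\<close> and at \<open>z = 0\<close> are the two null equations for
    \<open>p = S^T q\<close>.\<close>
  have null: "transpose_mat A *\<^sub>v (transpose_mat S *\<^sub>v q) = transpose_mat S *\<^sub>v q1 - transpose_mat L *\<^sub>v v \<and>
      transpose_mat B *\<^sub>v (transpose_mat S *\<^sub>v q) = - (transpose_mat W *\<^sub>v v)"
    if q: "q \<in> carrier_vec e" "q1 \<in> carrier_vec e" "v \<in> carrier_vec r"
      and H: "\<And>z u. z \<in> carrier_vec d \<Longrightarrow> u \<in> carrier_vec n \<Longrightarrow>
        q \<bullet> (S *\<^sub>v (A *\<^sub>v z + B *\<^sub>v u)) = q1 \<bullet> (S *\<^sub>v z) - v \<bullet> (L *\<^sub>v z + W *\<^sub>v u)" for q q1 v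
  proof
    show "transpose_mat A *\<^sub>v (transpose_mat S *\<^sub>v q) = transpose_mat S *\<^sub>v q1 - transpose_mat L *\<^sub>v v"
    proof (rule vec_eq_sp[of _ d])
      fix z :: "real vec" assume z: "z \<in> carrier_vec d"
      have "(transpose_mat A *\<^sub>v (transpose_mat S *\<^sub>v q)) \<bullet> z = q \<bullet> (S *\<^sub>v (A *\<^sub>v z + B *\<^sub>v 0\<^sub>v n))"
        using q z by (simp add: mv_transpose mv_zero)
      also have "\<dots> = q1 \<bullet> (S *\<^sub>v z) - v \<bullet> (L *\<^sub>v z)" using H[OF z, of "0\<^sub>v n"] z by (simp add: mv_zero)
      also have "\<dots> = (transpose_mat S *\<^sub>v q1 - transpose_mat L *\<^sub>v v) \<bullet> z"
        using q z by (simp add: sp_minus_left mv_transpose)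
      finally show "(transpose_mat A *\<^sub>v (transpose_mat S *\<^sub>v q)) \<bullet> z = (transpose_mat S *\<^sub>v q1 - transpose_mat L *\<^sub>v v) \<bullet> z" .
    qed simp_all
    show "transpose_mat B *\<^sub>v (transpose_mat S *\<^sub>v q) = - (transpose_mat W *\<^sub>v v)"
    proof (rule vec_eq_sp[of _ n])
      fix u :: "real vec" assume u: "u \<in> carrier_vec n"
      have "(transpose_mat B *\<^sub>v (transpose_mat S *\<^sub>v q)) \<bullet> u = q \<bullet> (S *\<^sub>v (A *\<^sub>v 0\<^sub>v d + B *\<^sub>v u))"
        using q u by (simp add: mv_transpose mv_zero)
      also have "\<dots> = - (v \<bullet> (W *\<^sub>v u))" using H[OF _ u, of "0\<^sub>v d"] q u by (simp add: mv_zero)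
      also have "\<dots> = (- (transpose_mat W *\<^sub>v v)) \<bullet> u" using q u by (simp add: mv_transpose)
      finally show "(transpose_mat B *\<^sub>v (transpose_mat S *\<^sub>v q)) \<bullet> u = (- (transpose_mat W *\<^sub>v v)) \<bullet> u" .
    qed simp_all
  qed
  have e0: "e = 0"
  proof (rule ccontr)
    assume "e \<noteq> 0"
    then have epos: "0 < e" by simp
    define T :: "nat \<Rightarrow> real vec \<times> real vec \<Rightarrow> real" where
      "T a zu = (if a < e then (S *\<^sub>v fst zu) $ a else (L *\<^sub>v fst zu + W *\<^sub>v snd zu) $ (a - e))" for a zu
    define V :: "(real vec \<times> real vec) set" where "V = carrier_vec d \<times> carrier_vec n"
    define comb where "comb c zu zu' = (fst zu + c \<cdot>\<^sub>v fst zu', snd zu + c \<cdot>\<^sub>v snd zu')"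
      for c :: real and zu zu' :: "real vec \<times> real vec"
    \<comment> \<open>An annihilator \<open>(a, b)\<close> is absorbed into a null pair at a real
      \<mu> > 0: with \<open>Ah^T q - \<mu> q = a\<close> and \<open>v = b - Gm^T q\<close>, the
      annihilation identity becomes the hypothesis of \<open>null\<close>. Vanishing of the pair
      gives \<open>q = 0\<close>, hence \<open>a = 0\<close> and \<open>b = 0\<close>.\<close>
    have noann: "\<forall>a<e + r. y a = 0" if y: "\<forall>zu\<in>V. (\<Sum>a<e + r. y a * T a zu) = 0" for y
    proof -
      define a where "a = vec e y"
      define b where "b = vec r (\<lambda>i. y (e + i))"
      have ab[simp]: "a \<in> carrier_vec e" "b \<in> carrier_vec r" by (simp_all add: a_def b_def)
      have ann: "a \<bullet> (S *\<^sub>v z) + b \<bullet> (L *\<^sub>v z + W *\<^sub>v u) = 0" if "z \<in> carrier_vec d" "u \<in> carrier_vec n" for z u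
      proof -
        have "a \<bullet> (S *\<^sub>v z) = (\<Sum>i<e. y i * T i (z,u))"
          by (simp add: sp_sum a_def T_def del: index_mult_mat_vec)
        moreover have "b \<bullet> (L *\<^sub>v z + W *\<^sub>v u) = (\<Sum>i<r. y (e + i) * T (e + i) (z,u))"
          by (simp add: sp_sum b_def T_def del: index_mult_mat_vec)
        moreover have "(\<Sum>i<e + r. y i * T i (z,u)) = 0" using y that by (simp add: V_def)
        ultimately show ?thesis by (simp add: sum_lessThan_add)
      qed
      obtain \<mu> q where \<mu>: "0 < \<mu>" and q[simp]: "q \<in> carrier_vec e" and qa: "transpose_mat Ah *\<^sub>v q - \<mu> \<cdot>\<^sub>v q = a"
        using positive_resolvent_point[OF Ah] ab(1) by blast
      have qd[simp]: "dim_vec q = e" by (rule carrier_vecD[OF q])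
      have abd[simp]: "dim_vec a = e" "dim_vec b = r" using carrier_vecD[OF ab(1)] carrier_vecD[OF ab(2)] by simp_all
      have Aq: "transpose_mat Ah *\<^sub>v q = \<mu> \<cdot>\<^sub>v q + a"
        unfolding qa[symmetric] by (intro eq_vecI) (simp_all del: index_mult_mat_vec)
      define v where "v = b - transpose_mat Gm *\<^sub>v q"
      have v: "v \<in> carrier_vec r" by (simp add: v_def)
      have H: "q \<bullet> (S *\<^sub>v (A *\<^sub>v z + B *\<^sub>v u)) = (\<mu> \<cdot>\<^sub>v q) \<bullet> (S *\<^sub>v z) - v \<bullet> (L *\<^sub>v z + W *\<^sub>v u)"
        if "z \<in> carrier_vec d" "u \<in> carrier_vec n" for z u
        using ann[OF that] unfolding split[OF q that] Aq v_def by (simp add: sp_add_left sp_minus_left)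
      have p: "transpose_mat S *\<^sub>v q \<in> carrier_vec d" by simp
      have N: "transpose_mat A *\<^sub>v (transpose_mat S *\<^sub>v q) = transpose_mat S *\<^sub>v (\<mu> \<cdot>\<^sub>v q) - transpose_mat L *\<^sub>v v"
          "transpose_mat B *\<^sub>v (transpose_mat S *\<^sub>v q) = - (transpose_mat W *\<^sub>v v)"
        using null[OF q _ v H] by simp_all
      have "left_null \<mu> 0 (transpose_mat S *\<^sub>v q) (0\<^sub>v d) v (0\<^sub>v r)"
        unfolding left_null_def
      proof (intro conjI ballI impI)
        show "transpose_mat A *\<^sub>v (transpose_mat S *\<^sub>v q) =
          \<mu> \<cdot>\<^sub>v (transpose_mat S *\<^sub>v q) - 0 \<cdot>\<^sub>v 0\<^sub>v d - transpose_mat L *\<^sub>v v"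
          unfolding N(1) by (simp add: mv_smult)
        show "transpose_mat A *\<^sub>v 0\<^sub>v d = 0 \<cdot>\<^sub>v (transpose_mat S *\<^sub>v q) + \<mu> \<cdot>\<^sub>v 0\<^sub>v d - transpose_mat L *\<^sub>v 0\<^sub>v r"
          by (intro eq_vecI) (simp_all add: mv_zero del: index_mult_mat_vec)
        show "transpose_mat B *\<^sub>v 0\<^sub>v d = - (transpose_mat W *\<^sub>v 0\<^sub>v r)" by (simp add: mv_zero)
      qed (use N kill v in simp_all)
      then have z: "v = 0\<^sub>v r" "transpose_mat S *\<^sub>v q = 0\<^sub>v d"
        using left_null_zero[OF fr, of \<mu> 0 "transpose_mat S *\<^sub>v q" "0\<^sub>v d" v "0\<^sub>v r"] \<mu> by simp_all
      have q0: "q = 0\<^sub>v e" by (rule ind[OF q z(2)])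
      have a0: "a = 0\<^sub>v e" unfolding qa[symmetric] q0 by (simp add: mv_zero)
      have "b = v + transpose_mat Gm *\<^sub>v q" unfolding v_def by (intro eq_vecI) (simp_all del: index_mult_mat_vec)
      then have b0: "b = 0\<^sub>v r" using z q0 by (simp add: mv_zero)
      show "\<forall>i<e + r. y i = 0"
      proof (intro allI impI)
        fix i assume i: "i < e + r"
        show "y i = 0"
        proof (cases "i < e")
          case True
          then have "a $ i = 0" using a0 by simp
          then show ?thesis using True by (simp add: a_def)
        next
          case False
          have "b $ (i - e) = 0" using b0 i False by simp
          moreover have "i - e < r" "e + (i - e) = i" using False i by linarith+
          ultimately show ?thesis by (simp add: b_def)
        qed
      qed
    qed
    have surj: "\<exists>z\<in>carrier_vec d. \<exists>u\<in>carrier_vec n. S *\<^sub>v z = y \<and> L *\<^sub>v z + W *\<^sub>v u = w"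
      if y: "y \<in> carrier_vec e" and w: "w \<in> carrier_vec r" for y w
    proof -
      define c where "c i = (if i < e then y $ i else w $ (i - e))" for i
      have "\<exists>zu\<in>V. \<forall>a<e + r. T a zu = c a"
      proof (rule annihilator_or_surjective[where comb = comb])
        have "(0\<^sub>v d, 0\<^sub>v n) \<in> V" by (simp add: V_def)
        then show "V \<noteq> {}" by blast
        fix c :: real and zu zu' assume zu: "zu \<in> V" "zu' \<in> V"
        then have dv: "dim_vec (fst zu) = d" "dim_vec (snd zu) = n" "dim_vec (fst zu') = d" "dim_vec (snd zu') = n"
          by (auto simp: V_def mem_Times_iff)
        show "comb c zu zu' \<in> V" using zu by (simp add: comb_def V_def mem_Times_iff)
        fix a assume a: "a < e + r"
        show "T a (comb c zu zu') = T a zu + c * T a zu'"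
          using a dv by (simp add: T_def comb_def mv_simps distrib_left del: index_mult_mat_vec)
      qed (rule noann)
      then obtain zu where zu: "zu \<in> V" "\<forall>a<e + r. T a zu = c a" by blast
      have "S *\<^sub>v fst zu = y"
      proof (rule eq_vecI)
        fix i assume "i < dim_vec y"
        then show "(S *\<^sub>v fst zu) $ i = y $ i" using zu(2)[rule_format, of i] y by (simp add: T_def c_def del: index_mult_mat_vec)
      qed (use y in simp)
      moreover have "L *\<^sub>v fst zu + W *\<^sub>v snd zu = w"
      proof (rule eq_vecI)
        fix i assume "i < dim_vec w"
        then show "(L *\<^sub>v fst zu + W *\<^sub>v snd zu) $ i = w $ i"
          using zu(2)[rule_format, of "e + i"] w by (simp add: T_def c_def del: index_mult_mat_vec)
      qed (use w in simp)
      ultimately show ?thesis using zu(1) by (intro bexI[of _ "fst zu"] bexI[of _ "snd zu"]) (simp_all add: V_def mem_Times_iff)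
    qed
    have ineq: "(transpose_mat Gm *\<^sub>v q) \<bullet> (transpose_mat Gm *\<^sub>v q) \<le> 2 * ((transpose_mat Ah *\<^sub>v q) \<bullet> q)" if q: "q \<in> carrier_vec e" for q
    proof -
      \<comment> \<open>The minimiser of \<open>w \<bullet> w + 2 * (Gm^T q \<bullet> w)\<close>,
        which gives the sharpest inequality.\<close>
      define w where "w = - (transpose_mat Gm *\<^sub>v q)"
      have w: "w \<in> carrier_vec r" by (simp add: w_def)
      obtain z u where z: "z \<in> carrier_vec d" and u: "u \<in> carrier_vec n" and zu: "S *\<^sub>v z = q" "L *\<^sub>v z + W *\<^sub>v u = w"
        using surj[OF q w] by blast
      have "0 \<le> (L *\<^sub>v z + W *\<^sub>v u) \<bullet> (L *\<^sub>v z + W *\<^sub>v u) + 2 * (z \<bullet> (E *\<^sub>v (A *\<^sub>v z + B *\<^sub>v u)))"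
        using E z u by (simp add: slack_def)
      also have "z \<bullet> (E *\<^sub>v (A *\<^sub>v z + B *\<^sub>v u)) = q \<bullet> (S *\<^sub>v (A *\<^sub>v z + B *\<^sub>v u))" using zES[OF z] zu z u by simp
      also have "\<dots> = (transpose_mat Ah *\<^sub>v q) \<bullet> q + (transpose_mat Gm *\<^sub>v q) \<bullet> w" using split[OF q z u] zu by simp
      finally show ?thesis unfolding zu(2) w_def by simp
    qed
    have ThA: "transpose_mat Ah \<in> carrier_mat e e" using Ah by simp
    from real_eigenvector_pair[OF ThA epos] obtain \<alpha> \<beta> qa qb where
      "qa \<in> carrier_vec e \<and> qb \<in> carrier_vec e \<and> (qa \<noteq> 0\<^sub>v e \<or> qb \<noteq> 0\<^sub>v e) \<and>
        transpose_mat Ah *\<^sub>v qa = \<alpha> \<cdot>\<^sub>v qa - \<beta> \<cdot>\<^sub>v qb \<and> transpose_mat Ah *\<^sub>v qb = \<beta> \<cdot>\<^sub>v qa + \<alpha> \<cdot>\<^sub>v qb" by (elim exE)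
    then have q[simp]: "qa \<in> carrier_vec e" "qb \<in> carrier_vec e" and nz: "qa \<noteq> 0\<^sub>v e \<or> qb \<noteq> 0\<^sub>v e"
      and ea: "transpose_mat Ah *\<^sub>v qa = \<alpha> \<cdot>\<^sub>v qa - \<beta> \<cdot>\<^sub>v qb" and eb: "transpose_mat Ah *\<^sub>v qb = \<beta> \<cdot>\<^sub>v qa + \<alpha> \<cdot>\<^sub>v qb"
      by simp_all
    have qd[simp]: "dim_vec qa = e" "dim_vec qb = e" using carrier_vecD[OF q(1)] carrier_vecD[OF q(2)] by simp_all
    \<comment> \<open>The minus sign turns the \<open>Gm\<close> term of \<open>split\<close> into
      \<open>- v \<bullet> (L z + W u)\<close>, the form used in \<open>null\<close>.\<close>
    define va vb where "va = - (transpose_mat Gm *\<^sub>v qa)" and "vb = - (transpose_mat Gm *\<^sub>v qb)"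
    have v[simp]: "va \<in> carrier_vec r" "vb \<in> carrier_vec r" by (simp_all add: va_def vb_def)
    have Ha: "qa \<bullet> (S *\<^sub>v (A *\<^sub>v z + B *\<^sub>v u)) = (\<alpha> \<cdot>\<^sub>v qa - \<beta> \<cdot>\<^sub>v qb) \<bullet> (S *\<^sub>v z) - va \<bullet> (L *\<^sub>v z + W *\<^sub>v u)"
      if "z \<in> carrier_vec d" "u \<in> carrier_vec n" for z u
      unfolding split[OF q(1) that] ea va_def by simp
    have Hb: "qb \<bullet> (S *\<^sub>v (A *\<^sub>v z + B *\<^sub>v u)) = (\<beta> \<cdot>\<^sub>v qa + \<alpha> \<cdot>\<^sub>v qb) \<bullet> (S *\<^sub>v z) - vb \<bullet> (L *\<^sub>v z + W *\<^sub>v u)"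
      if "z \<in> carrier_vec d" "u \<in> carrier_vec n" for z u
      unfolding split[OF q(2) that] eb vb_def by simp
    have vd[simp]: "dim_vec va = r" "dim_vec vb = r" by (simp_all add: va_def vb_def)
    have ln: "left_null \<alpha> \<beta> (transpose_mat S *\<^sub>v qa) (transpose_mat S *\<^sub>v qb) va vb"
      unfolding left_null_def using null[OF q(1) _ v(1) Ha] null[OF q(2) _ v(2) Hb] kill
      by (simp add: mv_minus mv_add mv_smult)
    have nn: "0 \<le> qa \<bullet> qa" "0 \<le> qb \<bullet> qb" by (simp_all add: sp_self_nonneg)
    have qq: "0 < qa \<bullet> qa + qb \<bullet> qb"
    proof (rule ccontr)
      assume "\<not> ?thesis"
      then have "qa \<bullet> qa = 0" "qb \<bullet> qb = 0" using nn by linarith+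
      then show False using nz by (simp add: sp_self_eq_0)
    qed
    have vv: "va \<bullet> va + vb \<bullet> vb \<le> 2 * (\<alpha> * (qa \<bullet> qa + qb \<bullet> qb))"
      using ineq[OF q(1)] ineq[OF q(2)] sp_comm[of qa qb] unfolding ea eb va_def vb_def
      by (simp add: sp_minus_left sp_add_left algebra_simps)
    have vn: "0 \<le> va \<bullet> va" "0 \<le> vb \<bullet> vb" by (simp_all add: sp_self_nonneg)
    have \<alpha>0: "0 \<le> \<alpha>"
    proof (rule ccontr)
      assume "\<not> ?thesis"
      then have "\<alpha> * (qa \<bullet> qa + qb \<bullet> qb) < 0" using qq by (simp add: mult_neg_pos)
      then show False using vv vn by linarith
    qed
    have "0 < \<alpha> \<or> 0 \<le> \<alpha> \<and> va = 0\<^sub>v r \<and> vb = 0\<^sub>v r"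
    proof (cases "\<alpha> = 0")
      case True
      then have "va \<bullet> va = 0" "vb \<bullet> vb = 0" using vv vn by auto
      then show ?thesis using True by (simp add: sp_self_eq_0)
    qed (use \<alpha>0 in simp)
    from left_null_zero[OF fr ln this] have "transpose_mat S *\<^sub>v qa = 0\<^sub>v d" "transpose_mat S *\<^sub>v qb = 0\<^sub>v d" by simp_all
    then have "qa = 0\<^sub>v e" "qb = 0\<^sub>v e" using ind by simp_all
    then show False using nz by simp
  qed
  show ?thesis
  proof (rule eq_matI)
    fix i j assume "i < dim_row (0\<^sub>m d d :: real mat)" "j < dim_col (0\<^sub>m d d :: real mat)"
    then show "E $$ (i,j) = 0\<^sub>m d d $$ (i,j)" using e0 by (simp add: ES sp_sum)
  qed (simp_all add: ES)
qed

text \<open>A left null vector \<open>v \<noteq> 0\<close> makes small multiples of \<open>pa pa\<^sup>T + pb pb\<^sup>T\<close> slack.\<close>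
lemma full_row_rank_if_minimal:
  assumes ind: "\<And>v. v \<in> carrier_vec r \<Longrightarrow> transpose_mat L *\<^sub>v v = 0\<^sub>v d \<Longrightarrow> transpose_mat W *\<^sub>v v = 0\<^sub>v n \<Longrightarrow> v = 0\<^sub>v r"
    and min: "\<And>E. slack E \<Longrightarrow> E = 0\<^sub>m d d"
  shows full_row_rank_rhp
  unfolding full_row_rank_rhp_def
proof (intro allI impI)
  fix \<alpha> \<beta> :: real and pa pb va vb assume \<alpha>: "0 < \<alpha>" and ln: "left_null \<alpha> \<beta> pa pb va vb"
  have p[simp]: "pa \<in> carrier_vec d" "pb \<in> carrier_vec d" "va \<in> carrier_vec r" "vb \<in> carrier_vec r"
    and Apa: "transpose_mat A *\<^sub>v pa = \<alpha> \<cdot>\<^sub>v pa - \<beta> \<cdot>\<^sub>v pb - transpose_mat L *\<^sub>v va"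
    and Apb: "transpose_mat A *\<^sub>v pb = \<beta> \<cdot>\<^sub>v pa + \<alpha> \<cdot>\<^sub>v pb - transpose_mat L *\<^sub>v vb"
    and Bp: "transpose_mat B *\<^sub>v pa = - (transpose_mat W *\<^sub>v va)" "transpose_mat B *\<^sub>v pb = - (transpose_mat W *\<^sub>v vb)"
    using ln by (simp_all add: left_null_def)
  have pd[simp]: "dim_vec pa = d" "dim_vec pb = d" "dim_vec va = r" "dim_vec vb = r"
    using carrier_vecD[OF p(1)] carrier_vecD[OF p(2)] carrier_vecD[OF p(3)] carrier_vecD[OF p(4)] by simp_all
  obtain ga where ga: "ga \<in> carrier_vec d" "X *\<^sub>v ga = pa"
    using ker_functional[OF X p(1)] ln unfolding left_null_def by blast
  obtain gb where gb: "gb \<in> carrier_vec d" "X *\<^sub>v gb = pb"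
    using ker_functional[OF X p(2)] ln unfolding left_null_def by blast
  \<comment> \<open>As \<open>X ga = pa\<close>, Cauchy-Schwarz for the form \<open>X\<close> gives
    \<open>(pa \<bullet> z)^2 \<le> Ka * (z \<bullet> X z)\<close>, and likewise for
    \<open>pb\<close> and \<open>Kb\<close>.\<close>
  define Ka where "Ka = ga \<bullet> pa" define Kb where "Kb = gb \<bullet> pb"
  have K: "0 \<le> Ka" "0 \<le> Kb" using X_nonneg[OF ga(1)] X_nonneg[OF gb(1)] by (simp_all add: Ka_def Kb_def ga gb)
  define N where "N = va \<bullet> va + vb \<bullet> vb"
  have N: "0 \<le> N" by (simp add: N_def sp_self_nonneg)
  \<comment> \<open>The first bound gives \<open>c * N \<le> \<alpha>\<close>, which preserves the
    dissipation inequality; the second gives \<open>c * (Ka + Kb) \<le> 1\<close>, which preserves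
    \<open>E \<le> X\<close>. The added 1 keeps the denominators positive.\<close>
  define c where "c = min (\<alpha> / (N + 1)) (1 / (Ka + Kb + 1))"
  have c0: "0 < c" using \<alpha> N K by (simp add: c_def)
  have c1: "c * N \<le> \<alpha>"
  proof -
    have "c * N \<le> \<alpha> / (N + 1) * N" using N by (intro mult_right_mono) (simp_all add: c_def)
    also have "\<dots> \<le> \<alpha>" using \<alpha> N by (simp add: field_simps)
    finally show ?thesis .
  qed
  have c2: "c * (Ka + Kb) \<le> 1"
  proof -
    have "c * (Ka + Kb) \<le> 1 / (Ka + Kb + 1) * (Ka + Kb)" using K by (intro mult_right_mono) (simp_all add: c_def)
    also have "\<dots> \<le> 1" using K by (simp add: field_simps)
    finally show ?thesis .
  qed
  define E where "E = mat d d (\<lambda>(i,j). c * (pa $ i * pa $ j + pb $ i * pb $ j))"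
  have Ec: "E \<in> carrier_mat d d" by (simp add: E_def)
  have Ev: "E *\<^sub>v x = (c * (pa \<bullet> x)) \<cdot>\<^sub>v pa + (c * (pb \<bullet> x)) \<cdot>\<^sub>v pb" if x: "x \<in> carrier_vec d" for x
  proof (rule eq_vecI)
    fix i assume "i < dim_vec ((c * (pa \<bullet> x)) \<cdot>\<^sub>v pa + (c * (pb \<bullet> x)) \<cdot>\<^sub>v pb)"
    then have i: "i < d" by simp
    have "(E *\<^sub>v x) $ i = (\<Sum>j<d. c * (pa $ i * pa $ j + pb $ i * pb $ j) * x $ j)"
      using i x Ec by (simp add: sp_sum E_def)
    also have "\<dots> = (\<Sum>j<d. (c * pa $ i) * (pa $ j * x $ j)) + (\<Sum>j<d. (c * pb $ i) * (pb $ j * x $ j))"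
      unfolding sum.distrib[symmetric] by (intro sum.cong refl) (simp add: algebra_simps)
    also have "\<dots> = (c * pa $ i) * (pa \<bullet> x) + (c * pb $ i) * (pb \<bullet> x)"
      using x by (simp add: sp_sum sum_distrib_left)
    finally show "(E *\<^sub>v x) $ i = ((c * (pa \<bullet> x)) \<cdot>\<^sub>v pa + (c * (pb \<bullet> x)) \<cdot>\<^sub>v pb) $ i" using i by simp
  qed (simp add: E_def)
  have zE: "z \<bullet> (E *\<^sub>v y) = c * ((pa \<bullet> z) * (pa \<bullet> y) + (pb \<bullet> z) * (pb \<bullet> y))"
    if "z \<in> carrier_vec d" "y \<in> carrier_vec d" for z y
    using that sp_comm[of z pa] sp_comm[of z pb] by (simp add: Ev sp_add_right algebra_simps)
  have "slack E"
    unfolding slack_def psd_def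
  proof (intro conjI ballI)
    show "transpose_mat E = E" by (intro eq_matI) (simp_all add: E_def mult.commute)
    fix z :: "real vec" assume z: "z \<in> carrier_vec d"
    show "0 \<le> z \<bullet> (E *\<^sub>v z)" unfolding zE[OF z z] using c0 by simp
    have "(pa \<bullet> z)\<^sup>2 \<le> Ka * (z \<bullet> (X *\<^sub>v z))"
      using psd_cauchy_schwarz[OF X z ga(1)] z sp_comm[of z pa] by (simp add: ga(2) Ka_def mult.commute)
    moreover have "(pb \<bullet> z)\<^sup>2 \<le> Kb * (z \<bullet> (X *\<^sub>v z))"
      using psd_cauchy_schwarz[OF X z gb(1)] z sp_comm[of z pb] by (simp add: gb(2) Kb_def mult.commute)
    ultimately have "c * ((pa \<bullet> z)\<^sup>2 + (pb \<bullet> z)\<^sup>2) \<le> c * ((Ka + Kb) * (z \<bullet> (X *\<^sub>v z)))"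
      using c0 by (intro mult_left_mono) (simp_all add: distrib_right)
    also have "\<dots> = (c * (Ka + Kb)) * (z \<bullet> (X *\<^sub>v z))" by simp
    also have "\<dots> \<le> 1 * (z \<bullet> (X *\<^sub>v z))" by (intro mult_right_mono c2 X_nonneg z)
    finally show "z \<bullet> (E *\<^sub>v z) \<le> z \<bullet> (X *\<^sub>v z)" unfolding zE[OF z z] by (simp add: power2_eq_square)
    fix u :: "real vec" assume u: "u \<in> carrier_vec n"
    define w where "w = L *\<^sub>v z + W *\<^sub>v u"
    have w: "w \<in> carrier_vec r" using z u by (simp add: w_def)
    define x1 where "x1 = pa \<bullet> z" define x2 where "x2 = pb \<bullet> z"
    have da: "pa \<bullet> (A *\<^sub>v z + B *\<^sub>v u) = \<alpha> * x1 - \<beta> * x2 - va \<bullet> w"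
    proof -
      have "pa \<bullet> (A *\<^sub>v z + B *\<^sub>v u) = (transpose_mat A *\<^sub>v pa) \<bullet> z + (transpose_mat B *\<^sub>v pa) \<bullet> u"
        using z u by (simp add: sp_add_right mv_transpose)
      also have "\<dots> = \<alpha> * x1 - \<beta> * x2 - va \<bullet> (L *\<^sub>v z) - va \<bullet> (W *\<^sub>v u)"
        unfolding Apa Bp x1_def x2_def using z u by (simp add: sp_minus_left mv_transpose)
      finally show ?thesis using z u by (simp add: w_def sp_add_right)
    qed
    have db: "pb \<bullet> (A *\<^sub>v z + B *\<^sub>v u) = \<beta> * x1 + \<alpha> * x2 - vb \<bullet> w"
    proof -
      have "pb \<bullet> (A *\<^sub>v z + B *\<^sub>v u) = (transpose_mat A *\<^sub>v pb) \<bullet> z + (transpose_mat B *\<^sub>v pb) \<bullet> u"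
        using z u by (simp add: sp_add_right mv_transpose)
      also have "\<dots> = \<beta> * x1 + \<alpha> * x2 - vb \<bullet> (L *\<^sub>v z) - vb \<bullet> (W *\<^sub>v u)"
        unfolding Apb Bp x1_def x2_def using z u by (simp add: sp_minus_left sp_add_left mv_transpose)
      finally show ?thesis using z u by (simp add: w_def sp_add_right)
    qed
    have sq: "0 \<le> \<alpha> * x\<^sup>2 - 2 * (x * s) + s\<^sup>2 / \<alpha>" for x s
    proof -
      have "\<alpha> * x\<^sup>2 - 2 * (x * s) + s\<^sup>2 / \<alpha> = (\<alpha> * x - s)\<^sup>2 / \<alpha>"
        using \<alpha> by (simp add: field_simps power2_eq_square)
      then show ?thesis using \<alpha> by simp
    qed
    have "(va \<bullet> w)\<^sup>2 + (vb \<bullet> w)\<^sup>2 \<le> N * (w \<bullet> w)"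
      using cauchy_schwarz_vec[OF p(3) w] cauchy_schwarz_vec[OF p(4) w] by (simp add: N_def distrib_right)
    then have "c * (((va \<bullet> w)\<^sup>2 + (vb \<bullet> w)\<^sup>2) / \<alpha>) \<le> c * (N * (w \<bullet> w) / \<alpha>)"
      using c0 \<alpha> by (intro mult_left_mono divide_right_mono) simp_all
    also have "\<dots> = (c * N) / \<alpha> * (w \<bullet> w)" by simp
    also have "\<dots> \<le> 1 * (w \<bullet> w)" using c1 \<alpha> by (intro mult_right_mono sp_self_nonneg) simp
    finally have 1: "c * (((va \<bullet> w)\<^sup>2 + (vb \<bullet> w)\<^sup>2) / \<alpha>) \<le> w \<bullet> w" by simp
    \<comment> \<open>Half of \<open>2 * c * \<alpha> * (x1^2 + x2^2)\<close> completes the squares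
      with the terms in \<open>w\<close>, the other half is nonnegative and dropped. The \<beta>
      terms cancel between \<open>x1\<close> and \<open>x2\<close>.\<close>
    have "0 \<le> c * ((\<alpha> * x1\<^sup>2 - 2 * (x1 * (va \<bullet> w)) + (va \<bullet> w)\<^sup>2 / \<alpha>) + (\<alpha> * x2\<^sup>2 - 2 * (x2 * (vb \<bullet> w)) + (vb \<bullet> w)\<^sup>2 / \<alpha>))"
      using c0 by (intro mult_nonneg_nonneg[OF less_imp_le] add_nonneg_nonneg[OF sq sq])
    moreover have "0 \<le> c * (\<alpha> * x1\<^sup>2 + \<alpha> * x2\<^sup>2)" using c0 \<alpha> by simp
    ultimately have "0 \<le> c * (((va \<bullet> w)\<^sup>2 + (vb \<bullet> w)\<^sup>2) / \<alpha>) + 2 * (c * (x1 * (\<alpha> * x1 - \<beta> * x2 - va \<bullet> w) + x2 * (\<beta> * x1 + \<alpha> * x2 - vb \<bullet> w)))"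
      by (simp add: algebra_simps add_divide_distrib power2_eq_square)
    also have "\<dots> \<le> w \<bullet> w + 2 * (c * (x1 * (\<alpha> * x1 - \<beta> * x2 - va \<bullet> w) + x2 * (\<beta> * x1 + \<alpha> * x2 - vb \<bullet> w)))"
      using 1 by simp
    also have "\<dots> = (L *\<^sub>v z + W *\<^sub>v u) \<bullet> (L *\<^sub>v z + W *\<^sub>v u) + 2 * (z \<bullet> (E *\<^sub>v (A *\<^sub>v z + B *\<^sub>v u)))"
      using zE[OF z, of "A *\<^sub>v z + B *\<^sub>v u"] z u unfolding da db x1_def[symmetric] x2_def[symmetric] w_def[symmetric] by simp
    finally show "0 \<le> (L *\<^sub>v z + W *\<^sub>v u) \<bullet> (L *\<^sub>v z + W *\<^sub>v u) + 2 * (z \<bullet> (E *\<^sub>v (A *\<^sub>v z + B *\<^sub>v u)))" .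
  qed (rule Ec)
  then have "E = 0\<^sub>m d d" by (rule min)
  then have Ez: "z \<bullet> (E *\<^sub>v z) = 0" if "z \<in> carrier_vec d" for z
    using that by (simp add: sp_sum)
  have "c * ((pa \<bullet> pa) * (pa \<bullet> pa) + (pb \<bullet> pa) * (pb \<bullet> pa)) = 0" "c * ((pa \<bullet> pb) * (pa \<bullet> pb) + (pb \<bullet> pb) * (pb \<bullet> pb)) = 0"
    using Ez[OF p(1)] Ez[OF p(2)] unfolding zE[OF p(1) p(1)] zE[OF p(2) p(2)] by simp_all
  then have "pa \<bullet> pa = 0" "pb \<bullet> pb = 0" using c0 by (simp_all add: sum_squares_eq_zero_iff)
  then have p0: "pa = 0\<^sub>v d" "pb = 0\<^sub>v d" by (simp_all add: sp_self_eq_0)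
  have neg: "y = 0\<^sub>v k" if "0\<^sub>v k = - y" "y \<in> carrier_vec k" for y :: "real vec" and k
  proof (rule eq_vecI)
    fix i assume "i < dim_vec (0\<^sub>v k :: real vec)"
    then have i: "i < k" by simp
    have "(0\<^sub>v k :: real vec) $ i = (- y) $ i" using that(1) by simp
    then show "y $ i = 0\<^sub>v k $ i" using i that(2) by simp
  qed (use that in simp)
  \<comment> \<open>With \<open>p = 0\<close> the null equations shrink to \<open>L^T v = 0\<close>
    and \<open>W^T v = 0\<close>, to which \<open>ind\<close> applies.\<close>
  have "0\<^sub>v d = - (transpose_mat L *\<^sub>v va)" using Apa[unfolded p0] by (simp add: mv_zero)
  then have la: "transpose_mat L *\<^sub>v va = 0\<^sub>v d" by (rule neg) simp
  have "0\<^sub>v d = - (transpose_mat L *\<^sub>v vb)" using Apb[unfolded p0] by (simp add: mv_zero)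
  then have lb: "transpose_mat L *\<^sub>v vb = 0\<^sub>v d" by (rule neg) simp
  have "0\<^sub>v n = - (transpose_mat W *\<^sub>v va)" using Bp(1)[unfolded p0] by (simp add: mv_zero)
  then have wa: "transpose_mat W *\<^sub>v va = 0\<^sub>v n" by (rule neg) simp
  have "0\<^sub>v n = - (transpose_mat W *\<^sub>v vb)" using Bp(2)[unfolded p0] by (simp add: mv_zero)
  then have wb: "transpose_mat W *\<^sub>v vb = 0\<^sub>v n" by (rule neg) simp
  show "va = 0\<^sub>v r \<and> vb = 0\<^sub>v r" using ind[OF p(3) la wa] ind[OF p(4) lb wb] by simp
qed

end

section \<open>Resolvents and transfer functions\<close>

text \<open>Rank is the dimension of the column span. A maximal independent set of columns therefore
  has \<open>n\<close> elements and is a basis; a vector \<open>v\<close> whose pairing with every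
  column is 0 then pairs to 0 with every unit vector.\<close>

lemma (in vec_space) rank_full_imp_left_kernel:
  assumes G: "G \<in> carrier_mat n k" and rk: "rank G = n"
    and v: "v \<in> carrier_vec n" and 0: "transpose_mat G *\<^sub>v v = 0\<^sub>v k"
  shows "v = 0\<^sub>v n"
proof -
  have cG: "set (cols G) \<subseteq> carrier_vec n" using G cols_dim[of G] by simp
  have "finite (set (cols G))" by simp
  then obtain U where U: "finite U" "maximal U (\<lambda>T. T \<subseteq> set (cols G) \<and> lin_indpt T)"
    using maximal_exists_superset[of "set (cols G)" "\<lambda>T. T \<subseteq> set (cols G) \<and> lin_indpt T" "{}"]
    by (auto simp: lin_dep_def)
  then have US: "U \<subseteq> set (cols G)" "lin_indpt U" by (auto simp: maximal_def)
  have "card U = n" using rank_card_indpt[OF G U(2)] rk by simp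
  then have "basis U" using US cG U(1) fin_dim by (intro dim_li_is_basis) (auto simp: dim_is_n)
  then have sp: "span U = carrier_vec n" by (simp add: basis_def)
  define N where "N = {x \<in> carrier_vec n. v \<bullet> x = 0}"
  have "LinearCombinations.submodule class_ring N V"
    unfolding LinearCombinations.submodule_def using v
    by (auto simp: N_def scalar_prod_add_distrib[of _ n] module_vec_simps class_ring_simps module_axioms)
  moreover have "U \<subseteq> N"
  proof
    fix c assume "c \<in> U"
    then obtain j where j: "j < k" "c = col G j" using US(1) G by (auto simp: cols_def)
    have "(transpose_mat G *\<^sub>v v) $ j = col G j \<bullet> v" using j G by simp
    then have "v \<bullet> c = 0" using 0 j v G sp_comm[of v c] by simp
    then show "c \<in> N" using j G by (simp add: N_def)
  qed
  ultimately have "span U \<subseteq> N" by (intro span_is_subset)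
  then have "unit_vec n i \<in> N" if "i < n" for i using sp by auto
  then have "v $ i = 0" if "i < n" for i using that v by (auto simp: N_def)
  then show ?thesis using v by (intro eq_vecI) auto
qed

text \<open>A trivial left kernel makes \<open>G\<close> surjective by \<open>mv_surj\<close>, and
  \<open>G y\<close> is a combination of the columns, assembled one column at a time. So the columns
  span the whole space.\<close>

lemma (in vec_space) left_kernel_imp_rank_full:
  assumes G: "G \<in> carrier_mat n k"
    and ker: "\<And>v. v \<in> carrier_vec n \<Longrightarrow> transpose_mat G *\<^sub>v v = 0\<^sub>v k \<Longrightarrow> v = 0\<^sub>v n"
  shows "rank G = n"
proof -
  have cG: "set (cols G) \<subseteq> carrier_vec n" using G cols_dim[of G] by simp
  have "x \<in> span (set (cols G))" if x: "x \<in> carrier_vec n" for x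
  proof -
    obtain y where y: "y \<in> carrier_vec k" "G *\<^sub>v y = x" using mv_surj[OF G ker x] by auto
    have "vec n (\<lambda>i. \<Sum>j<l. G $$ (i,j) * y $ j) \<in> span (set (cols G))" if "l \<le> k" for l
      using that
    proof (induction l)
      case 0
      have "vec n (\<lambda>i. \<Sum>j<0. G $$ (i,j) * y $ j) = 0\<^sub>v n" by (intro eq_vecI) auto
      moreover have "0\<^sub>v n \<in> span (set (cols G))"
        using span_is_submodule[OF cG] unfolding LinearCombinations.submodule_def by (simp add: module_vec_simps)
      ultimately show ?case by simp
    next
      case (Suc l)
      have c: "col G l \<in> span (set (cols G))"
        using in_own_span[OF cG] Suc.prems G by (auto simp: cols_def)
      have "vec n (\<lambda>i. \<Sum>j<Suc l. G $$ (i,j) * y $ j) =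
        vec n (\<lambda>i. \<Sum>j<l. G $$ (i,j) * y $ j) + y $ l \<cdot>\<^sub>v col G l"
        using G Suc.prems by (intro eq_vecI) (auto simp: mult.commute)
      then show ?case using Suc c cG by (simp add: span_add1 smult_in_span)
    qed
    then have "vec n (\<lambda>i. \<Sum>j<k. G $$ (i,j) * y $ j) \<in> span (set (cols G))" by simp
    also have "vec n (\<lambda>i. \<Sum>j<k. G $$ (i,j) * y $ j) = x"
      unfolding y(2)[symmetric] using G y(1) by (intro eq_vecI) (auto simp: sp_sum)
    finally show ?thesis .
  qed
  then have "span (set (cols G)) = carrier_vec n" using span_is_subset2[OF cG] by blast
  then have "span_vs (set (cols G)) = V" by (simp add: module_vec_def)
  then show ?thesis unfolding rank_def using dim_is_n by simp
qed

section \<open>Complexification of real matrices and vectors\<close>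

lemma cmat_carrier[simp]: "M \<in> carrier_mat r k \<Longrightarrow> cmat M \<in> carrier_mat r k"
  by (simp add: cmat_def)

lemma cmat_dims[simp]: "dim_row (cmat M) = dim_row M" "dim_col (cmat M) = dim_col M"
  by (simp_all add: cmat_def)

lemma cmat_index[simp]: "i < dim_row M \<Longrightarrow> j < dim_col M \<Longrightarrow> cmat M $$ (i,j) = complex_of_real (M $$ (i,j))"
  by (simp add: cmat_def)

lemma cmat_transpose: "cmat (transpose_mat M) = transpose_mat (cmat M)"
  by (intro eq_matI) auto

lemma cmat_mult: "dim_col M = dim_row N \<Longrightarrow> cmat (M * N) = cmat M * cmat N"
  by (intro eq_matI) (auto simp: sp_sum)

lemma cmat_minus: "dim_row M = dim_row N \<Longrightarrow> dim_col M = dim_col N \<Longrightarrow> cmat (M - N) = cmat M - cmat N"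
  by (intro eq_matI) auto

lemma cmat_uminus: "cmat (- M) = - cmat M"
  by (intro eq_matI) auto

lemma cmat_one: "cmat (1\<^sub>m k) = 1\<^sub>m k"
  by (intro eq_matI) auto

text \<open>The vector \<open>a + i b\<close>. It translates complex equations such as
  \<open>v^T Z(\<lambda>) = 0\<close> into the pairs of real equations of
  \<open>left_null\<close>.\<close>

definition cvec :: "real vec \<Rightarrow> real vec \<Rightarrow> complex vec" where
  "cvec a b = vec (dim_vec a) (\<lambda>i. Complex (a $ i) (b $ i))"

lemma cvec_dim[simp]: "dim_vec (cvec a b) = dim_vec a"
  by (simp add: cvec_def)

lemma cvec_index[simp]: "i < dim_vec a \<Longrightarrow> cvec a b $ i = Complex (a $ i) (b $ i)"
  by (simp add: cvec_def)

lemma cvec_carrier[simp]: "a \<in> carrier_vec k \<Longrightarrow> cvec a b \<in> carrier_vec k"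
  by (intro carrier_vecI) simp

lemma cvec_cases:
  assumes "v \<in> carrier_vec k"
  obtains a b where "a \<in> carrier_vec k" "b \<in> carrier_vec k" "v = cvec a b"
proof
  show "map_vec Re v \<in> carrier_vec k" "map_vec Im v \<in> carrier_vec k" using assms by simp_all
  show "v = cvec (map_vec Re v) (map_vec Im v)" by (intro eq_vecI) auto
qed

lemma cvec_eq_iff: "dim_vec a = dim_vec b \<Longrightarrow> dim_vec a' = dim_vec a \<Longrightarrow> dim_vec b' = dim_vec a \<Longrightarrow>
    cvec a b = cvec a' b' \<longleftrightarrow> a = a' \<and> b = b'"
  by (auto simp: Matrix.vec_eq_iff)

lemma cvec_eq_0: "dim_vec a = k \<Longrightarrow> dim_vec b = k \<Longrightarrow> cvec a b = 0\<^sub>v k \<longleftrightarrow> a = 0\<^sub>v k \<and> b = 0\<^sub>v k"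
  by (auto simp: Matrix.vec_eq_iff complex_eq_iff)

lemma cvec_mult: "dim_vec a = dim_col M \<Longrightarrow> dim_vec b = dim_col M \<Longrightarrow> cmat M *\<^sub>v cvec a b = cvec (M *\<^sub>v a) (M *\<^sub>v b)"
  by (intro eq_vecI) (auto simp: sp_sum complex_eq_iff)

lemma cvec_smult: "dim_vec a = dim_vec b \<Longrightarrow>
    Complex \<alpha> \<beta> \<cdot>\<^sub>v cvec a b = cvec (\<alpha> \<cdot>\<^sub>v a - \<beta> \<cdot>\<^sub>v b) (\<beta> \<cdot>\<^sub>v a + \<alpha> \<cdot>\<^sub>v b)"
  by (intro eq_vecI) (auto simp: complex_eq_iff algebra_simps)

lemma cvec_minus: "dim_vec a = dim_vec a' \<Longrightarrow> dim_vec b = dim_vec a' \<Longrightarrow> dim_vec b' = dim_vec a' \<Longrightarrow>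
    cvec a b - cvec a' b' = cvec (a - a') (b - b')"
  by (intro eq_vecI) (auto simp: complex_eq_iff)

section \<open>The characteristic matrix, its inverse and the transfer function\<close>

abbreviation charm :: "real mat \<Rightarrow> complex \<Rightarrow> complex mat" where
  "charm A s \<equiv> s \<cdot>\<^sub>m 1\<^sub>m (dim_row A) - cmat A"

lemma charm_carrier: "A \<in> carrier_mat d d \<Longrightarrow> charm A s \<in> carrier_mat d d"
  by auto

lemma charm_mv: "A \<in> carrier_mat d d \<Longrightarrow> v \<in> carrier_vec d \<Longrightarrow> charm A s *\<^sub>v v = s \<cdot>\<^sub>v v - cmat A *\<^sub>v v"
  by (simp add: mv_simps)

lemma charm_det_0:
  assumes A: "A \<in> carrier_mat d d"
  shows "Determinant.det (charm A s) = 0 \<longleftrightarrow> (\<exists>v\<in>carrier_vec d. v \<noteq> 0\<^sub>v d \<and> cmat A *\<^sub>v v = s \<cdot>\<^sub>v v)"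
proof -
  have "charm A s *\<^sub>v v = 0\<^sub>v d \<longleftrightarrow> cmat A *\<^sub>v v = s \<cdot>\<^sub>v v" if "v \<in> carrier_vec d" for v
    unfolding charm_mv[OF A that] using A that by (auto simp: Matrix.vec_eq_iff)
  then show ?thesis using det_0_iff_vec_prod_zero[OF charm_carrier[OF A]] by auto
qed

lemma resolvent_carrier[simp]: "A \<in> carrier_mat d d \<Longrightarrow> resolvent A s \<in> carrier_mat d d"
  unfolding resolvent_def using adj_mat(1)[OF charm_carrier] by auto

lemma resolvent_inverse:
  assumes A: "A \<in> carrier_mat d d" and s: "Determinant.det (charm A s) \<noteq> 0"
  shows "resolvent A s * charm A s = 1\<^sub>m d" "charm A s * resolvent A s = 1\<^sub>m d"
proof -
  note c = charm_carrier[OF A, of s]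
  note a = adj_mat[OF c]
  have "resolvent A s * charm A s = (1 / Determinant.det (charm A s)) \<cdot>\<^sub>m (Determinant.det (charm A s) \<cdot>\<^sub>m 1\<^sub>m d)"
    unfolding resolvent_def by (subst mult_smult_assoc_mat[OF a(1) c]) (simp only: a(3))
  then show "resolvent A s * charm A s = 1\<^sub>m d" using s by (intro eq_matI) auto
  have "charm A s * resolvent A s = (1 / Determinant.det (charm A s)) \<cdot>\<^sub>m (Determinant.det (charm A s) \<cdot>\<^sub>m 1\<^sub>m d)"
    unfolding resolvent_def by (subst mult_smult_distrib[OF c a(1)]) (simp only: a(2))
  then show "charm A s * resolvent A s = 1\<^sub>m d" using s by (intro eq_matI) auto
qed

lemma finite_ss_poles:
  assumes A: "A \<in> carrier_mat d d"
  shows "finite (ss_poles A)"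
proof -
  have "s \<in> spectrum (cmat A)" if "Determinant.det (charm A s) = 0" for s
    using that A unfolding charm_det_0[OF A] by (auto simp: spectrum_def eigenvalue_def eigenvector_def)
  then have "ss_poles A \<subseteq> spectrum (cmat A) \<union> uminus ` spectrum (cmat A)"
    unfolding ss_poles_def by (auto simp: image_iff) (metis minus_minus)
  moreover have "finite (spectrum (cmat A))" using A by (intro card_finite_spectrum(1)[of _ d]) simp
  ultimately show ?thesis by (metis finite_UnI finite_imageI finite_subset)
qed

lemma holomorphic_det:
  assumes "\<And>s. M s \<in> carrier_mat k k" "\<And>i j. i < k \<Longrightarrow> j < k \<Longrightarrow> (\<lambda>s. M s $$ (i,j)) holomorphic_on S"
  shows "(\<lambda>s. Determinant.det (M s)) holomorphic_on S"
proof -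
  have "(\<lambda>s. \<Sum>p\<in>{p. p permutes {0..<k}}. signof p * (\<Prod>i = 0..<k. M s $$ (i, p i))) holomorphic_on S"
  proof (intro holomorphic_on_sum holomorphic_on_mult holomorphic_on_const holomorphic_on_prod)
    fix p i assume "p \<in> {p. p permutes {0..<k}}" "i \<in> {0..<k}"
    then have "i < k" "p i < k" using permutes_in_image[of p "{0..<k}" i] by auto
    then show "(\<lambda>s. M s $$ (i, p i)) holomorphic_on S" by (rule assms(2))
  qed
  then show ?thesis by (simp add: det_def'[OF assms(1)])
qed

text \<open>By Cramer's rule each entry is a cofactor divided by the determinant, and both are
  polynomial in the entries of the characteristic matrix.\<close>

lemma holomorphic_resolvent:
  assumes A: "A \<in> carrier_mat d d" and ij: "i < d" "j < d"
    and S: "\<And>s. s \<in> S \<Longrightarrow> Determinant.det (charm A s) \<noteq> 0"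
  shows "(\<lambda>s. resolvent A s $$ (i,j)) holomorphic_on S"
proof -
  note c = charm_carrier[OF A]
  have e: "(\<lambda>s. charm A s $$ (i,j)) holomorphic_on S" if "i < d" "j < d" for i j
    using that A by (auto intro!: holomorphic_intros)
  have det: "(\<lambda>s. Determinant.det (charm A s)) holomorphic_on S"
    by (rule holomorphic_det[OF c e])
  have cof: "(\<lambda>s. cofactor (charm A s) j i) holomorphic_on S"
    unfolding cofactor_def
  proof (intro holomorphic_on_mult holomorphic_on_const holomorphic_det)
    show "mat_delete (charm A s) j i \<in> carrier_mat (d - 1) (d - 1)" for s
      using mat_delete_carrier[OF c[of s]] ij by (cases d) auto
    fix a b assume ab: "a < d - 1" "b < d - 1"
    have "mat_delete (charm A s) j i $$ (a,b) = charm A s $$ (insert_index j a, insert_index i b)" for s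
      using mat_delete_index[of "charm A s" "d - 1" j i a b] c[of s] ij ab by (cases d) auto
    moreover have "insert_index j a < d" "insert_index i b < d" using ab by (auto simp: insert_index_def)
    ultimately show "(\<lambda>s. mat_delete (charm A s) j i $$ (a,b)) holomorphic_on S" using e by simp
  qed
  have "(\<lambda>s. 1 / Determinant.det (charm A s) * cofactor (charm A s) j i) holomorphic_on S"
    using S by (intro holomorphic_on_mult holomorphic_on_divide holomorphic_on_const det cof) auto
  moreover have "resolvent A s $$ (i,j) = 1 / Determinant.det (charm A s) * cofactor (charm A s) j i" for s
    using A ij by (simp add: resolvent_def adj_mat_def)
  ultimately show ?thesis by simp
qed

lemma holomorphic_transfer:
  assumes A: "A \<in> carrier_mat d d" and B: "B \<in> carrier_mat d n" and L: "L \<in> carrier_mat r d" and W: "W \<in> carrier_mat r n"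
    and ij: "i < r" "j < n" and S: "\<And>s. s \<in> S \<Longrightarrow> Determinant.det (charm A s) \<noteq> 0"
  shows "(\<lambda>s. (cmat W + cmat L * resolvent A s * cmat B) $$ (i,j)) holomorphic_on S"
proof -
  have "(cmat W + cmat L * resolvent A s * cmat B) $$ (i,j) =
    complex_of_real (W $$ (i,j)) + (\<Sum>b<d. (\<Sum>a<d. complex_of_real (L $$ (i,a)) * resolvent A s $$ (a,b)) * complex_of_real (B $$ (b,j)))" for s
    using ij carrier_matD[OF B] carrier_matD[OF L] carrier_matD[OF W] carrier_matD[OF resolvent_carrier[OF A, of s]]
    by (simp add: sp_sum)
  moreover have "(\<lambda>s. complex_of_real (W $$ (i,j)) + (\<Sum>b<d. (\<Sum>a<d. complex_of_real (L $$ (i,a)) * resolvent A s $$ (a,b)) * complex_of_real (B $$ (b,j)))) holomorphic_on S"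
    using S by (intro holomorphic_on_add holomorphic_on_sum holomorphic_on_mult holomorphic_on_const holomorphic_resolvent[OF A]) auto
  ultimately show ?thesis by simp
qed

text \<open>Evaluate \<open>lmi_bilinear\<close> at the states \<open>\<phi> (- s) a\<close> and
  \<open>\<phi> s b\<close>, the responses \<open>(\<lambda> I - A)^{-1} B\<close> to the inputs
  \<open>a\<close> and \<open>b\<close> at \<lambda> = - s and \<lambda> = s. There
  \<open>A z + B u\<close> equals \<open>- s z\<close> and \<open>s z'\<close> respectively, so the
  two terms with \<open>X\<close> cancel and only input and output terms are left.\<close>

lemma para_factorization:
  assumes dims: "A \<in> carrier_mat d d" "B \<in> carrier_mat d n" "C \<in> carrier_mat m d" "D \<in> carrier_mat m n"
    "L \<in> carrier_mat r d" "W \<in> carrier_mat r n" "X \<in> carrier_mat d d" and sym: "transpose_mat X = X"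
    and e1: "- transpose_mat A * X - X * A - transpose_mat C * C = transpose_mat L * L"
    and e2: "- transpose_mat D * C - transpose_mat B * X = transpose_mat W * L"
    and e3: "1\<^sub>m n - transpose_mat D * D = transpose_mat W * W"
    and s: "s \<notin> ss_poles A"
  defines "Z \<equiv> \<lambda>s. cmat W + cmat L * resolvent A s * cmat B"
  shows "para Z s * Z s = 1\<^sub>m n - para (transfer A B C D) s * transfer A B C D s"
proof -
  have dd[simp]: "dim_row A = d" "dim_col A = d" "dim_row B = d" "dim_col B = n" "dim_row C = m" "dim_col C = d"
    "dim_row D = m" "dim_col D = n" "dim_row L = r" "dim_col L = d" "dim_row W = r" "dim_col W = n" "dim_row X = d" "dim_col X = d"
    using carrier_matD[OF dims(1)] carrier_matD[OF dims(2)] carrier_matD[OF dims(3)] carrier_matD[OF dims(4)]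
      carrier_matD[OF dims(5)] carrier_matD[OF dims(6)] carrier_matD[OF dims(7)] by simp_all
  have rd[simp]: "dim_row (resolvent A s) = d" "dim_col (resolvent A s) = d" for s
    using carrier_matD[OF resolvent_carrier[OF dims(1), of s]] by simp_all
  have dets: "Determinant.det (charm A s) \<noteq> 0" "Determinant.det (charm A (- s)) \<noteq> 0"
    using s by (auto simp: ss_poles_def)
  have Zd: "Z s \<in> carrier_mat r n" for s by (intro carrier_matI) (simp_all add: Z_def)
  have Hd: "transfer A B C D s \<in> carrier_mat m n" for s by (intro carrier_matI) (simp_all add: transfer_def)
  note Zdd[simp] = carrier_matD[OF Zd] and Hdd[simp] = carrier_matD[OF Hd]
  define \<phi> where "\<phi> s b = resolvent A s *\<^sub>v (cmat B *\<^sub>v b)" for s b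
  have \<phi>[simp]: "\<phi> s b \<in> carrier_vec d" "dim_vec (\<phi> s b) = d" for s b by (simp_all add: \<phi>_def)
  have Zb: "Z s *\<^sub>v b = cmat L *\<^sub>v \<phi> s b + cmat W *\<^sub>v b"
    and Hb: "transfer A B C D s *\<^sub>v b = cmat C *\<^sub>v \<phi> s b + cmat D *\<^sub>v b" if "b \<in> carrier_vec n" for s b
    using that by (simp_all add: Z_def transfer_def \<phi>_def mv_simps comm_add_vec[of _ r] comm_add_vec[of _ m])
  have st: "cmat A *\<^sub>v \<phi> s b + cmat B *\<^sub>v b = s \<cdot>\<^sub>v \<phi> s b"
    if b: "b \<in> carrier_vec n" and det: "Determinant.det (charm A s) \<noteq> 0" for s b
  proof -
    have "charm A s *\<^sub>v \<phi> s b = (charm A s * resolvent A s) *\<^sub>v (cmat B *\<^sub>v b)"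
      using b by (simp add: \<phi>_def mv_mult)
    also have "\<dots> = cmat B *\<^sub>v b" unfolding resolvent_inverse(2)[OF dims(1) det] using b by simp
    finally have e: "s \<cdot>\<^sub>v \<phi> s b - cmat A *\<^sub>v \<phi> s b = cmat B *\<^sub>v b" unfolding charm_mv[OF dims(1) \<phi>(1)] .
    show ?thesis unfolding e[symmetric] by (intro eq_vecI) simp_all
  qed
  have csym: "transpose_mat (cmat X) = cmat X" using sym by (simp add: cmat_transpose[symmetric])
  have c1: "- transpose_mat (cmat A) * cmat X - cmat X * cmat A - transpose_mat (cmat C) * cmat C = transpose_mat (cmat L) * cmat L"
    using arg_cong[OF e1, of cmat] by (simp add: cmat_minus cmat_mult cmat_uminus cmat_transpose)
  have c2: "- transpose_mat (cmat D) * cmat C - transpose_mat (cmat B) * cmat X = transpose_mat (cmat W) * cmat L"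
    using arg_cong[OF e2, of cmat] by (simp add: cmat_minus cmat_mult cmat_uminus cmat_transpose)
  have c3: "1\<^sub>m n - transpose_mat (cmat D) * cmat D = transpose_mat (cmat W) * cmat W"
    using arg_cong[OF e3, of cmat] by (simp add: cmat_minus cmat_mult cmat_uminus cmat_transpose cmat_one)
  show ?thesis
  proof (rule mat_eq_mv[of _ n n])
    show "para Z s * Z s \<in> carrier_mat n n" by (intro carrier_matI) (simp_all add: para_def)
    show "1\<^sub>m n - para (transfer A B C D) s * transfer A B C D s \<in> carrier_mat n n" by (intro carrier_matI) (simp_all add: para_def)
    fix b :: "complex vec" assume b: "b \<in> carrier_vec n"
    show "(para Z s * Z s) *\<^sub>v b = (1\<^sub>m n - para (transfer A B C D) s * transfer A B C D s) *\<^sub>v b"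
    proof (rule vec_eq_sp[of _ n])
      show "(para Z s * Z s) *\<^sub>v b \<in> carrier_vec n" by (simp add: para_def)
      show "(1\<^sub>m n - para (transfer A B C D) s * transfer A B C D s) *\<^sub>v b \<in> carrier_vec n" by (simp add: para_def)
      fix a :: "complex vec" assume a: "a \<in> carrier_vec n"
      have m: "((transpose_mat (M (- s)) * M s) *\<^sub>v b) \<bullet> a = (M (- s) *\<^sub>v a) \<bullet> (M s *\<^sub>v b)"
        if "\<And>s. M s \<in> carrier_mat k n" for M :: "complex \<Rightarrow> complex mat" and k
        using that[of s] that[of "- s"] a b sp_comm[of "M s *\<^sub>v b" "M (- s) *\<^sub>v a"] by (simp add: mv_mult mv_transpose)
      have "((para Z s * Z s) *\<^sub>v b) \<bullet> a = (Z (- s) *\<^sub>v a) \<bullet> (Z s *\<^sub>v b)"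
        unfolding para_def by (rule m[OF Zd])
      also have "\<dots> = a \<bullet> b - (transfer A B C D (- s) *\<^sub>v a) \<bullet> (transfer A B C D s *\<^sub>v b)
          - ((- s) \<cdot>\<^sub>v \<phi> (- s) a) \<bullet> (cmat X *\<^sub>v \<phi> s b) - \<phi> (- s) a \<bullet> (cmat X *\<^sub>v (s \<cdot>\<^sub>v \<phi> s b))"
        unfolding Zb[OF a] Zb[OF b] Hb[OF a] Hb[OF b]
        unfolding st[OF a dets(2), symmetric] st[OF b dets(1), symmetric]
        by (rule lmi_bilinear[OF _ _ _ _ _ _ _ csym c1 c2 c3, where d = d and m = m and r = r]) (use a b dims in simp_all)
      also have "\<dots> = a \<bullet> b - (transfer A B C D (- s) *\<^sub>v a) \<bullet> (transfer A B C D s *\<^sub>v b)"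
        by (simp add: mv_smult del: index_mult_mat_vec)
      also have "\<dots> = ((1\<^sub>m n - para (transfer A B C D) s * transfer A B C D s) *\<^sub>v b) \<bullet> a"
        using m[where M = "transfer A B C D", OF Hd] a b sp_comm[of a b] by (simp add: para_def mv_mminus sp_minus_left)
      finally show "((para Z s * Z s) *\<^sub>v b) \<bullet> a = ((1\<^sub>m n - para (transfer A B C D) s * transfer A B C D s) *\<^sub>v b) \<bullet> a" .
    qed
  qed
qed

section \<open>Removal of unobservable unstable modes\<close>

context storage begin

text \<open>Restricting \<open>A\<close> to the observable quotient removes its unstable eigenvalues without changing the
  transfer functions; \<open>At\<close> is a copy of that quotient map on the original space.\<close>
lemma stable_reduction:
  obtains At where "At \<in> carrier_mat d d"
    "\<And>z. z \<in> carrier_vec d \<Longrightarrow> X *\<^sub>v (A *\<^sub>v z - At *\<^sub>v z) = 0\<^sub>v d"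
    "\<And>z. z \<in> carrier_vec d \<Longrightarrow> X *\<^sub>v z = 0\<^sub>v d \<Longrightarrow> At *\<^sub>v z = 0\<^sub>v d"
proof -
  from rank_factorization[OF X] obtain k R where "R \<in> carrier_mat k d \<and> X = transpose_mat R * R \<and>
     (\<forall>v\<in>carrier_vec k. transpose_mat R *\<^sub>v v = 0\<^sub>v d \<longrightarrow> v = 0\<^sub>v k)" by (elim exE)
  then have R: "R \<in> carrier_mat k d" and XR: "X = transpose_mat R * R"
    and ind: "\<And>v. v \<in> carrier_vec k \<Longrightarrow> transpose_mat R *\<^sub>v v = 0\<^sub>v d \<Longrightarrow> v = 0\<^sub>v k" by simp_all
  obtain P where P: "P \<in> carrier_mat d k" and RP: "R * P = 1\<^sub>m k" using right_inverse[OF R ind] by blast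
  have dims[simp]: "dim_row R = k" "dim_col R = d" "dim_row P = d" "dim_col P = k"
    using carrier_matD[OF R] carrier_matD[OF P] by simp_all
  have RPv: "R *\<^sub>v (P *\<^sub>v v) = v" if "v \<in> carrier_vec k" for v
  proof -
    have "(R * P) *\<^sub>v v = v" unfolding RP using that by simp
    then show ?thesis using that by (simp add: mv_mult)
  qed
  have Xv: "X *\<^sub>v z = transpose_mat R *\<^sub>v (R *\<^sub>v z)" if "z \<in> carrier_vec d" for z
    using that by (simp add: XR mv_mult)
  have ker: "R *\<^sub>v z = 0\<^sub>v k" if "z \<in> carrier_vec d" "X *\<^sub>v z = 0\<^sub>v d" for z
    using that by (intro ind) (simp_all add: Xv)
  \<comment> \<open>\<open>P R\<close> is a projection whose kernel is that of \<open>X\<close>.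
    Hence \<open>R At = R A\<close>, and invariance of the kernel of \<open>X\<close> under
    \<open>A\<close> makes \<open>At\<close> vanish on it.\<close>
  define At where "At = P * (R * A)"
  have Atv: "At *\<^sub>v z = P *\<^sub>v (R *\<^sub>v (A *\<^sub>v z))" if "z \<in> carrier_vec d" for z
    using that by (simp add: At_def mv_mult)
  show ?thesis
  proof
    show "At \<in> carrier_mat d d" by (intro carrier_matI) (simp_all add: At_def)
    fix z :: "real vec" assume z: "z \<in> carrier_vec d"
    have "R *\<^sub>v (A *\<^sub>v z - At *\<^sub>v z) = 0\<^sub>v k"
      using z RPv[of "R *\<^sub>v (A *\<^sub>v z)"] by (simp add: mv_minus Atv)
    then show "X *\<^sub>v (A *\<^sub>v z - At *\<^sub>v z) = 0\<^sub>v d" using z by (simp add: Xv Atv mv_zero)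
    assume "X *\<^sub>v z = 0\<^sub>v d"
    then show "At *\<^sub>v z = 0\<^sub>v d" using z ker[OF _ ker_X(3)[OF z]] by (simp add: Atv mv_zero)
  qed
qed

end

locale reduced_storage = storage +
  fixes At :: "real mat"
  assumes At[simp]: "At \<in> carrier_mat d d"
    and XAt: "\<And>z. z \<in> carrier_vec d \<Longrightarrow> X *\<^sub>v (A *\<^sub>v z - At *\<^sub>v z) = 0\<^sub>v d"
    and At_ker: "\<And>z. z \<in> carrier_vec d \<Longrightarrow> X *\<^sub>v z = 0\<^sub>v d \<Longrightarrow> At *\<^sub>v z = 0\<^sub>v d"
begin

lemma At_dims[simp]: "dim_row At = d" "dim_col At = d"
  using carrier_matD[OF At] by simp_all

lemma resolvent_dims[simp]: "dim_row (resolvent At s) = d" "dim_col (resolvent At s) = d"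
  "dim_row (resolvent A s) = d" "dim_col (resolvent A s) = d"
  using carrier_matD[OF resolvent_carrier[OF At, of s]] carrier_matD[OF resolvent_carrier[OF A, of s]] by simp_all

text \<open>Since \<open>z \<bullet> X At z \<le> 0\<close>, an eigenvector \<open>a + i b\<close>
  with eigenvalue of positive real part must have \<open>X a = X b = 0\<close>. But
  \<open>At\<close> is zero on the kernel of \<open>X\<close>, so the eigenvalue would be 0.\<close>

lemma At_stable:
  assumes s: "0 < Re s"
  shows "Determinant.det (charm At s) \<noteq> 0"
proof
  assume "Determinant.det (charm At s) = 0"
  then obtain v where v: "v \<in> carrier_vec d" "v \<noteq> 0\<^sub>v d" "cmat At *\<^sub>v v = s \<cdot>\<^sub>v v" unfolding charm_det_0[OF At] by blast
  obtain a b where a: "a \<in> carrier_vec d" and b: "b \<in> carrier_vec d" and vab: "v = cvec a b" by (rule cvec_cases[OF v(1)])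
  have dab[simp]: "dim_vec a = d" "dim_vec b = d" using carrier_vecD[OF a] carrier_vecD[OF b] by simp_all
  define \<alpha> \<beta> where "\<alpha> = Re s" and "\<beta> = Im s"
  have sab: "s = Complex \<alpha> \<beta>" by (simp add: \<alpha>_def \<beta>_def)
  have "cvec (At *\<^sub>v a) (At *\<^sub>v b) = cvec (\<alpha> \<cdot>\<^sub>v a - \<beta> \<cdot>\<^sub>v b) (\<beta> \<cdot>\<^sub>v a + \<alpha> \<cdot>\<^sub>v b)"
    using v(3) unfolding vab sab by (simp add: cvec_mult cvec_smult)
  then have Aa: "At *\<^sub>v a = \<alpha> \<cdot>\<^sub>v a - \<beta> \<cdot>\<^sub>v b" and Ab: "At *\<^sub>v b = \<beta> \<cdot>\<^sub>v a + \<alpha> \<cdot>\<^sub>v b"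
    by (subst (asm) cvec_eq_iff; simp)+
  have q: "z \<bullet> (X *\<^sub>v (At *\<^sub>v z)) \<le> 0" if z: "z \<in> carrier_vec d" for z
  proof -
    have "z \<bullet> (X *\<^sub>v (A *\<^sub>v z)) - z \<bullet> (X *\<^sub>v (At *\<^sub>v z)) = z \<bullet> (X *\<^sub>v (A *\<^sub>v z - At *\<^sub>v z))"
      using z by (simp add: mv_minus sp_minus_right)
    also have "\<dots> = 0" unfolding XAt[OF z] using z by simp
    finally show ?thesis
      using lw_free[OF z z] sym_sp[OF Xc Xsym z, of "A *\<^sub>v z"] sp_self_nonneg[of "L *\<^sub>v z"] sp_self_nonneg[of "C *\<^sub>v z"] z
      by simp
  qed
  have ab: "a \<bullet> (X *\<^sub>v b) = b \<bullet> (X *\<^sub>v a)" by (rule sym_sp[OF Xc Xsym a b])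
  have "\<alpha> * (a \<bullet> (X *\<^sub>v a) + b \<bullet> (X *\<^sub>v b)) = a \<bullet> (X *\<^sub>v (At *\<^sub>v a)) + b \<bullet> (X *\<^sub>v (At *\<^sub>v b))"
    unfolding Aa Ab using ab by (simp add: mv_simps algebra_simps)
  also have "\<dots> \<le> 0" using q[OF a] q[OF b] by simp
  finally have "a \<bullet> (X *\<^sub>v a) + b \<bullet> (X *\<^sub>v b) \<le> 0" using s by (simp add: \<alpha>_def mult_le_0_iff)
  then have z: "a \<bullet> (X *\<^sub>v a) = 0" "b \<bullet> (X *\<^sub>v b) = 0" using X_nonneg[OF a] X_nonneg[OF b] by linarith+
  have "X *\<^sub>v a = 0\<^sub>v d" "X *\<^sub>v b = 0\<^sub>v d" using psd_ker[OF X a z(1)] psd_ker[OF X b z(2)] .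
  then have "At *\<^sub>v a = 0\<^sub>v d" "At *\<^sub>v b = 0\<^sub>v d" using At_ker a b by simp_all
  then have "cmat At *\<^sub>v v = 0\<^sub>v d" unfolding vab by (simp add: cvec_mult cvec_eq_0)
  then have "s \<cdot>\<^sub>v v = 0\<^sub>v d" using v(3) by simp
  then have "s * v $ i = 0" if "i < d" for i using that v(1) arg_cong[of _ _ "\<lambda>w. w $ i"] by (metis carrier_vecD index_smult_vec(1) index_zero_vec(1))
  moreover have "s \<noteq> 0" using s by auto
  ultimately have "v $ i = 0" if "i < d" for i using that by (metis mult_eq_0_iff)
  then have "v = 0\<^sub>v d" using v(1) by (intro eq_vecI) auto
  then show False using v(2) by simp
qed

abbreviation Zred :: "complex \<Rightarrow> complex mat" where
  "Zred s \<equiv> cmat W + cmat L * resolvent At s * cmat B"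

lemma Zred_carrier: "Zred s \<in> carrier_mat r n"
  by (intro carrier_matI) simp_all

text \<open>\<open>Y = L (s I - At)^{-1}\<close> annihilates the kernel of \<open>X\<close>, because
  there \<open>s I - At\<close> is multiplication by \<open>s\<close> and \<open>L\<close> is zero.
  The values of \<open>A - At\<close> lie in this kernel, so
  \<open>Y (s I - A) = Y (s I - At) = L\<close>.\<close>

lemma transfer_reduced:
  assumes s: "0 < Re s" and det: "Determinant.det (charm A s) \<noteq> 0"
  shows "cmat L * resolvent At s = cmat L * resolvent A s"
proof -
  define Y where "Y = cmat L * resolvent At s"
  have Yd[simp]: "dim_row Y = r" "dim_col Y = d" by (simp_all add: Y_def)
  have Y: "Y \<in> carrier_mat r d" by (intro carrier_matI) simp_all
  have YQ: "Y *\<^sub>v (charm At s *\<^sub>v w) = cmat L *\<^sub>v w" if w: "w \<in> carrier_vec d" for w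
  proof -
    have "Y *\<^sub>v (charm At s *\<^sub>v w) = cmat L *\<^sub>v ((resolvent At s * charm At s) *\<^sub>v w)"
      using w by (simp add: Y_def mv_mult)
    then show ?thesis unfolding resolvent_inverse(1)[OF At At_stable[OF s]] using w by simp
  qed
  have YN: "Y *\<^sub>v cvec a b = 0\<^sub>v r"
    if a: "a \<in> carrier_vec d" "X *\<^sub>v a = 0\<^sub>v d" and b: "b \<in> carrier_vec d" "X *\<^sub>v b = 0\<^sub>v d" for a b
  proof -
    have dab[simp]: "dim_vec a = d" "dim_vec b = d" using carrier_vecD[OF a(1)] carrier_vecD[OF b(1)] by simp_all
    have c: "cvec a b \<in> carrier_vec d" using a(1) by simp
    have "cmat At *\<^sub>v cvec a b = 0\<^sub>v d" using At_ker[OF a] At_ker[OF b] by (simp add: cvec_mult cvec_eq_0)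
    then have "charm At s *\<^sub>v cvec a b = s \<cdot>\<^sub>v cvec a b" unfolding charm_mv[OF At c] using c by simp
    then have "s \<cdot>\<^sub>v (Y *\<^sub>v cvec a b) = cmat L *\<^sub>v cvec a b" using YQ[OF c] by (simp add: mv_smult)
    also have "\<dots> = 0\<^sub>v r" using ker_X(2)[OF a] ker_X(2)[OF b] by (simp add: cvec_mult cvec_eq_0)
    finally have e: "s \<cdot>\<^sub>v (Y *\<^sub>v cvec a b) = 0\<^sub>v r" .
    show ?thesis
    proof (rule eq_vecI)
      fix i assume "i < dim_vec (0\<^sub>v r :: complex vec)"
      then have i: "i < r" by simp
      have "(s \<cdot>\<^sub>v (Y *\<^sub>v cvec a b)) $ i = 0" unfolding e using i by simp
      then have "s * (Y *\<^sub>v cvec a b) $ i = 0" using i by (simp del: index_mult_mat_vec)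
      then show "(Y *\<^sub>v cvec a b) $ i = 0\<^sub>v r $ i" using s i by (auto simp del: index_mult_mat_vec)
    qed simp
  qed
  have "Y * charm A s = cmat L"
  proof (rule mat_eq_mv[of _ r d])
    show "Y * charm A s \<in> carrier_mat r d" by (intro carrier_matI) simp_all
    fix w :: "complex vec" assume w: "w \<in> carrier_vec d"
    obtain a b where a: "a \<in> carrier_vec d" and b: "b \<in> carrier_vec d" and wab: "w = cvec a b" by (rule cvec_cases[OF w])
    have dab[simp]: "dim_vec a = d" "dim_vec b = d" using carrier_vecD[OF a] carrier_vecD[OF b] by simp_all
    have "charm A s *\<^sub>v w = charm At s *\<^sub>v w - (cmat A *\<^sub>v w - cmat At *\<^sub>v w)"
      unfolding charm_mv[OF A w] charm_mv[OF At w] using w by (intro eq_vecI) (simp_all del: index_mult_mat_vec)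
    also have "cmat A *\<^sub>v w - cmat At *\<^sub>v w = cvec (A *\<^sub>v a - At *\<^sub>v a) (A *\<^sub>v b - At *\<^sub>v b)"
      unfolding wab by (simp add: cvec_mult cvec_minus)
    finally have "(Y * charm A s) *\<^sub>v w = Y *\<^sub>v (charm At s *\<^sub>v w) - Y *\<^sub>v cvec (A *\<^sub>v a - At *\<^sub>v a) (A *\<^sub>v b - At *\<^sub>v b)"
      using w by (simp add: mv_mult mv_minus)
    also have "\<dots> = cmat L *\<^sub>v w" unfolding YQ[OF w] using a b by (simp add: YN XAt)
    finally show "(Y * charm A s) *\<^sub>v w = cmat L *\<^sub>v w" .
  qed simp
  then have "Y * (charm A s * resolvent A s) = cmat L * resolvent A s"
    using assoc_mult_mat[OF Y charm_carrier[OF A, of s] resolvent_carrier[OF A, of s]] by simp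
  then show ?thesis unfolding resolvent_inverse(2)[OF A det] using Y by (simp add: Y_def)
qed

text \<open>The vector \<open>p\<close> is forced to be \<open>(s I - At)^{-T} L^T v\<close>.
  Pairing its equation with \<open>z\<close> in the kernel of \<open>X\<close> gives
  \<open>s * (p \<bullet> z) = 0\<close>, so \<open>p\<close> vanishes on that kernel, and on such
  functionals the transposes of \<open>At\<close> and \<open>A\<close> agree. The remaining
  equation, for \<open>B\<close>, is \<open>Z^T v = 0\<close>.\<close>

lemma left_null_iff:
  assumes \<alpha>: "0 < \<alpha>" and v: "va \<in> carrier_vec r" "vb \<in> carrier_vec r"
  shows "transpose_mat (Zred (Complex \<alpha> \<beta>)) *\<^sub>v cvec va vb = 0\<^sub>v n \<longleftrightarrow> (\<exists>pa pb. left_null \<alpha> \<beta> pa pb va vb)"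
proof -
  define s where "s = Complex \<alpha> \<beta>"
  have s: "0 < Re s" using \<alpha> by (simp add: s_def)
  note inv = resolvent_inverse[OF At At_stable[OF s]]
  have vd[simp]: "dim_vec va = r" "dim_vec vb = r" using carrier_vecD[OF v(1)] carrier_vecD[OF v(2)] by simp_all
  define p where "p = transpose_mat (resolvent At s) *\<^sub>v (transpose_mat (cmat L) *\<^sub>v cvec va vb)"
  have pc: "p \<in> carrier_vec d" by (simp add: p_def)
  have Ztv: "transpose_mat (Zred s) *\<^sub>v cvec va vb = transpose_mat (cmat W) *\<^sub>v cvec va vb + transpose_mat (cmat B) *\<^sub>v p"
  proof (rule vec_eq_sp[of _ n])
    fix z :: "complex vec" assume z: "z \<in> carrier_vec n"
    then show "(transpose_mat (Zred s) *\<^sub>v cvec va vb) \<bullet> z = (transpose_mat (cmat W) *\<^sub>v cvec va vb + transpose_mat (cmat B) *\<^sub>v p) \<bullet> z"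
      by (simp add: mv_transpose mv_simps p_def)
  qed simp_all
  have Qtp: "transpose_mat (charm At s) *\<^sub>v p = transpose_mat (cmat L) *\<^sub>v cvec va vb"
  proof (rule vec_eq_sp[of _ d])
    fix z :: "complex vec" assume z: "z \<in> carrier_vec d"
    have "(transpose_mat (charm At s) *\<^sub>v p) \<bullet> z = cvec va vb \<bullet> (cmat L *\<^sub>v ((resolvent At s * charm At s) *\<^sub>v z))"
      using z by (simp add: mv_transpose p_def mv_mult)
    also have "\<dots> = (transpose_mat (cmat L) *\<^sub>v cvec va vb) \<bullet> z" unfolding inv(1) using z by (simp add: mv_transpose)
    finally show "(transpose_mat (charm At s) *\<^sub>v p) \<bullet> z = (transpose_mat (cmat L) *\<^sub>v cvec va vb) \<bullet> z" .
  qed simp_all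
  have Qt_real: "transpose_mat (charm At s) *\<^sub>v cvec pa pb =
      cvec (\<alpha> \<cdot>\<^sub>v pa - \<beta> \<cdot>\<^sub>v pb - transpose_mat At *\<^sub>v pa) (\<beta> \<cdot>\<^sub>v pa + \<alpha> \<cdot>\<^sub>v pb - transpose_mat At *\<^sub>v pb)"
    if "pa \<in> carrier_vec d" "pb \<in> carrier_vec d" for pa pb
  proof -
    have pd: "dim_vec pa = d" "dim_vec pb = d" using that by simp_all
    have "transpose_mat (charm At s) = charm (transpose_mat At) s" by (intro eq_matI) auto
    then have "transpose_mat (charm At s) *\<^sub>v cvec pa pb = s \<cdot>\<^sub>v cvec pa pb - cmat (transpose_mat At) *\<^sub>v cvec pa pb"
      using charm_mv[of "transpose_mat At" d "cvec pa pb" s] that by simp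
    then show ?thesis using pd by (simp add: s_def cvec_smult cvec_mult cvec_minus)
  qed
  have LT: "transpose_mat (cmat L) *\<^sub>v cvec va vb = cvec (transpose_mat L *\<^sub>v va) (transpose_mat L *\<^sub>v vb)"
    and WT: "transpose_mat (cmat W) *\<^sub>v cvec va vb = cvec (transpose_mat W *\<^sub>v va) (transpose_mat W *\<^sub>v vb)"
    by (simp_all add: cmat_transpose[symmetric] cvec_mult)
  have BT: "transpose_mat (cmat B) *\<^sub>v cvec pa pb = cvec (transpose_mat B *\<^sub>v pa) (transpose_mat B *\<^sub>v pb)"
    if "pa \<in> carrier_vec d" "pb \<in> carrier_vec d" for pa pb
    using that by (simp add: cmat_transpose[symmetric] cvec_mult)
  have AtT: "transpose_mat At *\<^sub>v q = transpose_mat A *\<^sub>v q"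
    if q: "q \<in> carrier_vec d" and k: "\<And>z. z \<in> carrier_vec d \<Longrightarrow> X *\<^sub>v z = 0\<^sub>v d \<Longrightarrow> q \<bullet> z = 0" for q
  proof (rule vec_eq_sp[of _ d])
    fix z :: "real vec" assume z: "z \<in> carrier_vec d"
    have "q \<bullet> (A *\<^sub>v z - At *\<^sub>v z) = 0" using XAt[OF z] z by (intro k) simp_all
    then show "(transpose_mat At *\<^sub>v q) \<bullet> z = (transpose_mat A *\<^sub>v q) \<bullet> z" using q z by (simp add: mv_transpose sp_minus_right)
  qed simp_all
  show ?thesis
  proof
    assume "transpose_mat (Zred (Complex \<alpha> \<beta>)) *\<^sub>v cvec va vb = 0\<^sub>v n"
    then have Z0: "transpose_mat (cmat W) *\<^sub>v cvec va vb + transpose_mat (cmat B) *\<^sub>v p = 0\<^sub>v n"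
      using Ztv by (simp add: s_def)
    obtain pa pb where pa: "pa \<in> carrier_vec d" and pb: "pb \<in> carrier_vec d" and pab: "p = cvec pa pb" by (rule cvec_cases[OF pc])
    have pd[simp]: "dim_vec pa = d" "dim_vec pb = d" using carrier_vecD[OF pa] carrier_vecD[OF pb] by simp_all
    have "cvec (\<alpha> \<cdot>\<^sub>v pa - \<beta> \<cdot>\<^sub>v pb - transpose_mat At *\<^sub>v pa) (\<beta> \<cdot>\<^sub>v pa + \<alpha> \<cdot>\<^sub>v pb - transpose_mat At *\<^sub>v pb)
        = cvec (transpose_mat L *\<^sub>v va) (transpose_mat L *\<^sub>v vb)"
      using Qtp unfolding pab Qt_real[OF pa pb] LT .
    then have ea: "\<alpha> \<cdot>\<^sub>v pa - \<beta> \<cdot>\<^sub>v pb - transpose_mat At *\<^sub>v pa = transpose_mat L *\<^sub>v va"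
      and eb: "\<beta> \<cdot>\<^sub>v pa + \<alpha> \<cdot>\<^sub>v pb - transpose_mat At *\<^sub>v pb = transpose_mat L *\<^sub>v vb"
      by (subst (asm) cvec_eq_iff; simp)+
    have Ata: "transpose_mat At *\<^sub>v pa = \<alpha> \<cdot>\<^sub>v pa - \<beta> \<cdot>\<^sub>v pb - transpose_mat L *\<^sub>v va"
      unfolding ea[symmetric] by (intro eq_vecI) (simp_all del: index_mult_mat_vec)
    have Atb: "transpose_mat At *\<^sub>v pb = \<beta> \<cdot>\<^sub>v pa + \<alpha> \<cdot>\<^sub>v pb - transpose_mat L *\<^sub>v vb"
      unfolding eb[symmetric] by (intro eq_vecI) (simp_all del: index_mult_mat_vec)
    have kill: "pa \<bullet> z = 0 \<and> pb \<bullet> z = 0" if z: "z \<in> carrier_vec d" "X *\<^sub>v z = 0\<^sub>v d" for z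
    proof -
      have a: "(transpose_mat At *\<^sub>v q) \<bullet> z = 0" if "q \<in> carrier_vec d" for q
        using At_ker[OF z] z that by (simp add: mv_transpose)
      have l: "(transpose_mat L *\<^sub>v v) \<bullet> z = 0" if "v \<in> carrier_vec r" for v
        using ker_X(2)[OF z] z that by (simp add: mv_transpose)
      have "0 = \<alpha> * (pa \<bullet> z) - \<beta> * (pb \<bullet> z)" "0 = \<beta> * (pa \<bullet> z) + \<alpha> * (pb \<bullet> z)"
        using arg_cong[OF Ata, of "\<lambda>w. w \<bullet> z"] arg_cong[OF Atb, of "\<lambda>w. w \<bullet> z"] z a[OF pa] a[OF pb] l[OF v(1)] l[OF v(2)]
        by (simp_all add: sp_minus_left sp_add_left)
      \<comment> \<open>Multiplication of the complex equation by the conjugate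
        \<open>\<alpha> - i \<beta>\<close>.\<close>
      then have "\<alpha> * (\<alpha> * (pa \<bullet> z) - \<beta> * (pb \<bullet> z)) + \<beta> * (\<beta> * (pa \<bullet> z) + \<alpha> * (pb \<bullet> z)) = 0"
        "\<alpha> * (\<beta> * (pa \<bullet> z) + \<alpha> * (pb \<bullet> z)) - \<beta> * (\<alpha> * (pa \<bullet> z) - \<beta> * (pb \<bullet> z)) = 0" by simp_all
      then have "(\<alpha> * \<alpha> + \<beta> * \<beta>) * (pa \<bullet> z) = 0" "(\<alpha> * \<alpha> + \<beta> * \<beta>) * (pb \<bullet> z) = 0"
        by (simp_all add: algebra_simps)
      moreover have "\<alpha> * \<alpha> + \<beta> * \<beta> \<noteq> 0" using \<alpha> by (simp add: sum_squares_eq_zero_iff)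
      ultimately show ?thesis by (simp only: mult_eq_0_iff) simp
    qed
    have "cvec (transpose_mat W *\<^sub>v va) (transpose_mat W *\<^sub>v vb) + cvec (transpose_mat B *\<^sub>v pa) (transpose_mat B *\<^sub>v pb) = 0\<^sub>v n"
      using Z0 unfolding pab WT BT[OF pa pb] .
    then have sumW: "(transpose_mat W *\<^sub>v va) $ i + (transpose_mat B *\<^sub>v pa) $ i = 0 \<and> (transpose_mat W *\<^sub>v vb) $ i + (transpose_mat B *\<^sub>v pb) $ i = 0"
      if "i < n" for i
      using that arg_cong[of _ "0\<^sub>v n" "\<lambda>w. w $ i"] by (auto simp: complex_eq_iff Matrix.vec_eq_iff simp del: index_mult_mat_vec)
    have "transpose_mat B *\<^sub>v pa = - (transpose_mat W *\<^sub>v va)" "transpose_mat B *\<^sub>v pb = - (transpose_mat W *\<^sub>v vb)"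
      using sumW by (auto intro!: eq_vecI simp: eq_neg_iff_add_eq_0 add.commute simp del: index_mult_mat_vec)
    then have "left_null \<alpha> \<beta> pa pb va vb"
      unfolding left_null_def using pa pb v kill AtT[OF pa] AtT[OF pb] Ata Atb by simp
    then show "\<exists>pa pb. left_null \<alpha> \<beta> pa pb va vb" by blast
  next
    assume "\<exists>pa pb. left_null \<alpha> \<beta> pa pb va vb"
    then obtain pa pb where ln: "left_null \<alpha> \<beta> pa pb va vb" by blast
    have pa: "pa \<in> carrier_vec d" and pb: "pb \<in> carrier_vec d"
      and kill: "\<And>z. z \<in> carrier_vec d \<Longrightarrow> X *\<^sub>v z = 0\<^sub>v d \<Longrightarrow> pa \<bullet> z = 0 \<and> pb \<bullet> z = 0"
      and ea: "transpose_mat A *\<^sub>v pa = \<alpha> \<cdot>\<^sub>v pa - \<beta> \<cdot>\<^sub>v pb - transpose_mat L *\<^sub>v va"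
      and eb: "transpose_mat A *\<^sub>v pb = \<beta> \<cdot>\<^sub>v pa + \<alpha> \<cdot>\<^sub>v pb - transpose_mat L *\<^sub>v vb"
      and B: "transpose_mat B *\<^sub>v pa = - (transpose_mat W *\<^sub>v va)" "transpose_mat B *\<^sub>v pb = - (transpose_mat W *\<^sub>v vb)"
      using ln by (simp_all add: left_null_def)
    have pd[simp]: "dim_vec pa = d" "dim_vec pb = d" using carrier_vecD[OF pa] carrier_vecD[OF pb] by simp_all
    have AtTa: "transpose_mat At *\<^sub>v pa = transpose_mat A *\<^sub>v pa" by (rule AtT[OF pa]) (use kill in blast)
    have AtTb: "transpose_mat At *\<^sub>v pb = transpose_mat A *\<^sub>v pb" by (rule AtT[OF pb]) (use kill in blast)
    have "\<alpha> \<cdot>\<^sub>v pa - \<beta> \<cdot>\<^sub>v pb - transpose_mat At *\<^sub>v pa = transpose_mat L *\<^sub>v va"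
      unfolding AtTa ea by (intro eq_vecI) (simp_all del: index_mult_mat_vec)
    moreover have "\<beta> \<cdot>\<^sub>v pa + \<alpha> \<cdot>\<^sub>v pb - transpose_mat At *\<^sub>v pb = transpose_mat L *\<^sub>v vb"
      unfolding AtTb eb by (intro eq_vecI) (simp_all del: index_mult_mat_vec)
    ultimately have Q: "transpose_mat (charm At s) *\<^sub>v cvec pa pb = transpose_mat (cmat L) *\<^sub>v cvec va vb"
      unfolding Qt_real[OF pa pb] LT by simp
    have "p = cvec pa pb"
    proof (rule vec_eq_sp[of _ d])
      fix z :: "complex vec" assume z: "z \<in> carrier_vec d"
      have "p \<bullet> z = (transpose_mat (cmat L) *\<^sub>v cvec va vb) \<bullet> (resolvent At s *\<^sub>v z)"
        unfolding p_def using z by (subst mv_transpose) simp_all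
      also have "\<dots> = cvec pa pb \<bullet> ((charm At s * resolvent At s) *\<^sub>v z)"
        unfolding Q[symmetric] using z by (simp add: mv_transpose mv_mult)
      also have "\<dots> = cvec pa pb \<bullet> z" unfolding inv(2) using z by simp
      finally show "p \<bullet> z = cvec pa pb \<bullet> z" .
    qed (use pc pa in simp_all)
    then have "transpose_mat (Zred s) *\<^sub>v cvec va vb =
        cvec (transpose_mat W *\<^sub>v va) (transpose_mat W *\<^sub>v vb) + cvec (- (transpose_mat W *\<^sub>v va)) (- (transpose_mat W *\<^sub>v vb))"
      unfolding Ztv WT by (simp only: BT[OF pa pb] B)
    also have "\<dots> = 0\<^sub>v n" by (intro eq_vecI) (simp_all add: complex_eq_iff del: index_mult_mat_vec)
    finally show "transpose_mat (Zred (Complex \<alpha> \<beta>)) *\<^sub>v cvec va vb = 0\<^sub>v n" by (simp add: s_def)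
  qed
qed

lemma full_row_rank_iff:
  "full_row_rank_rhp \<longleftrightarrow> (\<forall>s. 0 < Re s \<longrightarrow> vec_space.rank r (Zred s) = r)"
proof
  assume fr: full_row_rank_rhp
  show "\<forall>s. 0 < Re s \<longrightarrow> vec_space.rank r (Zred s) = r"
  proof (intro allI impI)
    fix s :: complex assume s: "0 < Re s"
    show "vec_space.rank r (Zred s) = r"
    proof (rule vec_space.left_kernel_imp_rank_full[OF Zred_carrier])
      fix v assume v: "v \<in> carrier_vec r" and 0: "transpose_mat (Zred s) *\<^sub>v v = 0\<^sub>v n"
      obtain va vb where va: "va \<in> carrier_vec r" and vb: "vb \<in> carrier_vec r" and vab: "v = cvec va vb" by (rule cvec_cases[OF v])
      have "\<exists>pa pb. left_null (Re s) (Im s) pa pb va vb"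
        using left_null_iff[OF s va vb, of "Im s"] 0 vab by simp
      then have "va = 0\<^sub>v r \<and> vb = 0\<^sub>v r" using fr s unfolding full_row_rank_rhp_def by blast
      then show "v = 0\<^sub>v r" unfolding vab by (simp add: cvec_eq_0)
    qed
  qed
next
  assume rk: "\<forall>s. 0 < Re s \<longrightarrow> vec_space.rank r (Zred s) = r"
  show full_row_rank_rhp unfolding full_row_rank_rhp_def
  proof (intro allI impI)
    fix \<alpha> \<beta> :: real and pa pb va vb assume \<alpha>: "0 < \<alpha>" and ln: "left_null \<alpha> \<beta> pa pb va vb"
    have va: "va \<in> carrier_vec r" and vb: "vb \<in> carrier_vec r" using ln by (simp_all add: left_null_def)
    have "transpose_mat (Zred (Complex \<alpha> \<beta>)) *\<^sub>v cvec va vb = 0\<^sub>v n" using left_null_iff[OF \<alpha> va vb] ln by blast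
    moreover have "vec_space.rank r (Zred (Complex \<alpha> \<beta>)) = r" using rk \<alpha> by simp
    ultimately have "cvec va vb = 0\<^sub>v r"
      using vec_space.rank_full_imp_left_kernel[OF Zred_carrier] va by (metis cvec_carrier)
    then show "va = 0\<^sub>v r \<and> vb = 0\<^sub>v r" using va vb by (simp add: cvec_eq_0)
  qed
qed

text \<open>An analytic extension can only be \<open>Zred\<close>: the two agree off the finite pole
  set, and the set where they differ is open by continuity, so being finite it is empty. The rank
  requirement therefore concerns \<open>Zred\<close>, including its values at cancelled
  poles.\<close>

lemma spectral_factor_iff:
  assumes id: "\<And>s. s \<notin> ss_poles A \<Longrightarrow> para (\<lambda>s. cmat W + cmat L * resolvent A s * cmat B) s * (cmat W + cmat L * resolvent A s * cmat B) = F s"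
  shows "spectral_factor r n (ss_poles A) (\<lambda>s. cmat W + cmat L * resolvent A s * cmat B) F \<longleftrightarrow> full_row_rank_rhp"
proof -
  have fin: "finite (ss_poles A)" by (rule finite_ss_poles[OF A])
  have hol: "(\<lambda>s. Zred s $$ (i,j)) holomorphic_on {s. 0 < Re s}" if "i < r" "j < n" for i j
    by (rule holomorphic_transfer[OF At B L W that]) (use At_stable in simp)
  have agree: "Zred s = cmat W + cmat L * resolvent A s * cmat B" if "0 < Re s" "s \<notin> ss_poles A" for s
  proof -
    have "Determinant.det (charm A s) \<noteq> 0" using that(2) by (auto simp: ss_poles_def)
    then show ?thesis using transfer_reduced[OF that(1)] by simp
  qed
  show ?thesis
  proof
    assume "spectral_factor r n (ss_poles A) (\<lambda>s. cmat W + cmat L * resolvent A s * cmat B) F"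
    then obtain G where Gh: "\<And>i j. i < r \<Longrightarrow> j < n \<Longrightarrow> (\<lambda>s. G s $$ (i,j)) holomorphic_on {s. 0 < Re s}"
      and Gr: "\<And>s. 0 < Re s \<Longrightarrow> G s \<in> carrier_mat r n \<and> vec_space.rank r (G s) = r"
      and Ge: "\<And>s. 0 < Re s \<Longrightarrow> s \<notin> ss_poles A \<Longrightarrow> G s = cmat W + cmat L * resolvent A s * cmat B"
      unfolding spectral_factor_def by blast
    have "G s = Zred s" if s: "0 < Re s" for s
    proof (rule eq_matI)
      fix i j assume "i < dim_row (Zred s)" "j < dim_col (Zred s)"
      then have ij: "i < r" "j < n" by simp_all
      define h where "h s = G s $$ (i,j) - Zred s $$ (i,j)" for s
      have op: "open {s. 0 < Re s}" by (rule open_halfspace_Re_gt)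
      have "continuous_on {s. 0 < Re s} h"
        unfolding h_def by (intro continuous_on_diff holomorphic_on_imp_continuous_on Gh hol ij)
      then have "open ({s. 0 < Re s} \<inter> h -` (- {0}))"
        by (rule continuous_open_preimage) (simp_all add: op open_Compl)
      moreover have "{s. 0 < Re s} \<inter> h -` (- {0}) \<subseteq> ss_poles A"
      proof
        fix s assume "s \<in> {s. 0 < Re s} \<inter> h -` (- {0})"
        then have 1: "0 < Re s" and 2: "h s \<noteq> 0" by simp_all
        show "s \<in> ss_poles A"
        proof (rule ccontr)
          assume "s \<notin> ss_poles A"
          then have "G s = Zred s" using Ge[OF 1] agree[OF 1] by simp
          then show False using 2 by (simp add: h_def)
        qed
      qed
      ultimately have "{s. 0 < Re s} \<inter> h -` (- {0}) = {}"
        using finite_imp_not_open fin finite_subset by blast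
      then have "h s = 0" using s by blast
      then show "G s $$ (i,j) = Zred s $$ (i,j)" by (simp add: h_def)
    qed (use Gr[OF s] in auto)
    then show full_row_rank_rhp unfolding full_row_rank_iff using Gr by simp
  next
    assume fr: full_row_rank_rhp
    have rk: "vec_space.rank r (Zred s) = r" if "0 < Re s" for s using fr that unfolding full_row_rank_iff by blast
    show "spectral_factor r n (ss_poles A) (\<lambda>s. cmat W + cmat L * resolvent A s * cmat B) F"
      unfolding spectral_factor_def
    proof (intro conjI exI[of _ Zred] allI impI)
      fix s assume "s \<notin> ss_poles A"
      then show "para (\<lambda>s. cmat W + cmat L * resolvent A s * cmat B) s * (cmat W + cmat L * resolvent A s * cmat B) = F s"
        by (rule id)
    next
      fix s assume "0 < Re s \<and> s \<notin> ss_poles A"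
      then show "Zred s = cmat W + cmat L * resolvent A s * cmat B" using agree by blast
    next
      fix s :: complex assume "0 < Re s"
      then show "vec_space.rank r (Zred s) = r" by (rule rk)
    next
      fix s show "Zred s \<in> carrier_mat r n" by (rule Zred_carrier)
    next
      fix i j assume "i < r" "j < n"
      then show "(\<lambda>s. Zred s $$ (i,j)) holomorphic_on {s. 0 < Re s}" by (rule hol)
    qed (rule fin)
  qed
qed

end

section \<open>Primitives of locally integrable functions\<close>

abbreviation itg :: "(real \<Rightarrow> real) \<Rightarrow> real \<Rightarrow> real \<Rightarrow> real" where
  "itg f a b \<equiv> interval_lebesgue_integral lborel (ereal a) (ereal b) f"

definition loc_int :: "(real \<Rightarrow> real) \<Rightarrow> bool" where
  "loc_int f \<longleftrightarrow> f \<in> borel_measurable borel \<and> (\<forall>a b. set_integrable lborel {a..b} f)"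

definition loc_l2 :: "(real \<Rightarrow> real) \<Rightarrow> bool" where
  "loc_l2 f \<longleftrightarrow> f \<in> borel_measurable borel \<and> (\<forall>a b. set_integrable lborel {a..b} (\<lambda>t. (f t)\<^sup>2))"

lemma set_borel_measurable_Icc: "f \<in> borel_measurable borel \<Longrightarrow> set_borel_measurable lborel {a..b} f"
  for f :: "real \<Rightarrow> real"
  unfolding set_borel_measurable_def by simp

lemma loc_int_add: "loc_int f \<Longrightarrow> loc_int g \<Longrightarrow> loc_int (\<lambda>t. f t + g t)"
  by (auto simp: loc_int_def)

lemma loc_int_cmult: "loc_int f \<Longrightarrow> loc_int (\<lambda>t. c * f t)"
  by (auto simp: loc_int_def)

lemma loc_int_diff: "loc_int f \<Longrightarrow> loc_int g \<Longrightarrow> loc_int (\<lambda>t. f t - g t)"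
  by (auto simp: loc_int_def)

lemma loc_int_zero: "loc_int (\<lambda>t. 0)"
  by (auto simp: loc_int_def set_integrable_def)

lemma loc_int_sum: "(\<And>i. i \<in> S \<Longrightarrow> loc_int (f i)) \<Longrightarrow> loc_int (\<lambda>t. \<Sum>i\<in>S. f i t)"
  by (induction S rule: infinite_finite_induct) (auto intro: loc_int_add loc_int_zero)

lemma loc_int_interval: 
  assumes "loc_int f"
  shows "interval_lebesgue_integrable lborel (ereal a) (ereal b) f"
proof -
  have "set_integrable lborel {x..y} f" for x y using assms by (simp add: loc_int_def)
  then have "set_integrable lborel {x<..<y} f" for x y
    by (rule set_integrable_subset) (auto simp: greaterThanLessThan_subseteq_atLeastAtMost_iff)
  then show ?thesis by (simp add: interval_lebesgue_integrable_def)
qed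

lemma itg_add: "loc_int f \<Longrightarrow> loc_int g \<Longrightarrow> itg (\<lambda>t. f t + g t) a b = itg f a b + itg g a b"
  by (rule interval_lebesgue_integral_add(2)) (rule loc_int_interval, assumption)+

lemma itg_diff: "loc_int f \<Longrightarrow> loc_int g \<Longrightarrow> itg (\<lambda>t. f t - g t) a b = itg f a b - itg g a b"
  by (rule interval_lebesgue_integral_diff(2)) (rule loc_int_interval, assumption)+

lemma itg_sum: "finite S \<Longrightarrow> (\<And>i. i \<in> S \<Longrightarrow> loc_int (f i)) \<Longrightarrow> itg (\<lambda>t. \<Sum>i\<in>S. f i t) a b = (\<Sum>i\<in>S. itg (f i) a b)"
proof (induction S rule: finite_induct)
  case (insert i S)
  then show ?case using itg_add[of "f i" "\<lambda>t. \<Sum>i\<in>S. f i t" a b] loc_int_sum[of S f] by simp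
qed simp

lemma itg_combine:
  assumes "loc_int f"
  shows "itg f a b + itg f b c = itg f a c"
proof -
  have "min (ereal a) (min (ereal b) (ereal c)) = ereal (min a (min b c))"
    "max (ereal a) (max (ereal b) (ereal c)) = ereal (max a (max b c))" by (simp_all add: min_def max_def)
  then show ?thesis using loc_int_interval[OF assms] by (intro interval_integral_sum) (simp only:)
qed

lemma itg_mono:
  assumes "loc_int f" "loc_int g" "\<And>t. f t \<le> g t" "a \<le> b"
  shows "itg f a b \<le> itg g a b"
proof -
  have "set_integrable lborel {a..b} f" "set_integrable lborel {a..b} g" using assms by (auto simp: loc_int_def)
  then show ?thesis using assms(3,4) by (simp add: interval_integral_Icc set_integral_mono)
qed

lemma itg_shift: "itg (\<lambda>t. f (t + c)) a b = itg f (a + c) (b + c)"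
proof -
  have *: "itg (\<lambda>t. f (t + c)) a b = itg f (a + c) (b + c)" if "a \<le> b" for a b
  proof -
    have "itg f (a + c) (b + c) = (\<integral>x. indicator {a + c..b + c} x * f x \<partial>lborel)"
      using that by (simp add: interval_integral_Icc set_lebesgue_integral_def)
    also have "\<dots> = (\<integral>x. indicator {a + c..b + c} (c + 1 * x) * f (c + 1 * x) \<partial>lborel)"
      by (subst lborel_integral_real_affine[where c = 1 and t = c]) simp_all
    also have "\<dots> = (\<integral>x. indicator {a..b} x * f (x + c) \<partial>lborel)"
      by (intro Bochner_Integration.integral_cong refl) (auto simp: indicator_def add.commute)
    also have "\<dots> = itg (\<lambda>t. f (t + c)) a b"
      using that by (simp add: interval_integral_Icc set_lebesgue_integral_def)
    finally show ?thesis ..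
  qed
  show ?thesis
  proof (cases "a \<le> b")
    case False
    have "itg (\<lambda>t. f (t + c)) a b = - itg (\<lambda>t. f (t + c)) b a" by (rule interval_integral_endpoints_reverse)
    also have "\<dots> = - itg f (b + c) (a + c)" using *[of b a] False by simp
    also have "\<dots> = itg f (a + c) (b + c)" by (rule interval_integral_endpoints_reverse[symmetric])
    finally show ?thesis .
  qed (rule *)
qed

lemma itg_cong: "(\<And>t. min a b < t \<Longrightarrow> t < max a b \<Longrightarrow> f t = g t) \<Longrightarrow> itg f a b = itg g a b"
  by (rule interval_integral_cong) (auto simp: einterval_def min_def max_def split: if_splits)

lemma loc_l2_loc_int_square: "loc_l2 f \<Longrightarrow> loc_int (\<lambda>t. (f t)\<^sup>2)"
  by (auto simp: loc_l2_def loc_int_def)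

text \<open>The product is dominated by the sum of the squares. This makes the supply rate and the
  derivative of a storage function locally integrable.\<close>

lemma loc_l2_mult:
  assumes f: "loc_l2 f" and g: "loc_l2 g"
  shows "loc_int (\<lambda>t. f t * g t)"
  unfolding loc_int_def
proof (intro conjI allI)
  have [measurable]: "f \<in> borel_measurable borel" "g \<in> borel_measurable borel" using f g by (auto simp: loc_l2_def)
  show m: "(\<lambda>t. f t * g t) \<in> borel_measurable borel" by measurable
  fix a b :: real
  show "set_integrable lborel {a..b} (\<lambda>t. f t * g t)"
  proof (rule set_integrable_bound[OF _ set_borel_measurable_Icc[OF m]])
    show "set_integrable lborel {a..b} (\<lambda>t. (f t)\<^sup>2 + (g t)\<^sup>2)" using f g by (simp add: loc_l2_def)
    have "\<bar>x * y\<bar> \<le> x\<^sup>2 + y\<^sup>2" for x y :: real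
    proof -
      have "0 \<le> (\<bar>x\<bar> - \<bar>y\<bar>)\<^sup>2" by simp
      then have "2 * \<bar>x * y\<bar> \<le> x\<^sup>2 + y\<^sup>2" by (simp add: power2_diff abs_mult)
      then show ?thesis by (smt (verit) abs_ge_zero)
    qed
    then show "AE t in lborel. t \<in> {a..b} \<longrightarrow> norm (f t * g t) \<le> norm ((f t)\<^sup>2 + (g t)\<^sup>2)" by simp
  qed
qed

lemma loc_l2_continuous:
  assumes "continuous_on UNIV f"
  shows "loc_l2 f"
  unfolding loc_l2_def
proof (intro conjI allI)
  show "f \<in> borel_measurable borel" by (rule borel_measurable_continuous_onI[OF assms])
  fix a b :: real
  have "continuous_on {a..b} (\<lambda>t. (f t)\<^sup>2)"
    by (intro continuous_on_power continuous_on_subset[OF assms]) simp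
  then show "set_integrable lborel {a..b} (\<lambda>t. (f t)\<^sup>2)" by (rule borel_integrable_atLeastAtMost')
qed

lemma loc_l2_loc_int: "loc_l2 f \<Longrightarrow> loc_int f"
  using loc_l2_mult[of f "\<lambda>_. 1"] loc_l2_continuous[of "\<lambda>_. 1"] by simp

lemma loc_l2_cmult: "loc_l2 f \<Longrightarrow> loc_l2 (\<lambda>t. c * f t)"
  by (auto simp: loc_l2_def power_mult_distrib)

lemma loc_l2_add:
  assumes f: "loc_l2 f" and g: "loc_l2 g"
  shows "loc_l2 (\<lambda>t. f t + g t)"
proof -
  have "loc_int (\<lambda>t. (f t)\<^sup>2 + (g t)\<^sup>2 + 2 * (f t * g t))"
    by (intro loc_int_add loc_int_cmult loc_l2_mult f g loc_l2_loc_int_square)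
  then have "loc_int (\<lambda>t. (f t + g t)\<^sup>2)" by (simp add: power2_sum mult.assoc)
  moreover have "(\<lambda>t. f t + g t) \<in> borel_measurable borel" using f g by (auto simp: loc_l2_def)
  ultimately show ?thesis by (simp add: loc_l2_def loc_int_def)
qed

lemma loc_l2_sum: "(\<And>i. i \<in> S \<Longrightarrow> loc_l2 (f i)) \<Longrightarrow> loc_l2 (\<lambda>t. \<Sum>i\<in>S. f i t)"
  by (induction S rule: infinite_finite_induct) (auto intro: loc_l2_add loc_l2_continuous)

lemma loc_l2_shift:
  assumes f: "loc_l2 f"
  shows "loc_l2 (\<lambda>t. f (t + c))"
  unfolding loc_l2_def
proof (intro conjI allI)
  have [measurable]: "f \<in> borel_measurable borel" using f by (simp add: loc_l2_def)
  show "(\<lambda>t. f (t + c)) \<in> borel_measurable borel" by measurable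
  fix a b :: real
  have "integrable lborel (\<lambda>x. indicator {a + c..b + c} x *\<^sub>R (f x)\<^sup>2)"
    using f by (simp add: loc_l2_def set_integrable_def)
  then have "integrable lborel (\<lambda>x. indicator {a + c..b + c} (c + 1 * x) *\<^sub>R (f (c + 1 * x))\<^sup>2)"
    by (rule lborel_integrable_real_affine) simp
  also have "(\<lambda>x. indicator {a + c..b + c} (c + 1 * x) *\<^sub>R (f (c + 1 * x))\<^sup>2) = (\<lambda>x. indicator {a..b} x *\<^sub>R (f (x + c))\<^sup>2)"
    by (intro ext) (auto simp: indicator_def add.commute)
  finally show "set_integrable lborel {a..b} (\<lambda>t. (f (t + c))\<^sup>2)" by (simp add: set_integrable_def)
qed

lemma loc_l2_splice:
  assumes f: "loc_l2 f" and g: "loc_l2 g"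
  shows "loc_l2 (\<lambda>t. if t < \<tau> then f t else g t)"
  unfolding loc_l2_def
proof (intro conjI allI)
  have [measurable]: "f \<in> borel_measurable borel" "g \<in> borel_measurable borel" using f g by (auto simp: loc_l2_def)
  have m: "(\<lambda>t. if t < \<tau> then f t else g t) \<in> borel_measurable borel" by measurable
  then show "(\<lambda>t. if t < \<tau> then f t else g t) \<in> borel_measurable borel" .
  fix a b :: real
  show "set_integrable lborel {a..b} (\<lambda>t. (if t < \<tau> then f t else g t)\<^sup>2)"
  proof (rule set_integrable_bound[OF _ set_borel_measurable_Icc])
    show "set_integrable lborel {a..b} (\<lambda>t. (f t)\<^sup>2 + (g t)\<^sup>2)" using f g by (simp add: loc_l2_def)
    show "(\<lambda>t. (if t < \<tau> then f t else g t)\<^sup>2) \<in> borel_measurable borel" using m by measurable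
  qed simp
qed

section \<open>Integration by parts for primitives\<close>

lemma integrable_prod_pair:
  fixes F G :: "real \<Rightarrow> real"
  assumes F: "integrable lborel F" and G: "integrable lborel G"
  shows "integrable (lborel \<Otimes>\<^sub>M lborel) (\<lambda>(s,t). F s * G t)"
proof (rule lborel_pair.Fubini_integrable)
  have [measurable]: "F \<in> borel_measurable borel" "G \<in> borel_measurable borel" using F G by auto
  show "(\<lambda>(s,t). F s * G t) \<in> borel_measurable (lborel \<Otimes>\<^sub>M lborel)" by measurable
  have "(\<lambda>x. LBINT y. norm (case (x, y) of (s, t) \<Rightarrow> F s * G t)) = (\<lambda>x. \<bar>F x\<bar> * (LBINT y. \<bar>G y\<bar>))"
    by (simp add: abs_mult)
  then show "integrable lborel (\<lambda>x. LBINT y. norm (case (x, y) of (s, t) \<Rightarrow> F s * G t))" using F by simp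
  show "AE x in lborel. integrable lborel (\<lambda>y. case (x, y) of (s, t) \<Rightarrow> F s * G t)" using G by simp
qed

text \<open>The plane is cut along the diagonal into \<open>s \<le> t\<close> and
  \<open>t < s\<close>, and the integral of \<open>F t * G s\<close> is evaluated on each part with
  its own order of integration.\<close>

lemma fubini_triangle:
  fixes F G :: "real \<Rightarrow> real"
  assumes F: "integrable lborel F" and G: "integrable lborel G"
  shows "(LBINT t. F t * (LBINT s. indicator {..t} s * G s)) + (LBINT s. G s * (LBINT t. indicator {..<s} t * F t))
    = (LBINT t. F t) * (LBINT s. G s)"
proof -
  \<comment> \<open>The integrand on the open triangle \<open>t < s\<close>. The closed triangle is
    treated as its complement within the inner integral, so a single exchange of integrals
    suffices.\<close>
  define K where "K t s = F t * (indicator {t<..} s * G s)" for t s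
  have [measurable]: "F \<in> borel_measurable borel" "G \<in> borel_measurable borel" using F G by auto
  have "integrable (lborel \<Otimes>\<^sub>M lborel) (\<lambda>p. indicator {p \<in> space (lborel \<Otimes>\<^sub>M lborel). fst p < snd p} p *\<^sub>R (case p of (t,s) \<Rightarrow> F t * G s))"
    by (intro integrable_mult_indicator integrable_prod_pair F G) measurable
  also have "(\<lambda>p. indicator {p \<in> space (lborel \<Otimes>\<^sub>M lborel). fst p < snd p} p *\<^sub>R (case p of (t,s) \<Rightarrow> F t * G s)) = case_prod K"
    by (auto simp: K_def indicator_def space_pair_measure split: prod.splits)
  finally have K: "integrable (lborel \<Otimes>\<^sub>M lborel) (case_prod K)" .
  have Gi: "integrable lborel (\<lambda>s. indicator S s * G s)" if "S \<in> sets borel" for S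
    using integrable_mult_indicator[of S lborel G] that G by simp
  have "(LBINT s. G s * (LBINT t. indicator {..<s} t * F t)) = (LBINT s. LBINT t. K t s)"
  proof (intro Bochner_Integration.integral_cong refl)
    fix s
    have "(LBINT t. K t s) = (LBINT t. G s * (indicator {..<s} t * F t))"
      by (intro Bochner_Integration.integral_cong refl) (auto simp: K_def indicator_def)
    then show "G s * (LBINT t. indicator {..<s} t * F t) = (LBINT t. K t s)" by simp
  qed
  also have "\<dots> = (LBINT t. LBINT s. K t s)" by (rule lborel_pair.Fubini_integral[OF K])
  finally have 1: "(LBINT s. G s * (LBINT t. indicator {..<s} t * F t)) = (LBINT t. LBINT s. K t s)" .
  have Kt: "(LBINT s. K t s) = F t * (LBINT s. G s) - F t * (LBINT s. indicator {..t} s * G s)" for t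
  proof -
    have "(LBINT s. K t s) = F t * (LBINT s. indicator {t<..} s * G s)" by (simp add: K_def)
    also have "(LBINT s. indicator {t<..} s * G s) = (LBINT s. G s - indicator {..t} s * G s)"
      by (intro Bochner_Integration.integral_cong refl) (auto simp: indicator_def)
    also have "\<dots> = (LBINT s. G s) - (LBINT s. indicator {..t} s * G s)"
      by (rule Bochner_Integration.integral_diff[OF G Gi]) simp
    finally show ?thesis by (simp add: right_diff_distrib)
  qed
  have iK: "integrable lborel (\<lambda>t. LBINT s. K t s)" using lborel_pair.integrable_fst[OF K] by simp
  have iF: "integrable lborel (\<lambda>t. F t * (LBINT s. G s))" using F by simp
  have "(LBINT t. F t * (LBINT s. indicator {..t} s * G s)) = (LBINT t. F t * (LBINT s. G s) - (LBINT s. K t s))"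
    by (simp add: Kt)
  also have "\<dots> = (LBINT t. F t) * (LBINT s. G s) - (LBINT t. LBINT s. K t s)"
    using Bochner_Integration.integral_diff[OF iF iK] by simp
  finally show ?thesis using 1 by simp
qed

text \<open>The integrated form of \<open>x' = f\<close> with locally integrable \<open>f\<close>,
  which is the sense in which \<open>in_Bs\<close> reads the differential equation; \<open>x\<close>
  is absolutely continuous on bounded intervals but need not be differentiable everywhere.\<close>

definition primitive :: "(real \<Rightarrow> real) \<Rightarrow> (real \<Rightarrow> real) \<Rightarrow> bool" where
  "primitive x f \<longleftrightarrow> loc_int f \<and> (\<forall>a b. x b - x a = itg f a b)"

text \<open>The product rule for absolutely continuous functions, obtained by integrating
  \<open>f t * g s\<close> over the square with sides \<open>[a, b]\<close>. The inner integrals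
  over the two triangles are \<open>y t - y a\<close> and \<open>x s - x a\<close>.\<close>

lemma primitive_product_le:
  assumes x: "primitive x f" and y: "primitive y g" and fy: "loc_int (\<lambda>t. f t * y t)" and xg: "loc_int (\<lambda>t. x t * g t)" and ab: "a \<le> b"
  shows "x b * y b - x a * y a = itg (\<lambda>t. f t * y t + x t * g t) a b"
proof -
  define F where "F t = indicator {a..b} t * f t" for t
  define G where "G t = indicator {a..b} t * g t" for t
  have f: "loc_int f" and g: "loc_int g" and dx: "\<And>a b. x b - x a = itg f a b" and dy: "\<And>a b. y b - y a = itg g a b"
    using x y by (auto simp: primitive_def)
  have F: "integrable lborel F" and G: "integrable lborel G"
    using f g by (auto simp: loc_int_def set_integrable_def F_def[abs_def] G_def[abs_def])
  have iF: "(LBINT t. F t) = x b - x a" and iG: "(LBINT t. G t) = y b - y a"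
    unfolding dx dy using ab by (simp_all add: interval_integral_Icc set_lebesgue_integral_def F_def G_def)
  have yt: "(LBINT s. indicator {..t} s * G s) = y t - y a" if "t \<in> {a..b}" for t
  proof -
    have "(LBINT s. indicator {..t} s * G s) = (LBINT s. indicator {a..t} s * g s)"
      using that by (intro Bochner_Integration.integral_cong refl) (auto simp: indicator_def G_def)
    also have "\<dots> = y t - y a" unfolding dy using that by (simp add: interval_integral_Icc set_lebesgue_integral_def)
    finally show ?thesis .
  qed
  have xs: "(LBINT t. indicator {..<s} t * F t) = x s - x a" if "s \<in> {a..b}" for s
  proof -
    have "(LBINT t. indicator {..<s} t * F t) = (LBINT t. indicator {a..<s} t * f t)"
      using that by (intro Bochner_Integration.integral_cong refl) (auto simp: indicator_def F_def)
    also have "\<dots> = x s - x a" unfolding dx using that by (simp add: interval_integral_Ico set_lebesgue_integral_def)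
    finally show ?thesis .
  qed
  have "(LBINT t. F t * (LBINT s. indicator {..t} s * G s)) = itg (\<lambda>t. f t * y t - y a * f t) a b"
  proof -
    have "(LBINT t. F t * (LBINT s. indicator {..t} s * G s)) = (LBINT t. indicator {a..b} t * (f t * y t - y a * f t))"
    proof (intro Bochner_Integration.integral_cong refl)
      fix t show "F t * (LBINT s. indicator {..t} s * G s) = indicator {a..b} t * (f t * y t - y a * f t)"
        by (cases "t \<in> {a..b}") (simp_all only: yt F_def, simp_all add: algebra_simps)
    qed
    then show ?thesis using ab by (simp add: interval_integral_Icc set_lebesgue_integral_def)
  qed
  also have "\<dots> = itg (\<lambda>t. f t * y t) a b - y a * (x b - x a)"
    by (simp add: itg_diff fy f loc_int_cmult dx)
  finally have 1: "(LBINT t. F t * (LBINT s. indicator {..t} s * G s)) = itg (\<lambda>t. f t * y t) a b - y a * (x b - x a)" .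
  have "(LBINT s. G s * (LBINT t. indicator {..<s} t * F t)) = itg (\<lambda>t. x t * g t - x a * g t) a b"
  proof -
    have "(LBINT s. G s * (LBINT t. indicator {..<s} t * F t)) = (LBINT t. indicator {a..b} t * (x t * g t - x a * g t))"
    proof (intro Bochner_Integration.integral_cong refl)
      fix s show "G s * (LBINT t. indicator {..<s} t * F t) = indicator {a..b} s * (x s * g s - x a * g s)"
        by (cases "s \<in> {a..b}") (simp_all only: xs G_def, simp_all add: algebra_simps)
    qed
    then show ?thesis using ab by (simp add: interval_integral_Icc set_lebesgue_integral_def)
  qed
  also have "\<dots> = itg (\<lambda>t. x t * g t) a b - x a * (y b - y a)"
    by (simp add: itg_diff xg g loc_int_cmult dy)
  finally have 2: "(LBINT s. G s * (LBINT t. indicator {..<s} t * F t)) = itg (\<lambda>t. x t * g t) a b - x a * (y b - y a)" .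
  have "itg (\<lambda>t. f t * y t) a b + itg (\<lambda>t. x t * g t) a b = (x b - x a) * (y b - y a) + y a * (x b - x a) + x a * (y b - y a)"
    using fubini_triangle[OF F G] unfolding 1 2 iF iG by simp
  then show ?thesis unfolding itg_add[OF fy xg] by (simp add: algebra_simps)
qed

lemma primitive_product:
  assumes x: "primitive x f" and y: "primitive y g" and fy: "loc_int (\<lambda>t. f t * y t)" and xg: "loc_int (\<lambda>t. x t * g t)"
  shows "primitive (\<lambda>t. x t * y t) (\<lambda>t. f t * y t + x t * g t)"
  unfolding primitive_def
proof (intro conjI allI)
  show "loc_int (\<lambda>t. f t * y t + x t * g t)" by (intro loc_int_add fy xg)
  fix a b
  show "x b * y b - x a * y a = itg (\<lambda>t. f t * y t + x t * g t) a b"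
  proof (cases "a \<le> b")
    case True
    then show ?thesis by (rule primitive_product_le[OF x y fy xg])
  next
    case False
    then show ?thesis using primitive_product_le[OF x y fy xg, of b a]
        interval_integral_endpoints_reverse[of "ereal a" "ereal b" "\<lambda>t. f t * y t + x t * g t"] by simp
  qed
qed

lemma primitive_sum: "finite S \<Longrightarrow> (\<And>i. i \<in> S \<Longrightarrow> primitive (x i) (f i)) \<Longrightarrow> primitive (\<lambda>t. \<Sum>i\<in>S. x i t) (\<lambda>t. \<Sum>i\<in>S. f i t)"
  unfolding primitive_def by (auto intro: loc_int_sum simp: itg_sum sum_subtractf[symmetric])

lemma primitive_cmult: "primitive x f \<Longrightarrow> primitive (\<lambda>t. c * x t) (\<lambda>t. c * f t)"
  unfolding primitive_def by (auto intro: loc_int_cmult simp: right_diff_distrib[symmetric])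

section \<open>Trajectories\<close>

text \<open>A power series solution: \<open>v j\<close> is the \<open>j\<close>-th derivative at 0,
  so \<open>b\<close> enters only in \<open>v 1\<close>, and the bound \<open>M * K ^ j\<close>
  gives convergence everywhere. For \<open>b = 0\<close> the coefficients are multiples of Krylov
  vectors, so a vector orthogonal to all of these is orthogonal to the solution at every time; this
  clause provides the zero output of unobservable states.\<close>

lemma linear_ode:
  assumes A: "A \<in> carrier_mat d d" and x0: "x0 \<in> carrier_vec d" and b: "b \<in> carrier_vec d"
  shows "\<exists>z. (\<forall>t. z t \<in> carrier_vec d) \<and> z 0 = x0 \<and>
    (\<forall>t. \<forall>i<d. ((\<lambda>t. z t $ i) has_real_derivative (A *\<^sub>v z t + b) $ i) (at t)) \<and>
    (b = 0\<^sub>v d \<longrightarrow> (\<forall>t. \<forall>w\<in>carrier_vec d. (\<forall>j. w \<bullet> ((*\<^sub>v) A ^^ j) x0 = 0) \<longrightarrow> w \<bullet> z t = 0))"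
proof -
  have Ad[simp]: "dim_row A = d" "dim_col A = d" using carrier_matD[OF A] by simp_all
  have bd[simp]: "dim_vec b = d" "dim_vec x0 = d" using carrier_vecD[OF b] carrier_vecD[OF x0] by simp_all
  define v where "v = rec_nat x0 (\<lambda>j w. A *\<^sub>v w + (if j = 0 then b else 0\<^sub>v d))"
  have v0: "v 0 = x0" and vS: "v (Suc j) = A *\<^sub>v v j + (if j = 0 then b else 0\<^sub>v d)" for j
    by (simp_all add: v_def)
  have vc[simp]: "v j \<in> carrier_vec d" for j by (cases j) (simp_all add: v0 vS x0 b)
  have vd[simp]: "dim_vec (v j) = d" for j by (rule carrier_vecD[OF vc])
  \<comment> \<open>Adding 1 ensures \<open>K \<ge> 1\<close>, so that the contribution
    \<open>N b\<close> in the step from \<open>v 0\<close> to \<open>v 1\<close> is absorbed by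
    \<open>K * N b\<close>.\<close>
  define K where "K = (\<Sum>i<d. \<Sum>j<d. \<bar>A $$ (i,j)\<bar>) + 1"
  define N where "N w = (\<Sum>i<d. \<bar>w $ i\<bar>)" for w :: "real vec"
  define M where "M = N x0 + N b"
  have N0: "0 \<le> N w" for w by (simp add: N_def sum_nonneg)
  have K1: "1 \<le> K" by (simp add: K_def sum_nonneg)
  have NA: "N (A *\<^sub>v w) \<le> K * N w" if w: "w \<in> carrier_vec d" for w
  proof -
    have "N (A *\<^sub>v w) = (\<Sum>i<d. \<bar>\<Sum>j<d. A $$ (i,j) * w $ j\<bar>)" using w by (simp add: N_def mv_index del: index_mult_mat_vec)
    also have "\<dots> \<le> (\<Sum>i<d. \<Sum>j<d. \<bar>A $$ (i,j)\<bar> * N w)"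
    proof (intro sum_mono order.trans[OF sum_abs])
      fix i j assume "i \<in> {..<d}" "j \<in> {..<d}"
      then have "\<bar>w $ j\<bar> \<le> N w" unfolding N_def by (intro member_le_sum) auto
      then show "\<bar>A $$ (i,j) * w $ j\<bar> \<le> \<bar>A $$ (i,j)\<bar> * N w" by (simp add: abs_mult mult_left_mono)
    qed
    also have "\<dots> = (K - 1) * N w" by (simp add: K_def sum_distrib_right)
    also have "\<dots> \<le> K * N w" using N0 by (intro mult_right_mono) simp_all
    finally show ?thesis .
  qed
  have Nv: "N (v j) \<le> M * K ^ j" for j
  proof (induction j)
    case (Suc j)
    show ?case
    proof (cases j)
      case 0
      have "N (v (Suc j)) \<le> N (A *\<^sub>v x0) + N b"
        unfolding N_def sum.distrib[symmetric] using x0 b by (intro sum_mono) (simp add: vS 0 v0)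
      also have "\<dots> \<le> K * N x0 + K * N b" using NA[OF x0] K1 N0[of b] mult_right_mono[OF K1 N0, of b] by linarith
      finally show ?thesis using 0 by (simp add: M_def algebra_simps)
    next
      case (Suc i)
      then have "v (Suc j) = A *\<^sub>v v j" by (simp add: vS)
      then have "N (v (Suc j)) \<le> K * N (v j)" using NA[of "v j"] by simp
      also have "\<dots> \<le> K * (M * K ^ j)" using Suc.IH K1 by (intro mult_left_mono) simp_all
      finally show ?thesis by (simp add: ac_simps)
    qed
  qed (simp add: v0 M_def N0)
  define c where "c i j = v j $ i / fact j" for i j
  have cb: "\<bar>c i j\<bar> \<le> M * K ^ j / fact j" if "i < d" for i j
  proof -
    have "\<bar>v j $ i\<bar> \<le> N (v j)" unfolding N_def using that by (intro member_le_sum) auto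
    then show ?thesis using Nv[of j] by (simp add: c_def divide_right_mono)
  qed
  have sm: "summable (\<lambda>j. c i j * t ^ j)" if "i < d" for i t
  proof (rule summable_comparison_test')
    have "summable (\<lambda>j. M * (inverse (fact j) * (K * \<bar>t\<bar>) ^ j))" by (intro summable_mult summable_exp)
    then show "summable (\<lambda>j. M * K ^ j / fact j * \<bar>t\<bar> ^ j)" by (simp add: power_mult_distrib divide_inverse ac_simps)
    fix j assume "j \<ge> (0::nat)"
    show "norm (c i j * t ^ j) \<le> M * K ^ j / fact j * \<bar>t\<bar> ^ j"
      unfolding real_norm_def abs_mult power_abs by (rule mult_right_mono[OF cb[OF that]]) simp
  qed
  define z where "z t = vec d (\<lambda>i. \<Sum>j. c i j * t ^ j)" for t
  have zc[simp]: "z t \<in> carrier_vec d" for t by (simp add: z_def)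
  have zi: "z t $ i = (\<Sum>j. c i j * t ^ j)" if "i < d" for i t using that by (simp add: z_def)
  have z0: "z 0 = x0"
  proof (rule eq_vecI)
    fix i assume "i < dim_vec x0"
    then have i: "i < d" by simp
    have "(\<Sum>j. c i j * 0 ^ j) = c i 0" by (rule powser_zero)
    then show "z 0 $ i = x0 $ i" using i by (simp add: zi c_def v0)
  qed (simp add: z_def)
  have lin: "(\<Sum>l<d. a l * z t $ l) = (\<Sum>j. (\<Sum>l<d. a l * c l j) * t ^ j)" "summable (\<lambda>j. (\<Sum>l<d. a l * c l j) * t ^ j)" for a t
  proof -
    have "(\<lambda>j. \<Sum>l<d. a l * (c l j * t ^ j)) sums (\<Sum>l<d. a l * (\<Sum>j. c l j * t ^ j))"
      by (intro sums_sum sums_mult summable_sums sm) auto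
    then have "(\<lambda>j. (\<Sum>l<d. a l * c l j) * t ^ j) sums (\<Sum>l<d. a l * z t $ l)"
      by (simp add: zi sum_distrib_right mult.assoc)
    then show "(\<Sum>l<d. a l * z t $ l) = (\<Sum>j. (\<Sum>l<d. a l * c l j) * t ^ j)" "summable (\<lambda>j. (\<Sum>l<d. a l * c l j) * t ^ j)"
      by (simp_all add: sums_iff)
  qed
  have der: "((\<lambda>t. z t $ i) has_real_derivative (A *\<^sub>v z t + b) $ i) (at t)" if i: "i < d" for i t
  proof -
    have d1: "((\<lambda>t. \<Sum>j. c i j * t ^ j) has_real_derivative (\<Sum>j. diffs (c i) j * t ^ j)) (at t)"
      by (rule termdiffs_strong_converges_everywhere) (rule sm[OF i])
    have dj: "diffs (c i) j = (\<Sum>l<d. A $$ (i,l) * c l j) + (if j = 0 then b $ i else 0)" for j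
    proof -
      have f: "fact (Suc j) = real (Suc j) * (fact j :: real)" by simp
      have "diffs (c i) j = v (Suc j) $ i / fact j"
        unfolding diffs_def c_def f by (simp add: field_simps del: of_nat_Suc)
      also have "v (Suc j) $ i = (\<Sum>l<d. A $$ (i,l) * v j $ l) + (if j = 0 then b $ i else 0)"
        using i by (simp add: vS mv_index del: index_mult_mat_vec)
      finally have e: "diffs (c i) j = ((\<Sum>l<d. A $$ (i,l) * v j $ l) + (if j = 0 then b $ i else 0)) / fact j" .
      show ?thesis unfolding e by (cases "j = 0") (simp_all add: c_def sum_divide_distrib)
    qed
    have "(\<Sum>j. diffs (c i) j * t ^ j) = (\<Sum>j. (\<Sum>l<d. A $$ (i,l) * c l j) * t ^ j + (if j = 0 then b $ i else 0) * t ^ j)"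
      by (simp add: dj distrib_right)
    also have "\<dots> = (\<Sum>j. (\<Sum>l<d. A $$ (i,l) * c l j) * t ^ j) + (\<Sum>j. (if j = 0 then b $ i else 0) * t ^ j)"
      by (intro suminf_add[symmetric] lin(2) summable_finite[of "{0}"]) auto
    also have "(\<Sum>j. (if j = 0 then b $ i else 0) * t ^ j) = b $ i"
      by (subst suminf_finite[of "{0}"]) auto
    also have "(\<Sum>j. (\<Sum>l<d. A $$ (i,l) * c l j) * t ^ j) = (A *\<^sub>v z t) $ i"
      using i by (simp add: lin(1)[symmetric] mv_index z_def del: index_mult_mat_vec)
    finally have d2: "(\<Sum>j. diffs (c i) j * t ^ j) = (A *\<^sub>v z t + b) $ i" using i by (simp del: index_mult_mat_vec)
    have "(\<lambda>t. z t $ i) = (\<lambda>t. \<Sum>j. c i j * t ^ j)" using i by (simp add: z_def)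
    then show ?thesis using d1 unfolding d2 by simp
  qed
  have out: "w \<bullet> z t = 0" if b0: "b = 0\<^sub>v d" and w: "w \<in> carrier_vec d" and k: "\<forall>j. w \<bullet> ((*\<^sub>v) A ^^ j) x0 = 0" for w t
  proof -
    have vj: "v j = ((*\<^sub>v) A ^^ j) x0" for j
    proof (induction j)
      case (Suc j)
      have "v (Suc j) = A *\<^sub>v v j" using b0 by (simp add: vS)
      then show ?case using Suc by simp
    qed (simp add: v0)
    have "(\<Sum>l<d. w $ l * c l j) = 0" for j
    proof -
      have "(\<Sum>l<d. w $ l * v j $ l) = w \<bullet> v j" by (simp add: sp_sum)
      also have "\<dots> = 0" using k vj by simp
      finally show ?thesis by (simp add: c_def sum_divide_distrib[symmetric])
    qed
    then show ?thesis using lin(1)[of "\<lambda>l. w $ l" t] by (simp add: sp_sum z_def)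
  qed
  show ?thesis using z0 der out by (intro exI[of _ z]) (simp del: index_mult_mat_vec)
qed

lemma loc_l2_mv:
  assumes M: "M \<in> carrier_mat p k" and v: "\<And>t. v t \<in> carrier_vec k" "\<And>j. j < k \<Longrightarrow> loc_l2 (\<lambda>t. v t $ j)" and i: "i < p"
  shows "loc_l2 (\<lambda>t. (M *\<^sub>v v t) $ i)"
proof -
  have "loc_l2 (\<lambda>t. \<Sum>j<k. M $$ (i,j) * v t $ j)" by (intro loc_l2_sum loc_l2_cmult v) simp
  then show ?thesis using carrier_matD[OF M] carrier_vecD[OF v(1)] i by (simp add: mv_index del: index_mult_mat_vec)
qed

lemma loc_int_sp_self:
  assumes "\<And>t. y t \<in> carrier_vec k" "\<And>i. i < k \<Longrightarrow> loc_l2 (\<lambda>t. y t $ i)"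
  shows "loc_int (\<lambda>t. y t \<bullet> y t)"
proof -
  have "loc_int (\<lambda>t. \<Sum>i<k. y t $ i * y t $ i)" by (intro loc_int_sum loc_l2_mult assms) simp_all
  then show ?thesis using carrier_vecD[OF assms(1)] by (simp add: sp_sum)
qed

lemma L2loc_iff: "L2loc k u \<longleftrightarrow> (\<forall>t. u t \<in> carrier_vec k) \<and> (\<forall>i<k. loc_l2 (\<lambda>t. u t $ i))"
  by (simp add: L2loc_def loc_l2_def)

section \<open>Trajectories and payoff of the system\<close>

context lti begin

text \<open>The output is dropped from the behaviour: it is determined by \<open>u\<close> and
  \<open>x\<close> up to a null set, and the payoff is an integral.\<close>

definition traj :: "(real \<Rightarrow> real vec) \<Rightarrow> (real \<Rightarrow> real vec) \<Rightarrow> bool" where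
  "traj u x \<longleftrightarrow> L2loc n u \<and> L2loc d x \<and> (\<forall>i<d. primitive (\<lambda>t. x t $ i) (\<lambda>t. (A *\<^sub>v x t + B *\<^sub>v u t) $ i))"

definition payoff :: "(real \<Rightarrow> real vec) \<Rightarrow> (real \<Rightarrow> real vec) \<Rightarrow> real \<Rightarrow> real \<Rightarrow> real" where
  "payoff u x a b = itg (\<lambda>t. supply_rate (x t) (u t)) a b"

lemma traj_carrier: "traj u x \<Longrightarrow> u t \<in> carrier_vec n" "traj u x \<Longrightarrow> x t \<in> carrier_vec d"
  by (simp_all add: traj_def L2loc_iff)

lemma traj_l2: "traj u x \<Longrightarrow> i < n \<Longrightarrow> loc_l2 (\<lambda>t. u t $ i)" "traj u x \<Longrightarrow> i < d \<Longrightarrow> loc_l2 (\<lambda>t. x t $ i)"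
  by (simp_all add: traj_def L2loc_iff)

lemma L2loc_comb:
  assumes u: "L2loc n u" and x: "L2loc d x" and M: "M \<in> carrier_mat p d" and N: "N \<in> carrier_mat p n"
  shows "L2loc p (\<lambda>t. M *\<^sub>v x t + N *\<^sub>v u t)"
  unfolding L2loc_iff
proof (intro conjI allI impI)
  fix t show "M *\<^sub>v x t + N *\<^sub>v u t \<in> carrier_vec p" using carrier_matD[OF M] carrier_matD[OF N] by simp
next
  fix i assume i: "i < p"
  have "loc_l2 (\<lambda>t. (M *\<^sub>v x t) $ i + (N *\<^sub>v u t) $ i)"
    using u x i by (intro loc_l2_add loc_l2_mv[OF M] loc_l2_mv[OF N]) (simp_all add: L2loc_iff)
  then show "loc_l2 (\<lambda>t. (M *\<^sub>v x t + N *\<^sub>v u t) $ i)" using carrier_matD[OF M] carrier_matD[OF N] i by (simp del: index_mult_mat_vec)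
qed

lemma traj_output: "traj u x \<Longrightarrow> L2loc m (\<lambda>t. C *\<^sub>v x t + D *\<^sub>v u t)"
  by (rule L2loc_comb) (simp_all add: traj_def)

lemma in_Bs_iff: "in_Bs A B C D u y x \<longleftrightarrow> traj u x \<and> L2loc m y \<and> (AE t in lborel. y t = C *\<^sub>v x t + D *\<^sub>v u t)"
proof
  assume H: "in_Bs A B C D u y x"
  then have u: "L2loc n u" and x: "L2loc d x" and y: "L2loc m y" by (simp_all add: in_Bs_def)
  have "primitive (\<lambda>t. x t $ i) (\<lambda>t. (A *\<^sub>v x t + B *\<^sub>v u t) $ i)" if i: "i < d" for i
    unfolding primitive_def
  proof
    show "loc_int (\<lambda>t. (A *\<^sub>v x t + B *\<^sub>v u t) $ i)" using L2loc_comb[OF u x A B] i by (simp add: L2loc_iff loc_l2_loc_int)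
    show "\<forall>a b. x b $ i - x a $ i = itg (\<lambda>t. (A *\<^sub>v x t + B *\<^sub>v u t) $ i) a b" using H i by (simp add: in_Bs_def)
  qed
  then show "traj u x \<and> L2loc m y \<and> (AE t in lborel. y t = C *\<^sub>v x t + D *\<^sub>v u t)" using H u x y by (simp add: traj_def in_Bs_def)
next
  assume "traj u x \<and> L2loc m y \<and> (AE t in lborel. y t = C *\<^sub>v x t + D *\<^sub>v u t)"
  then show "in_Bs A B C D u y x" by (auto simp: traj_def in_Bs_def primitive_def)
qed

lemma loc_int_supply: "traj u x \<Longrightarrow> loc_int (\<lambda>t. supply_rate (x t) (u t))"
  unfolding supply_rate_def
  by (intro loc_int_diff loc_int_sp_self[of _ m] loc_int_sp_self[of _ n]) (use traj_output[of u x] in \<open>auto simp: L2loc_iff traj_def\<close>)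

lemma payoff_eq:
  assumes "in_Bs A B C D u y x"
  shows "(LBINT t=a..b. y t \<bullet> y t - u t \<bullet> u t) = payoff u x a b"
proof -
  have t: "traj u x" and y: "L2loc m y" and ae: "AE t in lborel. y t = C *\<^sub>v x t + D *\<^sub>v u t"
    using assms by (simp_all add: in_Bs_iff)
  have "loc_int (\<lambda>t. y t \<bullet> y t)" "loc_int (\<lambda>t. u t \<bullet> u t)"
    using y t by (intro loc_int_sp_self[of _ m]  loc_int_sp_self[of _ n]; simp add: L2loc_iff traj_def)+
  then have "loc_int (\<lambda>t. y t \<bullet> y t - u t \<bullet> u t)" by (rule loc_int_diff)
  then show ?thesis
    unfolding payoff_def using loc_int_supply[OF t] ae
    by (intro interval_integral_cong_AE) (auto simp: loc_int_def supply_rate_def elim!: eventually_mono)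
qed

text \<open>The end time in \<open>avail_storage\<close> ranges over the extended reals. The value \<open>\<infinity>\<close> adds nothing: the integral over the
  half-line is either a limit of integrals over bounded intervals or, if it does not converge, the junk value 0.\<close>
lemma avail_storage_eq:
  "avail_storage A B C D t0 x0 = Sup {ereal (payoff u x t0 t1) | t1 u x. t0 \<le> t1 \<and> traj u x \<and> x t0 = x0}" (is "_ = Sup ?S")
proof (rule antisym)
  show "avail_storage A B C D t0 x0 \<le> Sup ?S"
    unfolding avail_storage_def
  proof (rule Sup_least, elim CollectE exE conjE)
    fix e :: ereal and t1 :: ereal and u y x
    assume e: "e = ereal (LBINT t=t0..t1. y t \<bullet> y t - u t \<bullet> u t)" and t1: "ereal t0 \<le> t1" and B: "in_Bs A B C D u y x" and x0: "x t0 = x0"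
    have tr: "traj u x" using B by (simp add: in_Bs_iff)
    have fin: "ereal (payoff u x t0 T) \<le> Sup ?S" if "t0 \<le> T" for T
      by (rule Sup_upper) (use that tr x0 in blast)
    show "e \<le> Sup ?S"
    proof (cases t1)
      case (real T)
      then show ?thesis using fin[of T] t1 payoff_eq[OF B] e by simp
    next
      case PInf
      define f where "f t = y t \<bullet> y t - u t \<bullet> u t" for t
      have v: "(LBINT t=t0..t1. f t) = (LBINT t:{t0<..}. f t)"
        unfolding PInf by (simp add: interval_lebesgue_integral_def einterval_def greaterThan_def)
      show ?thesis
      proof (cases "set_integrable lborel {t0<..} f")
        case False
        then have "(LBINT t:{t0<..}. f t) = 0"
          unfolding set_lebesgue_integral_def set_integrable_def by (rule not_integrable_integral_eq)
        \<comment> \<open>The default value 0 of a divergent integral is also the payoff over the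
          interval of length 0.\<close>
        then have "e = ereal (payoff u x t0 t0)" using e v by (simp add: f_def payoff_def)
        then show ?thesis using fin[of t0] by simp
      next
        case True
        define I where "I k = {t0<..t0 + real k}" for k
        have U: "(\<Union>k. I k) = {t0<..}"
        proof (intro equalityI subsetI)
          fix t assume "t \<in> {t0<..}"
          moreover obtain k where "t - t0 \<le> real k" using real_arch_simple by blast
          ultimately show "t \<in> (\<Union>k. I k)" by (auto simp: I_def intro!: exI[of _ k])
        qed (auto simp: I_def)
        have "(\<lambda>k. LBINT t:I k. f t) \<longlonglongrightarrow> (LBINT t:(\<Union>k. I k). f t)"
          by (rule set_integral_cont_up) (use True in \<open>auto simp: U\<close>, auto simp: I_def incseq_def)
        moreover have "(LBINT t:I k. f t) = payoff u x t0 (t0 + real k)" for k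
          using payoff_eq[OF B, of t0 "t0 + real k"] by (simp add: interval_integral_Ioc I_def f_def)
        ultimately have "(\<lambda>k. ereal (payoff u x t0 (t0 + real k))) \<longlonglongrightarrow> e"
          using e v by (simp add: U f_def)
        then show ?thesis by (rule LIMSEQ_le_const2) (use fin in auto)
      qed
    qed (use t1 in simp)
  qed
  show "Sup ?S \<le> avail_storage A B C D t0 x0"
    unfolding avail_storage_def
  proof (rule Sup_subset_mono, rule subsetI, elim CollectE exE conjE)
    fix e t1 u x assume e: "e = ereal (payoff u x t0 t1)" and H: "t0 \<le> t1" "traj u x" "x t0 = x0"
    define y where "y t = C *\<^sub>v x t + D *\<^sub>v u t" for t
    have y: "in_Bs A B C D u y x" using H traj_output[OF H(2)] by (simp add: in_Bs_iff y_def[abs_def])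
    have "e = ereal (LBINT t=t0..t1. y t \<bullet> y t - u t \<bullet> u t)" using e payoff_eq[OF y] by simp
    moreover have "ereal t0 \<le> ereal t1" using H by simp
    ultimately show "e \<in> {ereal (LBINT t=t0..t1. y t \<bullet> y t - u t \<bullet> u t) | t1 u y x. ereal t0 \<le> t1 \<and> in_Bs A B C D u y x \<and> x t0 = x0}"
      using H y by blast
  qed
qed

text \<open>The product rule is applied to each monomial \<open>x t $ i * x t $ j\<close>; symmetry
  of \<open>X\<close> merges the two resulting sums into one with factor 2.\<close>

lemma primitive_quadratic:
  assumes X: "X \<in> carrier_mat d d" "transpose_mat X = X" and t: "traj u x"
  shows "primitive (\<lambda>t. x t \<bullet> (X *\<^sub>v x t)) (\<lambda>t. 2 * (x t \<bullet> (X *\<^sub>v (A *\<^sub>v x t + B *\<^sub>v u t))))"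
proof -
  define f where "f t = A *\<^sub>v x t + B *\<^sub>v u t" for t
  have xc: "x t \<in> carrier_vec d" for t using traj_carrier[OF t] by simp
  have xd[simp]: "dim_vec (x t) = d" for t by (rule carrier_vecD[OF xc])
  have fc: "f t \<in> carrier_vec d" for t by (simp add: f_def)
  have fd[simp]: "dim_vec (f t) = d" for t by (rule carrier_vecD[OF fc])
  have Xd[simp]: "dim_row X = d" "dim_col X = d" using carrier_matD[OF X(1)] by simp_all
  have fl: "loc_l2 (\<lambda>t. f t $ i)" if "i < d" for i
    using L2loc_comb[OF _ _ A B, of u x] t that by (simp add: traj_def L2loc_iff f_def)
  have xa: "primitive (\<lambda>t. x t $ i) (\<lambda>t. f t $ i)" if "i < d" for i using t that by (simp add: traj_def f_def)
  have "primitive (\<lambda>t. \<Sum>i<d. \<Sum>j<d. X $$ (i,j) * (x t $ i * x t $ j)) (\<lambda>t. \<Sum>i<d. \<Sum>j<d. X $$ (i,j) * (f t $ i * x t $ j + x t $ i * f t $ j))"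
    by (intro primitive_sum primitive_cmult primitive_product xa loc_l2_mult fl traj_l2(2)[OF t]) simp_all
  moreover have "(\<Sum>i<d. \<Sum>j<d. X $$ (i,j) * (x t $ i * x t $ j)) = x t \<bullet> (X *\<^sub>v x t)" for t
    by (simp add: sp_sum sum_distrib_left ac_simps)
  moreover have "(\<Sum>i<d. \<Sum>j<d. X $$ (i,j) * (f t $ i * x t $ j + x t $ i * f t $ j)) = 2 * (x t \<bullet> (X *\<^sub>v f t))" for t
  proof -
    have form: "v \<bullet> (X *\<^sub>v w) = (\<Sum>i<d. \<Sum>j<d. X $$ (i,j) * (v $ i * w $ j))" if "dim_vec w = d" for v w
      using that by (simp add: sp_sum sum_distrib_left ac_simps)
    have "(\<Sum>i<d. \<Sum>j<d. X $$ (i,j) * (f t $ i * x t $ j + x t $ i * f t $ j)) = f t \<bullet> (X *\<^sub>v x t) + x t \<bullet> (X *\<^sub>v f t)"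
      unfolding form[OF xd] form[OF fd] sum.distrib[symmetric] distrib_left ..
    then show ?thesis using sym_sp[OF X(1,2) xc fc, of t t] by simp
  qed
  ultimately show ?thesis unfolding f_def by simp
qed

lemma dissipation:
  assumes X: "X \<in> carrier_mat d d" "transpose_mat X = X" "dissipative X" and t: "traj u x" and ab: "a \<le> b"
  shows "payoff u x a b \<le> x a \<bullet> (X *\<^sub>v x a) - x b \<bullet> (X *\<^sub>v x b)"
proof -
  define f where "f t = A *\<^sub>v x t + B *\<^sub>v u t" for t
  have xc: "x t \<in> carrier_vec d" and uc: "u t \<in> carrier_vec n" for t using traj_carrier[OF t] by simp_all
  have q: "primitive (\<lambda>t. x t \<bullet> (X *\<^sub>v x t)) (\<lambda>t. 2 * (x t \<bullet> (X *\<^sub>v f t)))"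
    unfolding f_def by (rule primitive_quadratic[OF X(1,2) t])
  have "payoff u x a b \<le> itg (\<lambda>t. (- 1) * (2 * (x t \<bullet> (X *\<^sub>v f t)))) a b"
    unfolding payoff_def
  proof (rule itg_mono[OF loc_int_supply[OF t] _ _ ab])
    show "loc_int (\<lambda>t. (- 1) * (2 * (x t \<bullet> (X *\<^sub>v f t))))" by (rule loc_int_cmult, rule conjunct1[OF q[unfolded primitive_def]])
    fix t show "supply_rate (x t) (u t) \<le> (- 1) * (2 * (x t \<bullet> (X *\<^sub>v f t)))"
      using X(3)[unfolded dissipative_def, rule_format, OF xc[of t] uc[of t]] by (simp add: f_def)
  qed
  also have "\<dots> = - itg (\<lambda>t. 2 * (x t \<bullet> (X *\<^sub>v f t))) a b"
    by (subst interval_lebesgue_integral_mult_right) simp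
  also have "\<dots> = x a \<bullet> (X *\<^sub>v x a) - x b \<bullet> (X *\<^sub>v x b)" proof -
    have "x b \<bullet> (X *\<^sub>v x b) - x a \<bullet> (X *\<^sub>v x a) = itg (\<lambda>t. 2 * (x t \<bullet> (X *\<^sub>v f t))) a b"
      using q unfolding primitive_def by blast
    then show ?thesis by linarith
  qed
  finally show ?thesis .
qed

lemma primitive_lin: "primitive x f \<Longrightarrow> primitive y g \<Longrightarrow> primitive (\<lambda>t. x t + c * y t) (\<lambda>t. f t + c * g t)"
  unfolding primitive_def
proof (intro conjI allI; elim conjE)
  fix a b assume f: "loc_int f" "\<forall>a b. x b - x a = itg f a b" and g: "loc_int g" "\<forall>a b. y b - y a = itg g a b"
  have "itg (\<lambda>t. f t + c * g t) a b = (x b - x a) + c * (y b - y a)"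
    unfolding itg_add[OF f(1) loc_int_cmult[OF g(1)]] f(2)[rule_format] g(2)[rule_format] by simp
  then show "x b + c * y b - (x a + c * y a) = itg (\<lambda>t. f t + c * g t) a b" by (simp add: algebra_simps)
qed (rule loc_int_add, assumption, rule loc_int_cmult, assumption)

lemma traj_lin:
  assumes t: "traj u x" "traj u' x'"
  shows "traj (\<lambda>t. u t + c \<cdot>\<^sub>v u' t) (\<lambda>t. x t + c \<cdot>\<^sub>v x' t)"
proof -
  note [simp] = carrier_vecD[OF traj_carrier(1)[OF t(1)]] carrier_vecD[OF traj_carrier(1)[OF t(2)]]
    carrier_vecD[OF traj_carrier(2)[OF t(1)]] carrier_vecD[OF traj_carrier(2)[OF t(2)]]
  have "primitive (\<lambda>t. (x t + c \<cdot>\<^sub>v x' t) $ i) (\<lambda>t. (A *\<^sub>v (x t + c \<cdot>\<^sub>v x' t) + B *\<^sub>v (u t + c \<cdot>\<^sub>v u' t)) $ i)" if i: "i < d" for i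
  proof -
    have "primitive (\<lambda>t. x t $ i + c * x' t $ i) (\<lambda>t. (A *\<^sub>v x t + B *\<^sub>v u t) $ i + c * (A *\<^sub>v x' t + B *\<^sub>v u' t) $ i)"
      using t i by (intro primitive_lin) (simp_all only: traj_def)
    then show ?thesis using i by (simp add: mv_simps distrib_left ac_simps del: index_mult_mat_vec)
  qed
  moreover have "L2loc n (\<lambda>t. u t + c \<cdot>\<^sub>v u' t)" "L2loc d (\<lambda>t. x t + c \<cdot>\<^sub>v x' t)"
    using t unfolding traj_def L2loc_iff by (auto intro!: loc_l2_add loc_l2_cmult)
  ultimately show ?thesis unfolding traj_def by blast
qed

lemma traj_shift:
  assumes t: "traj u x"
  shows "traj (\<lambda>t. u (t + c)) (\<lambda>t. x (t + c))"
proof -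
  have "primitive (\<lambda>t. x (t + c) $ i) (\<lambda>t. (A *\<^sub>v x (t + c) + B *\<^sub>v u (t + c)) $ i)" if i: "i < d" for i
    unfolding primitive_def
  proof (intro conjI allI)
    have "loc_l2 (\<lambda>t. (A *\<^sub>v x t + B *\<^sub>v u t) $ i)" using L2loc_comb[OF _ _ A B, of u x] t i by (simp add: traj_def L2loc_iff)
    then have "loc_l2 (\<lambda>t. (A *\<^sub>v x (t + c) + B *\<^sub>v u (t + c)) $ i)" by (rule loc_l2_shift)
    then show "loc_int (\<lambda>t. (A *\<^sub>v x (t + c) + B *\<^sub>v u (t + c)) $ i)" by (rule loc_l2_loc_int)
    fix a b
    show "x (b + c) $ i - x (a + c) $ i = itg (\<lambda>t. (A *\<^sub>v x (t + c) + B *\<^sub>v u (t + c)) $ i) a b"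
      unfolding itg_shift[where f = "\<lambda>t. (A *\<^sub>v x t + B *\<^sub>v u t) $ i"] using t i unfolding traj_def primitive_def by blast
  qed
  moreover have "L2loc n (\<lambda>t. u (t + c))" "L2loc d (\<lambda>t. x (t + c))"
    using t unfolding traj_def L2loc_iff by (auto intro: loc_l2_shift)
  ultimately show ?thesis unfolding traj_def by blast
qed

lemma payoff_shift: "payoff (\<lambda>t. u (t + c)) (\<lambda>t. x (t + c)) a b = payoff u x (a + c) (b + c)"
  unfolding payoff_def by (rule itg_shift[where f = "\<lambda>t. supply_rate (x t) (u t)"])

text \<open>Integrals starting at the joint \<tau> meet only one of the two branches, and additivity
  of the integral yields all other intervals. At \<tau> itself the value is that of
  \<open>y\<close>, which agrees with \<open>x\<close> there.\<close>

lemma primitive_splice: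
  assumes x: "primitive x f" and y: "primitive y g" and xy: "x \<tau> = y \<tau>"
    and li: "loc_int (\<lambda>t. if t < \<tau> then f t else g t)"
  shows "primitive (\<lambda>t. if t < \<tau> then x t else y t) (\<lambda>t. if t < \<tau> then f t else g t)"
proof -
  let ?h = "\<lambda>t. if t < \<tau> then f t else g t" and ?z = "\<lambda>t. if t < \<tau> then x t else y t"
  have base: "?z b - ?z \<tau> = itg ?h \<tau> b" for b
  proof (cases "b < \<tau>")
    case True
    have "itg ?h \<tau> b = itg f \<tau> b" by (rule itg_cong) (use True in auto)
    moreover have "x b - x \<tau> = itg f \<tau> b" using x unfolding primitive_def by blast
    ultimately show ?thesis using True xy by simp
  next
    case False
    have "itg ?h \<tau> b = itg g \<tau> b" by (rule itg_cong) (use False in auto)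
    moreover have "y b - y \<tau> = itg g \<tau> b" using y unfolding primitive_def by blast
    ultimately show ?thesis using False by simp
  qed
  have "?z b - ?z a = itg ?h a b" for a b
    using base[of b] base[of a] itg_combine[OF li, of \<tau> a b] by linarith
  then show ?thesis unfolding primitive_def using li by blast
qed

lemma traj_splice:
  assumes t: "traj u x" "traj u' x'" and xy: "x \<tau> = x' \<tau>"
  shows "traj (\<lambda>t. if t < \<tau> then u t else u' t) (\<lambda>t. if t < \<tau> then x t else x' t)"
proof -
  have L: "L2loc k (\<lambda>t. if t < \<tau> then v t else v' t)" if "L2loc k v" "L2loc k v'" for k v v'
    unfolding L2loc_iff
  proof (intro conjI allI impI)
    fix t show "(if t < \<tau> then v t else v' t) \<in> carrier_vec k" using that by (simp add: L2loc_iff)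
  next
    fix i assume "i < k"
    then have "loc_l2 (\<lambda>t. if t < \<tau> then v t $ i else v' t $ i)" using that by (intro loc_l2_splice) (simp_all add: L2loc_iff)
    then show "loc_l2 (\<lambda>t. (if t < \<tau> then v t else v' t) $ i)" by (simp add: if_distrib[of "\<lambda>w. w $ i"])
  qed
  have "primitive (\<lambda>t. (if t < \<tau> then x t else x' t) $ i)
      (\<lambda>t. (A *\<^sub>v (if t < \<tau> then x t else x' t) + B *\<^sub>v (if t < \<tau> then u t else u' t)) $ i)" if i: "i < d" for i
  proof -
    have f: "loc_l2 (\<lambda>t. (A *\<^sub>v x t + B *\<^sub>v u t) $ i)" "loc_l2 (\<lambda>t. (A *\<^sub>v x' t + B *\<^sub>v u' t) $ i)"
      using L2loc_comb[OF _ _ A B, of u x] L2loc_comb[OF _ _ A B, of u' x'] t i by (simp_all add: traj_def L2loc_iff)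
    have "primitive (\<lambda>t. if t < \<tau> then x t $ i else x' t $ i) (\<lambda>t. if t < \<tau> then (A *\<^sub>v x t + B *\<^sub>v u t) $ i else (A *\<^sub>v x' t + B *\<^sub>v u' t) $ i)"
      using t i xy by (intro primitive_splice loc_l2_loc_int[OF loc_l2_splice[OF f]]) (simp_all only: traj_def)
    moreover have "(\<lambda>t. if t < \<tau> then x t $ i else x' t $ i) = (\<lambda>t. (if t < \<tau> then x t else x' t) $ i)" by auto
    moreover have "(\<lambda>t. if t < \<tau> then (A *\<^sub>v x t + B *\<^sub>v u t) $ i else (A *\<^sub>v x' t + B *\<^sub>v u' t) $ i) =
      (\<lambda>t. (A *\<^sub>v (if t < \<tau> then x t else x' t) + B *\<^sub>v (if t < \<tau> then u t else u' t)) $ i)" by auto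
    ultimately show ?thesis by simp
  qed
  then show ?thesis using t L unfolding traj_def by blast
qed

end

section \<open>The available storage as a quadratic form\<close>

text \<open>\<open>g a = f a - a * f 1\<close> is additive and vanishes at the integers, so it
  depends only on the fractional part of \<open>a\<close> and is bounded. As
  \<open>g (k * a) = k * g a\<close> for all natural \<open>k\<close>, boundedness forces
  \<open>g = 0\<close>.\<close>

lemma additive_bounded_linear:
  fixes f :: "real \<Rightarrow> real"
  assumes add: "\<And>a b. f (a + b) = f a + f b" and bd: "\<And>a. 0 \<le> a \<Longrightarrow> a \<le> 1 \<Longrightarrow> \<bar>f a\<bar> \<le> K"
  shows "f a = a * f 1"
proof -
  define g where "g a = f a - a * f 1" for a
  have gadd: "g (a + b) = g a + g b" for a b by (simp add: g_def add algebra_simps)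
  have g0: "g 0 = 0" using gadd[of 0 0] by simp
  have gn: "g (real k * a) = real k * g a" for k a
    by (induction k) (simp_all add: g0 gadd distrib_right)
  have gneg: "g (- a) = - g a" for a using gadd[of a "- a"] g0 by simp
  have gi: "g (of_int k) = 0" for k
  proof -
    have 1: "g (real j) = 0" for j using gn[of j 1] by (simp add: g_def)
    show ?thesis
    proof (cases "0 \<le> k")
      case True
      then show ?thesis using 1[of "nat k"] by simp
    next
      case False
      then show ?thesis using 1[of "nat (- k)"] gneg[of "of_int k"] by simp
    qed
  qed
  have gb: "\<bar>g a\<bar> \<le> K + \<bar>f 1\<bar>" for a
  proof -
    have "g a = g (frac a)" using gadd[of "of_int \<lfloor>a\<rfloor>" "frac a"] gi by (simp add: frac_def)
    moreover have "\<bar>g (frac a)\<bar> \<le> \<bar>f (frac a)\<bar> + \<bar>frac a * f 1\<bar>" by (simp add: g_def)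
    moreover have "\<bar>f (frac a)\<bar> \<le> K" using frac_lt_1[of a] by (intro bd) simp_all
    moreover have "\<bar>frac a * f 1\<bar> \<le> 1 * \<bar>f 1\<bar>"
      unfolding abs_mult using frac_lt_1[of a] by (intro mult_right_mono) simp_all
    ultimately show ?thesis by linarith
  qed
  have "g a = 0"
  proof (rule ccontr)
    assume ga: "g a \<noteq> 0"
    obtain k where k: "(K + \<bar>f 1\<bar>) / \<bar>g a\<bar> < real k" using reals_Archimedean2 by blast
    then have "K + \<bar>f 1\<bar> < real k * \<bar>g a\<bar>" using ga by (simp add: pos_divide_less_eq)
    also have "\<dots> = \<bar>g (real k * a)\<bar>" by (simp add: gn abs_mult)
    also have "\<dots> \<le> K + \<bar>f 1\<bar>" by (rule gb)
    finally show False by simp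
  qed
  then show ?thesis by (simp add: g_def)
qed

text \<open>The Jordan-von Neumann argument; nonnegativity replaces continuity.\<close>
lemma parallelogram_quadratic_form:
  fixes S :: "real vec \<Rightarrow> real"
  assumes par: "\<And>x y. x \<in> carrier_vec d \<Longrightarrow> y \<in> carrier_vec d \<Longrightarrow> S (x + y) + S (x - y) = 2 * S x + 2 * S y"
    and scale: "\<And>a x. x \<in> carrier_vec d \<Longrightarrow> S (a \<cdot>\<^sub>v x) = a\<^sup>2 * S x"
    and nonneg: "\<And>x. x \<in> carrier_vec d \<Longrightarrow> 0 \<le> S x"
  shows "\<exists>Q. psd d Q \<and> (\<forall>x\<in>carrier_vec d. S x = x \<bullet> (Q *\<^sub>v x))"
proof -
  define b where "b x y = (S (x + y) - S (x - y)) / 4" for x y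
  have neg: "S (x - y) = S (y - x)" if "x \<in> carrier_vec d" "y \<in> carrier_vec d" for x y
  proof -
    have "x - y = (- 1) \<cdot>\<^sub>v (y - x)" using that by (intro eq_vecI) auto
    then show ?thesis using scale[of "y - x" "- 1"] that by simp
  qed
  have bsym: "b x y = b y x" if "x \<in> carrier_vec d" "y \<in> carrier_vec d" for x y
    using neg[OF that] comm_add_vec[OF that] by (simp add: b_def)
  have bself: "b x x = S x" if x: "x \<in> carrier_vec d" for x
  proof -
    have "x + x = 2 \<cdot>\<^sub>v x" "x - x = 0 \<cdot>\<^sub>v x" using x by (auto intro!: eq_vecI)
    then show ?thesis using scale[OF x, of 2] scale[OF x, of 0] by (simp add: b_def)
  qed
  \<comment> \<open>Four instances of the parallelogram law. In the sum of the first two minus the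
    sum of the last two, the values at \<open>x + y - x'\<close> and \<open>x' - (x - y)\<close>
    cancel.\<close>
  have badd: "b (x + x') y = b x y + b x' y"
    if v: "x \<in> carrier_vec d" "x' \<in> carrier_vec d" "y \<in> carrier_vec d" for x x' y
  proof -
    note [simp] = carrier_vecD[OF v(1)] carrier_vecD[OF v(2)] carrier_vecD[OF v(3)]
    have e: "x + y + x' = x + x' + y" "x' + y + x = x + x' + y" "x - y + x' = x + x' - y" "x' - y + x = x + x' - y"
      "x' + y - x = x' - (x - y)" "x' - y - x = x' - (x + y)"
      by (auto intro!: eq_vecI)
    have 1: "S (x + x' + y) + S (x + y - x') = 2 * S (x + y) + 2 * S x'" using par[of "x + y" x'] v by (simp add: e)
    have 2: "S (x + x' + y) + S (x' - (x - y)) = 2 * S (x' + y) + 2 * S x" using par[of "x' + y" x] v by (simp add: e)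
    have 3: "S (x + x' - y) + S (x - y - x') = 2 * S (x - y) + 2 * S x'" using par[of "x - y" x'] v by (simp add: e)
    have 4: "S (x + x' - y) + S (x' - (x + y)) = 2 * S (x' - y) + 2 * S x" using par[of "x' - y" x] v by (simp add: e)
    have 5: "S (x - y - x') = S (x' - (x - y))" "S (x' - (x + y)) = S (x + y - x')" using v by (intro neg; simp)+
    have "(P - M) / 4 = (s1 - s2) / 4 + (s3 - s4) / 4"
      if "P + \<alpha> = 2 * s1 + 2 * s5" "P + \<beta> = 2 * s3 + 2 * s6" "M + \<beta> = 2 * s2 + 2 * s5" "M + \<alpha> = 2 * s4 + 2 * s6"
      for P M \<alpha> \<beta> s1 s2 s3 s4 s5 s6 :: real
    proof -
      have "P - M = (s1 - s2) + (s3 - s4)" using that by linarith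
      then show ?thesis by (simp only: add_divide_distrib)
    qed
    then show ?thesis unfolding b_def using 1 2 3[unfolded 5] 4[unfolded 5] by blast
  qed
  have bscale: "b (a \<cdot>\<^sub>v x) y = a * b x y" if x: "x \<in> carrier_vec d" and y: "y \<in> carrier_vec d" for a x y
  proof -
    have "b (a \<cdot>\<^sub>v x) y = a * b (1 \<cdot>\<^sub>v x) y"
    \<comment> \<open>For scalars in \<open>[0, 1]\<close>, nonnegativity bounds each term of
      \<open>b\<close> by the right side of the parallelogram law.\<close>
    proof (rule additive_bounded_linear[where K = "S x + S y"])
      fix a c
      have "(a + c) \<cdot>\<^sub>v x = a \<cdot>\<^sub>v x + c \<cdot>\<^sub>v x" by (intro eq_vecI) (simp_all add: distrib_right)
      then show "b ((a + c) \<cdot>\<^sub>v x) y = b (a \<cdot>\<^sub>v x) y + b (c \<cdot>\<^sub>v x) y" using badd x y by simp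
    next
      fix a :: real assume a: "0 \<le> a" "a \<le> 1"
      have "S (a \<cdot>\<^sub>v x + y) + S (a \<cdot>\<^sub>v x - y) = 2 * (a\<^sup>2 * S x) + 2 * S y" using par[of "a \<cdot>\<^sub>v x" y] scale[OF x] x y by simp
      moreover have "0 \<le> S (a \<cdot>\<^sub>v x + y)" "0 \<le> S (a \<cdot>\<^sub>v x - y)" using x y by (simp_all add: nonneg)
      moreover have "a\<^sup>2 * S x \<le> 1 * S x" using a nonneg[OF x] by (intro mult_right_mono) (simp_all add: power_le_one)
      ultimately show "\<bar>b (a \<cdot>\<^sub>v x) y\<bar> \<le> S x + S y" using nonneg[OF x] nonneg[OF y] unfolding b_def by (simp add: abs_le_iff)
    qed
    then show ?thesis by simp
  qed
  define Q where "Q = mat d d (\<lambda>(i,j). b (unit_vec d i) (unit_vec d j))"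
  have bsum: "b x y = (\<Sum>i<d. x $ i * b (unit_vec d i) y)" if x: "x \<in> carrier_vec d" and y: "y \<in> carrier_vec d" for x y
  proof -
    have "b (vec d (\<lambda>i. if i < k then x $ i else 0)) y = (\<Sum>i<k. x $ i * b (unit_vec d i) y)" if "k \<le> d" for k
      using that
    proof (induction k)
      case 0
      have "vec d (\<lambda>i. if i < 0 then x $ i else 0) = 0 \<cdot>\<^sub>v x" using x by (intro eq_vecI) auto
      then show ?case using bscale[OF x y, of 0] by simp
    next
      case (Suc k)
      have "vec d (\<lambda>i. if i < Suc k then x $ i else 0) = vec d (\<lambda>i. if i < k then x $ i else 0) + x $ k \<cdot>\<^sub>v unit_vec d k"
        using Suc.prems by (intro eq_vecI) (auto simp: less_Suc_eq)
      then show ?case using Suc y by (simp add: badd bscale)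
    qed
    from this[OF order_refl] show ?thesis
    proof -
      assume "b (vec d (\<lambda>i. if i < d then x $ i else 0)) y = (\<Sum>i<d. x $ i * b (unit_vec d i) y)"
      moreover have "vec d (\<lambda>i. if i < d then x $ i else 0) = x" using x by (intro eq_vecI) auto
      ultimately show ?thesis by simp
    qed
  qed
  have Sx: "S x = x \<bullet> (Q *\<^sub>v x)" if x: "x \<in> carrier_vec d" for x
  proof -
    have "S x = (\<Sum>i<d. x $ i * b (unit_vec d i) x)" using bself[OF x] bsum[OF x x] by simp
    also have "\<dots> = (\<Sum>i<d. x $ i * (\<Sum>j<d. x $ j * b (unit_vec d j) (unit_vec d i)))"
      by (intro sum.cong refl) (simp add: bsym[of "unit_vec d _" x] x bsum[OF x])
    also have "\<dots> = x \<bullet> (Q *\<^sub>v x)" using x by (simp add: sp_sum Q_def mult.commute bsym)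
    finally show ?thesis .
  qed
  have "psd d Q" unfolding psd_def
  proof (intro conjI ballI)
    show "transpose_mat Q = Q" by (intro eq_matI) (simp_all add: Q_def bsym)
    fix z :: "real vec" assume "z \<in> carrier_vec d"
    then show "0 \<le> z \<bullet> (Q *\<^sub>v z)" using nonneg[of z] Sx[of z] by simp
  qed (simp add: Q_def)
  then show ?thesis using Sx by blast
qed

section \<open>Steering and the value function\<close>

context lti begin

text \<open>Constant inputs are enough to test the dissipation inequality at a given state and
  input, and continuity of the state allows evaluation at time 0. The zero input provides free
  motions; for them the last clause rests on the Krylov clause of \<open>linear_ode\<close>.\<close>

lemma constant_input_traj:
  assumes x0: "x0 \<in> carrier_vec d" and u0: "u0 \<in> carrier_vec n"
  shows "\<exists>x. traj (\<lambda>_. u0) x \<and> x 0 = x0 \<and> (\<forall>i<d. continuous_on UNIV (\<lambda>t. x t $ i)) \<and>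
    (u0 = 0\<^sub>v n \<longrightarrow> (\<forall>j. C *\<^sub>v ((*\<^sub>v) A ^^ j) x0 = 0\<^sub>v m) \<longrightarrow> (\<forall>t. C *\<^sub>v x t = 0\<^sub>v m))"
proof -
  have b: "B *\<^sub>v u0 \<in> carrier_vec d" by simp
  from linear_ode[OF A x0 b] obtain z where z: "(\<forall>t. z t \<in> carrier_vec d) \<and> z 0 = x0 \<and>
    (\<forall>t. \<forall>i<d. ((\<lambda>t. z t $ i) has_real_derivative (A *\<^sub>v z t + B *\<^sub>v u0) $ i) (at t)) \<and>
    (B *\<^sub>v u0 = 0\<^sub>v d \<longrightarrow> (\<forall>t. \<forall>w\<in>carrier_vec d. (\<forall>j. w \<bullet> ((*\<^sub>v) A ^^ j) x0 = 0) \<longrightarrow> w \<bullet> z t = 0))" by (elim exE)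
  have zc: "z t \<in> carrier_vec d" for t by (rule spec[OF conjunct1[OF z]])
  have z0: "z 0 = x0" by (rule conjunct1[OF conjunct2[OF z]])
  have der: "((\<lambda>t. z t $ i) has_real_derivative (A *\<^sub>v z t + B *\<^sub>v u0) $ i) (at t)" if "i < d" for t i
    by (rule conjunct1[OF conjunct2[OF conjunct2[OF z]], THEN spec, THEN spec, THEN mp, OF that])
  have out: "w \<bullet> z t = 0" if "B *\<^sub>v u0 = 0\<^sub>v d" "w \<in> carrier_vec d" "\<forall>j. w \<bullet> ((*\<^sub>v) A ^^ j) x0 = 0" for t w
    by (rule conjunct2[OF conjunct2[OF conjunct2[OF z]], THEN mp, OF that(1), THEN spec, THEN bspec, OF that(2), THEN mp, OF that(3)])
  have zd[simp]: "dim_vec (z t) = d" for t by (rule carrier_vecD[OF zc])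
  have cont: "continuous_on UNIV (\<lambda>t. z t $ i)" if "i < d" for i
    by (intro continuous_at_imp_continuous_on ballI DERIV_isCont[OF der[OF that]])
  have contf: "continuous_on UNIV (\<lambda>t. (A *\<^sub>v z t + B *\<^sub>v u0) $ i)" if i: "i < d" for i
  proof -
    have "continuous_on UNIV (\<lambda>t. (\<Sum>j<d. A $$ (i,j) * z t $ j) + (B *\<^sub>v u0) $ i)"
      by (intro continuous_intros cont) simp
    then show ?thesis using i by (simp add: mv_index del: index_mult_mat_vec)
  qed
  have "primitive (\<lambda>t. z t $ i) (\<lambda>t. (A *\<^sub>v z t + B *\<^sub>v u0) $ i)" if i: "i < d" for i
    unfolding primitive_def
  proof (intro conjI allI)
    show "loc_int (\<lambda>t. (A *\<^sub>v z t + B *\<^sub>v u0) $ i)" by (intro loc_l2_loc_int loc_l2_continuous contf i)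
    fix a b
    have "itg (\<lambda>t. (A *\<^sub>v z t + B *\<^sub>v u0) $ i) a b = z b $ i - z a $ i"
    proof (rule interval_integral_FTC_finite)
      show "continuous_on {min a b..max a b} (\<lambda>t. (A *\<^sub>v z t + B *\<^sub>v u0) $ i)"
        by (rule continuous_on_subset[OF contf[OF i]]) simp
      fix t
      show "((\<lambda>t. z t $ i) has_vector_derivative (A *\<^sub>v z t + B *\<^sub>v u0) $ i) (at t within {min a b..max a b})"
        using der[OF i, of t] by (simp only: has_real_derivative_iff_has_vector_derivative has_vector_derivative_at_within)
    qed
    then show "z b $ i - z a $ i = itg (\<lambda>t. (A *\<^sub>v z t + B *\<^sub>v u0) $ i) a b" by simp
  qed
  moreover have "L2loc n (\<lambda>_. u0)"
    unfolding L2loc_iff by (intro conjI allI impI u0 loc_l2_continuous continuous_on_const)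
  moreover have "L2loc d z"
    unfolding L2loc_iff by (intro conjI allI impI zc loc_l2_continuous cont)
  ultimately have tr: "traj (\<lambda>_. u0) z" unfolding traj_def by blast
  have Cz: "C *\<^sub>v z t = 0\<^sub>v m" if u: "u0 = 0\<^sub>v n" and k: "\<forall>j. C *\<^sub>v ((*\<^sub>v) A ^^ j) x0 = 0\<^sub>v m" for t
  proof (rule eq_vecI)
    fix i assume "i < dim_vec (0\<^sub>v m :: real vec)"
    then have i: "i < m" by simp
    have "row C i \<bullet> ((*\<^sub>v) A ^^ j) x0 = 0" for j
    proof -
      have "(C *\<^sub>v ((*\<^sub>v) A ^^ j) x0) $ i = 0" using k i by simp
      then show ?thesis using i by simp
    qed
    then have "row C i \<bullet> z t = 0" using i u by (intro out) (simp_all add: mv_zero)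
    then show "(C *\<^sub>v z t) $ i = 0\<^sub>v m $ i" using i by simp
  qed simp
  show ?thesis
  proof (intro exI[of _ z] conjI allI impI)
    show "traj (\<lambda>_. u0) z" by (rule tr)
    show "z 0 = x0" by (rule z0)
    show "continuous_on UNIV (\<lambda>t. z t $ i)" if "i < d" for i by (rule cont[OF that])
    show "C *\<^sub>v z t = 0\<^sub>v m" if "u0 = 0\<^sub>v n" "\<forall>j. C *\<^sub>v ((*\<^sub>v) A ^^ j) x0 = 0\<^sub>v m" for t by (rule Cz[OF that])
  qed
qed

lemma free_traj:
  assumes x0: "x0 \<in> carrier_vec d"
  obtains x where "traj (\<lambda>_. 0\<^sub>v n) x" "x 0 = x0" "\<And>t. (\<forall>j. C *\<^sub>v ((*\<^sub>v) A ^^ j) x0 = 0\<^sub>v m) \<Longrightarrow> C *\<^sub>v x t = 0\<^sub>v m"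
proof -
  from constant_input_traj[OF x0 zero_carrier_vec[of n]] obtain x where
    x: "traj (\<lambda>_. 0\<^sub>v n) x \<and> x 0 = x0 \<and> (\<forall>i<d. continuous_on UNIV (\<lambda>t. x t $ i)) \<and>
      (0\<^sub>v n = (0\<^sub>v n :: real vec) \<longrightarrow> (\<forall>j. C *\<^sub>v ((*\<^sub>v) A ^^ j) x0 = 0\<^sub>v m) \<longrightarrow> (\<forall>t. C *\<^sub>v x t = 0\<^sub>v m))" by (elim exE)
  show ?thesis
  proof (rule that[of x])
    fix t assume "\<forall>j. C *\<^sub>v ((*\<^sub>v) A ^^ j) x0 = 0\<^sub>v m"
    then show "C *\<^sub>v x t = 0\<^sub>v m"
      using conjunct2[OF conjunct2[OF conjunct2[OF x]], THEN mp, OF refl] by (elim impE) (assumption, erule spec)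
  qed (rule conjunct1[OF x], rule conjunct1[OF conjunct2[OF x]])
qed

text \<open>A trajectory segment reduced to its end points, duration and payoff, with the start
  moved to time 0. Concatenation, scaling and superposition become rules for this relation, and
  \<open>t0\<close> disappears from the argument.\<close>

definition steer :: "real vec \<Rightarrow> real \<Rightarrow> real vec \<Rightarrow> real \<Rightarrow> bool" where
  "steer x0 T x1 c \<longleftrightarrow> 0 \<le> T \<and> (\<exists>u x. traj u x \<and> x 0 = x0 \<and> x T = x1 \<and> payoff u x 0 T = c)"

lemma avail_storage_steer: "avail_storage A B C D t0 x0 = Sup {ereal c | c T x1. steer x0 T x1 c}"
proof -
  have "{ereal (payoff u x t0 t1) | t1 u x. t0 \<le> t1 \<and> traj u x \<and> x t0 = x0} = {ereal c | c T x1. steer x0 T x1 c}"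
  proof (rule Set.set_eqI, rule iffI)
  fix e assume "e \<in> {ereal (payoff u x t0 t1) | t1 u x. t0 \<le> t1 \<and> traj u x \<and> x t0 = x0}"
  then obtain t1 u x where e: "e = ereal (payoff u x t0 t1)" and H: "t0 \<le> t1" "traj u x" "x t0 = x0" by blast
  have "payoff (\<lambda>t. u (t + t0)) (\<lambda>t. x (t + t0)) 0 (t1 - t0) = payoff u x t0 t1" by (simp add: payoff_shift)
  then have "steer x0 (t1 - t0) (x t1) (payoff u x t0 t1)"
    unfolding steer_def using H traj_shift[OF H(2), of t0]
    by (intro conjI exI[of _ "\<lambda>t. u (t + t0)"] exI[of _ "\<lambda>t. x (t + t0)"]) simp_all
  then show "e \<in> {ereal c | c T x1. steer x0 T x1 c}" using e by blast
next
  fix e assume "e \<in> {ereal c | c T x1. steer x0 T x1 c}"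
  then obtain T x1 c u x where e: "e = ereal c" and H: "0 \<le> T" "traj u x" "x 0 = x0" "payoff u x 0 T = c"
    unfolding steer_def by blast
  have "payoff (\<lambda>t. u (t + - t0)) (\<lambda>t. x (t + - t0)) t0 (t0 + T) = c" using H by (simp add: payoff_shift del: add_uminus_conv_diff)
  moreover have "traj (\<lambda>t. u (t + - t0)) (\<lambda>t. x (t + - t0))" by (rule traj_shift[OF H(2)])
  moreover have "t0 \<le> t0 + T" "x (t0 + - t0) = x0" using H by simp_all
  ultimately show "e \<in> {ereal (payoff u x t0 t1) | t1 u x. t0 \<le> t1 \<and> traj u x \<and> x t0 = x0}"
    using e by blast
  qed
  then show ?thesis by (simp only: avail_storage_eq)
qed

lemma steer_carrier: "steer x0 T x1 c \<Longrightarrow> x0 \<in> carrier_vec d" "steer x0 T x1 c \<Longrightarrow> x1 \<in> carrier_vec d"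
  unfolding steer_def using traj_carrier(2) by blast+

text \<open>Zero input earns the integral of \<open>|C x|^2\<close>, which is nonnegative. Every
  segment can thus be prolonged without loss, which brings two segments to a common duration before
  they are superposed.\<close>

lemma steer_free:
  assumes x0: "x0 \<in> carrier_vec d" and T: "0 \<le> T"
  shows "\<exists>x1 c. 0 \<le> c \<and> steer x0 T x1 c"
proof -
  obtain x where x: "traj (\<lambda>_. 0\<^sub>v n) x" "x 0 = x0" by (rule free_traj[OF x0])
  have "itg (\<lambda>_. 0) 0 T \<le> payoff (\<lambda>_. 0\<^sub>v n) x 0 T" unfolding payoff_def
    by (rule itg_mono[OF loc_int_zero loc_int_supply[OF x(1)] _ T])
      (use carrier_vecD[OF traj_carrier(2)[OF x(1)]] in \<open>simp add: supply_rate_def sp_self_nonneg\<close>)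
  then have "0 \<le> payoff (\<lambda>_. 0\<^sub>v n) x 0 T" by simp
  moreover have "steer x0 T (x T) (payoff (\<lambda>_. 0\<^sub>v n) x 0 T)"
    unfolding steer_def using x T by (intro conjI exI[of _ "\<lambda>_. 0\<^sub>v n"] exI[of _ x]) simp_all
  ultimately show ?thesis by blast
qed

lemma steer_refl:
  assumes "x0 \<in> carrier_vec d"
  shows "steer x0 0 x0 0"
proof -
  obtain x where "traj (\<lambda>_. 0\<^sub>v n) x" "x 0 = x0" by (rule free_traj[OF assms])
  then show ?thesis
    unfolding steer_def by (intro conjI exI[of _ "\<lambda>_. 0\<^sub>v n"] exI[of _ x]) (simp_all add: payoff_def)
qed

lemma steer_trans:
  assumes 1: "steer x0 T x1 c" and 2: "steer x1 T' x2 c'"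
  shows "steer x0 (T + T') x2 (c + c')"
proof -
  obtain u x where a: "0 \<le> T" "traj u x" "x 0 = x0" "x T = x1" "payoff u x 0 T = c" using 1 unfolding steer_def by blast
  obtain v y where b: "0 \<le> T'" "traj v y" "y 0 = x1" "y T' = x2" "payoff v y 0 T' = c'" using 2 unfolding steer_def by blast
  define v' y' where "v' t = v (t + - T)" and "y' t = y (t + - T)" for t
  have t': "traj v' y'" unfolding v'_def[abs_def] y'_def[abs_def] by (rule traj_shift[OF b(2)])
  have p': "payoff v' y' T (T + T') = c'"
    unfolding v'_def[abs_def] y'_def[abs_def] payoff_shift using b by simp
  define w z where "w t = (if t < T then u t else v' t)" and "z t = (if t < T then x t else y' t)" for t
  have tz: "traj w z" unfolding w_def[abs_def] z_def[abs_def]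
    by (rule traj_splice[OF a(2) t']) (simp add: y'_def a b)
  have "payoff w z 0 T = payoff u x 0 T" unfolding payoff_def by (rule itg_cong) (use a in \<open>simp add: w_def z_def\<close>)
  moreover have "payoff w z T (T + T') = payoff v' y' T (T + T')" unfolding payoff_def
    by (rule itg_cong) (use b in \<open>simp add: w_def z_def\<close>)
  moreover have "payoff w z 0 T + payoff w z T (T + T') = payoff w z 0 (T + T')"
    unfolding payoff_def by (rule itg_combine[OF loc_int_supply[OF tz]])
  ultimately have "payoff w z 0 (T + T') = c + c'" using a p' by simp
  \<comment> \<open>For \<open>T = 0\<close> time 0 already belongs to the second branch, whose
    initial state is \<open>x1 = x0\<close>.\<close>
  moreover have "z 0 = x0" using a b by (cases "T = 0") (auto simp: z_def y'_def)
  moreover have "z (T + T') = x2" using a b by (simp add: z_def y'_def)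
  ultimately show ?thesis unfolding steer_def using tz a b by (intro conjI exI[of _ w] exI[of _ z]) simp_all
qed

lemma steer_scale:
  assumes "steer x0 T x1 c"
  shows "steer (a \<cdot>\<^sub>v x0) T (a \<cdot>\<^sub>v x1) (a\<^sup>2 * c)"
proof -
  obtain u x where h: "0 \<le> T" "traj u x" "x 0 = x0" "x T = x1" "payoff u x 0 T = c" using assms unfolding steer_def by blast
  note d1 = carrier_vecD[OF traj_carrier(1)[OF h(2)]] and d2 = carrier_vecD[OF traj_carrier(2)[OF h(2)]]
  have "v + (a - 1) \<cdot>\<^sub>v v = a \<cdot>\<^sub>v v" for v :: "real vec" by (intro eq_vecI) (simp_all add: algebra_simps)
  then have t: "traj (\<lambda>t. a \<cdot>\<^sub>v u t) (\<lambda>t. a \<cdot>\<^sub>v x t)" using traj_lin[OF h(2) h(2), of "a - 1"] by simp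
  have "supply_rate (a \<cdot>\<^sub>v x t) (a \<cdot>\<^sub>v u t) = a\<^sup>2 * supply_rate (x t) (u t)" for t
  proof -
    have "C *\<^sub>v (a \<cdot>\<^sub>v x t) + D *\<^sub>v (a \<cdot>\<^sub>v u t) = a \<cdot>\<^sub>v (C *\<^sub>v x t + D *\<^sub>v u t)"
      using d1 d2 by (simp add: mv_smult smult_vec_add)
    then show ?thesis by (simp add: supply_rate_def power2_eq_square algebra_simps)
  qed
  then have "payoff (\<lambda>t. a \<cdot>\<^sub>v u t) (\<lambda>t. a \<cdot>\<^sub>v x t) 0 T = a\<^sup>2 * c" using h(5) by (simp add: payoff_def)
  then show ?thesis unfolding steer_def using h t by (intro conjI exI[of _ "\<lambda>t. a \<cdot>\<^sub>v u t"] exI[of _ "\<lambda>t. a \<cdot>\<^sub>v x t"]) simp_all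
qed

text \<open>The system is linear and \<open>supply_rate\<close> is a quadratic form in (state,
  input), so the sum and the difference of two trajectories satisfy the law at every instant, and
  hence after integration.\<close>

lemma steer_parallelogram:
  assumes 1: "steer x0 T x1 c" and 2: "steer y0 T y1 c'"
  shows "\<exists>p q z1 z2. steer (x0 + y0) T z1 p \<and> steer (x0 - y0) T z2 q \<and> p + q = 2 * c + 2 * c'"
proof -
  obtain u x where h: "0 \<le> T" "traj u x" "x 0 = x0" "x T = x1" "payoff u x 0 T = c" using 1 unfolding steer_def by blast
  obtain v y where k: "0 \<le> T" "traj v y" "y 0 = y0" "y T = y1" "payoff v y 0 T = c'" using 2 unfolding steer_def by blast
  note dh[simp] = carrier_vecD[OF traj_carrier(1)[OF h(2)]] carrier_vecD[OF traj_carrier(2)[OF h(2)]]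
  note dk[simp] = carrier_vecD[OF traj_carrier(1)[OF k(2)]] carrier_vecD[OF traj_carrier(2)[OF k(2)]]
  have mn: "a + (- 1) \<cdot>\<^sub>v b = a - b" if "dim_vec a = dim_vec b" for a b :: "real vec"
    using that by (intro eq_vecI) simp_all
  have t1: "traj (\<lambda>t. u t + v t) (\<lambda>t. x t + y t)" using traj_lin[OF h(2) k(2), of 1] by simp
  have t2: "traj (\<lambda>t. u t - v t) (\<lambda>t. x t - y t)" using traj_lin[OF h(2) k(2), of "- 1"] by (simp add: mn)
  have sq: "(a + b) \<bullet> (a + b) + (a - b) \<bullet> (a - b) = 2 * (a \<bullet> a) + 2 * (b \<bullet> b)"
    if "dim_vec a = dim_vec b" for a b :: "real vec"
    using that sp_comm[of a b] by (simp add: sp_add_left sp_add_right sp_minus_left sp_minus_right)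
  have lin: "p - a + (q - b) = 2 * (p' - a') + 2 * (q' - b')"
    if "p + q = 2 * p' + 2 * q'" "a + b = 2 * a' + 2 * b'" for p q a b p' q' a' b' :: real
    using that by (simp add: algebra_simps)
  have s: "supply_rate (x t + y t) (u t + v t) + supply_rate (x t - y t) (u t - v t) = 2 * supply_rate (x t) (u t) + 2 * supply_rate (y t) (v t)" for t
  proof -
    have "C *\<^sub>v (x t + y t) + D *\<^sub>v (u t + v t) = (C *\<^sub>v x t + D *\<^sub>v u t) + (C *\<^sub>v y t + D *\<^sub>v v t)"
      "C *\<^sub>v (x t - y t) + D *\<^sub>v (u t - v t) = (C *\<^sub>v x t + D *\<^sub>v u t) - (C *\<^sub>v y t + D *\<^sub>v v t)"
      by (intro eq_vecI; simp add: mv_add mv_minus del: index_mult_mat_vec)+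
    note e = this
    have "dim_vec (C *\<^sub>v x t + D *\<^sub>v u t) = dim_vec (C *\<^sub>v y t + D *\<^sub>v v t)" "dim_vec (u t) = dim_vec (v t)" by simp_all
    from sq[OF this(1)] sq[OF this(2)] show ?thesis unfolding supply_rate_def e by (rule lin)
  qed
  have "payoff (\<lambda>t. u t + v t) (\<lambda>t. x t + y t) 0 T + payoff (\<lambda>t. u t - v t) (\<lambda>t. x t - y t) 0 T = 2 * c + 2 * c'"
  proof -
    have "payoff (\<lambda>t. u t + v t) (\<lambda>t. x t + y t) 0 T + payoff (\<lambda>t. u t - v t) (\<lambda>t. x t - y t) 0 T =
      itg (\<lambda>t. supply_rate (x t + y t) (u t + v t) + supply_rate (x t - y t) (u t - v t)) 0 T"
      unfolding payoff_def by (rule itg_add[OF loc_int_supply[OF t1] loc_int_supply[OF t2], symmetric])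
    also have "\<dots> = itg (\<lambda>t. 2 * supply_rate (x t) (u t) + 2 * supply_rate (y t) (v t)) 0 T" by (simp only: s)
    also have "\<dots> = itg (\<lambda>t. 2 * supply_rate (x t) (u t)) 0 T + itg (\<lambda>t. 2 * supply_rate (y t) (v t)) 0 T"
      by (rule itg_add[OF loc_int_cmult[OF loc_int_supply[OF h(2)]] loc_int_cmult[OF loc_int_supply[OF k(2)]]])
    also have "\<dots> = 2 * c + 2 * c'" using h(5) k(5) by (simp add: payoff_def)
    finally show ?thesis .
  qed
  moreover have "steer (x0 + y0) T (x1 + y1) (payoff (\<lambda>t. u t + v t) (\<lambda>t. x t + y t) 0 T)"
    unfolding steer_def using h k t1 by (intro conjI exI[of _ "\<lambda>t. u t + v t"] exI[of _ "\<lambda>t. x t + y t"]) simp_all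
  moreover have "steer (x0 - y0) T (x1 - y1) (payoff (\<lambda>t. u t - v t) (\<lambda>t. x t - y t) 0 T)"
    unfolding steer_def using h k t2 by (intro conjI exI[of _ "\<lambda>t. u t - v t"] exI[of _ "\<lambda>t. x t - y t"]) simp_all
  ultimately show ?thesis by blast
qed

text \<open>The integrated dissipation inequality, with the nonnegative terminal storage
  dropped.\<close>

lemma avail_storage_le:
  assumes X: "psd d X" "dissipative X" and x0: "x0 \<in> carrier_vec d"
  shows "avail_storage A B C D t0 x0 \<le> ereal (x0 \<bullet> (X *\<^sub>v x0))"
  unfolding avail_storage_steer
proof (rule Sup_least)
  fix e assume "e \<in> {ereal c | c T x1. steer x0 T x1 c}"
  then obtain T u x where e: "e = ereal (payoff u x 0 T)" and T: "0 \<le> T" and t: "traj u x" "x 0 = x0"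
    unfolding steer_def by blast
  have "payoff u x 0 T \<le> x 0 \<bullet> (X *\<^sub>v x 0) - x T \<bullet> (X *\<^sub>v x T)"
    using X T t by (intro dissipation) (simp_all add: psd_def)
  moreover have "0 \<le> x T \<bullet> (X *\<^sub>v x T)" using X traj_carrier(2)[OF t(1)] by (simp add: psd_def)
  ultimately show "e \<le> ereal (x0 \<bullet> (X *\<^sub>v x0))" using e t by simp
qed

text \<open>Under a constant input the integrand \<phi> of payoff plus change of storage is
  continuous. If it were positive at time 0, it would exceed \<open>\<phi> 0 / 2\<close> on a short
  interval, against the integrated inequality there.\<close>

lemma dissipative_if_steer:
  assumes Q: "Q \<in> carrier_mat d d" "transpose_mat Q = Q"
    and H: "\<And>x0 T x1 c. steer x0 T x1 c \<Longrightarrow> c + x1 \<bullet> (Q *\<^sub>v x1) \<le> x0 \<bullet> (Q *\<^sub>v x0)"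
  shows "dissipative Q"
  unfolding dissipative_def
proof (intro ballI, rule ccontr)
  fix x0 u0 :: "real vec" assume x0: "x0 \<in> carrier_vec d" and u0: "u0 \<in> carrier_vec n"
  assume neg: "\<not> supply_rate x0 u0 + 2 * (x0 \<bullet> (Q *\<^sub>v (A *\<^sub>v x0 + B *\<^sub>v u0))) \<le> 0"
  have Qd[simp]: "dim_row Q = d" "dim_col Q = d" using carrier_matD[OF Q(1)] by simp_all
  from constant_input_traj[OF x0 u0] obtain x where x: "traj (\<lambda>_. u0) x \<and> x 0 = x0 \<and> (\<forall>i<d. continuous_on UNIV (\<lambda>t. x t $ i)) \<and>
    (u0 = 0\<^sub>v n \<longrightarrow> (\<forall>j. C *\<^sub>v ((*\<^sub>v) A ^^ j) x0 = 0\<^sub>v m) \<longrightarrow> (\<forall>t. C *\<^sub>v x t = 0\<^sub>v m))" by (elim exE)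
  have t: "traj (\<lambda>_. u0) x" by (rule conjunct1[OF x])
  have xx: "x 0 = x0" by (rule conjunct1[OF conjunct2[OF x]])
  have cont: "continuous_on UNIV (\<lambda>t. x t $ i)" if "i < d" for i
    by (rule conjunct1[OF conjunct2[OF conjunct2[OF x]], THEN spec, THEN mp, OF that])
  have xc: "x t \<in> carrier_vec d" for t by (rule traj_carrier(2)[OF t])
  have xd[simp]: "dim_vec (x t) = d" "dim_vec u0 = n" for t using carrier_vecD[OF xc] carrier_vecD[OF u0] by simp_all
  define \<phi> where "\<phi> t = supply_rate (x t) u0 + 2 * (x t \<bullet> (Q *\<^sub>v (A *\<^sub>v x t + B *\<^sub>v u0)))" for t
  have mvc: "continuous_on UNIV (\<lambda>t. (M *\<^sub>v v t) $ i)"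
    if "dim_row M = p" "dim_col M = k" "i < p" "\<And>t. dim_vec (v t) = k" "\<And>j. j < k \<Longrightarrow> continuous_on UNIV (\<lambda>t. v t $ j)"
    for M :: "real mat" and v :: "real \<Rightarrow> real vec" and i p k
  proof -
    have "continuous_on UNIV (\<lambda>t. \<Sum>j<k. M $$ (i,j) * v t $ j)" by (intro continuous_intros that(5)) simp
    then show ?thesis using that(1-4) by (simp add: mv_index del: index_mult_mat_vec)
  qed
  have spc: "continuous_on UNIV (\<lambda>t. v t \<bullet> w t)"
    if "\<And>t. dim_vec (w t) = k" "\<And>j. j < k \<Longrightarrow> continuous_on UNIV (\<lambda>t. v t $ j)" "\<And>j. j < k \<Longrightarrow> continuous_on UNIV (\<lambda>t. w t $ j)"
    for v w :: "real \<Rightarrow> real vec" and k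
    unfolding sp_sum that(1) by (intro continuous_intros that(2,3)) simp_all
  have addc: "continuous_on UNIV (\<lambda>t. (M *\<^sub>v x t + N *\<^sub>v u0) $ i)"
    if "dim_row M = p" "dim_col M = d" "dim_row N = p" "i < p" for M N :: "real mat" and i p
  proof -
    have "continuous_on UNIV (\<lambda>t. (M *\<^sub>v x t) $ i + (N *\<^sub>v u0) $ i)"
      by (intro continuous_intros mvc[OF that(1,2,4)] cont) simp_all
    then show ?thesis using that by (simp del: index_mult_mat_vec)
  qed
  have c1: "continuous_on UNIV (\<lambda>t. (C *\<^sub>v x t + D *\<^sub>v u0) \<bullet> (C *\<^sub>v x t + D *\<^sub>v u0))"
    by (rule spc[of _ m]) (simp_all add: addc del: index_mult_mat_vec index_add_vec)
  have c2: "continuous_on UNIV (\<lambda>t. x t \<bullet> (Q *\<^sub>v (A *\<^sub>v x t + B *\<^sub>v u0)))"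
    by (rule spc[of _ d]) (simp_all add: cont mvc[of _ d d] addc[of _ d] del: index_mult_mat_vec index_add_vec)
  have cphi: "continuous_on UNIV \<phi>" unfolding \<phi>_def[abs_def] supply_rate_def by (intro continuous_intros c1 c2)
  have pos: "0 < \<phi> 0" using neg by (simp add: \<phi>_def xx)
  have "\<forall>\<^sub>F t in at 0. \<phi> 0 / 2 < \<phi> t"
    using cphi pos by (intro order_tendstoD(1)[of _ "\<phi> 0"]) (auto simp: continuous_on_def)
  then obtain \<delta> where \<delta>: "0 < \<delta>" "\<And>t. t \<noteq> 0 \<Longrightarrow> \<bar>t\<bar> < \<delta> \<Longrightarrow> \<phi> 0 / 2 < \<phi> t"
    unfolding eventually_at by (auto simp: dist_real_def)
  define h where "h = \<delta> / 2"
  have h: "0 < h" "h < \<delta>" using \<delta>(1) by (simp_all add: h_def)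
  have q: "primitive (\<lambda>t. x t \<bullet> (Q *\<^sub>v x t)) (\<lambda>t. 2 * (x t \<bullet> (Q *\<^sub>v (A *\<^sub>v x t + B *\<^sub>v u0))))"
    by (rule primitive_quadratic[OF Q t])
  have li: "loc_int (\<lambda>t. 2 * (x t \<bullet> (Q *\<^sub>v (A *\<^sub>v x t + B *\<^sub>v u0))))" using q unfolding primitive_def by blast
  have "payoff (\<lambda>_. u0) x 0 h + (x h \<bullet> (Q *\<^sub>v x h) - x 0 \<bullet> (Q *\<^sub>v x 0)) = itg \<phi> 0 h"
  proof -
    have "x h \<bullet> (Q *\<^sub>v x h) - x 0 \<bullet> (Q *\<^sub>v x 0) = itg (\<lambda>t. 2 * (x t \<bullet> (Q *\<^sub>v (A *\<^sub>v x t + B *\<^sub>v u0)))) 0 h"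
      using q unfolding primitive_def by blast
    then show ?thesis unfolding payoff_def \<phi>_def[abs_def] itg_add[OF loc_int_supply[OF t] li] by simp
  qed
  moreover have "steer x0 h (x h) (payoff (\<lambda>_. u0) x 0 h)"
    unfolding steer_def using t xx h by (intro conjI exI[of _ "\<lambda>_. u0"] exI[of _ x]) simp_all
  from H[OF this] have "payoff (\<lambda>_. u0) x 0 h + x h \<bullet> (Q *\<^sub>v x h) \<le> x 0 \<bullet> (Q *\<^sub>v x 0)" unfolding xx .
  ultimately have "itg \<phi> 0 h \<le> 0" by linarith
  moreover have "itg (\<lambda>_. \<phi> 0 / 2) 0 h \<le> itg \<phi> 0 h"
  proof -
    have ps: "set_integrable lborel {0..h} (\<lambda>_. \<phi> 0 / 2)" "set_integrable lborel {0..h} \<phi>"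
      by (intro borel_integrable_atLeastAtMost' continuous_intros continuous_on_subset[OF cphi]; simp)+
    have "\<phi> 0 / 2 \<le> \<phi> t" if "t \<in> {0..h}" for t
      using \<delta>(2)[of t] that h pos by (cases "t = 0") auto
    then have "(LBINT t:{0..h}. \<phi> 0 / 2) \<le> (LBINT t:{0..h}. \<phi> t)" by (rule set_integral_mono[OF ps])
    then show ?thesis unfolding interval_integral_Icc[OF less_imp_le[OF h(1)]] .
  qed
  moreover have "itg (\<lambda>_. \<phi> 0 / 2) 0 h = \<phi> 0 / 2 * h" by simp
  moreover have "0 < \<phi> 0 / 2 * h" using pos h by simp
  ultimately show False by linarith
qed

text \<open>The supremum may fail to be attained, so the laws for \<open>S\<close> are derived from
  nearly optimal segments. Superposing such segments from \<open>x\<close> and \<open>y\<close>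
  gives one half of the parallelogram law; the same half for \<open>x + y\<close> and
  \<open>x - y\<close>, with homogeneity, gives the other.\<close>

lemma available_storage_matrix:
  assumes fin: "\<And>x0. x0 \<in> carrier_vec d \<Longrightarrow> avail_storage A B C D t0 x0 < \<infinity>"
  obtains Q where "psd d Q" "dissipative Q"
    "\<And>x0. x0 \<in> carrier_vec d \<Longrightarrow> avail_storage A B C D t0 x0 = ereal (x0 \<bullet> (Q *\<^sub>v x0))"
    "\<And>z. z \<in> carrier_vec d \<Longrightarrow> \<forall>j. C *\<^sub>v ((*\<^sub>v) A ^^ j) z = 0\<^sub>v m \<Longrightarrow> Q *\<^sub>v z = 0\<^sub>v d"
proof -
  define S where "S x0 = real_of_ereal (avail_storage A B C D t0 x0)" for x0
  have up: "ereal c \<le> avail_storage A B C D t0 x0" if "steer x0 T x1 c" for x0 T x1 c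
    unfolding avail_storage_steer by (rule Sup_upper) (use that in blast)
  have eS: "ereal (S x0) = avail_storage A B C D t0 x0" if x0: "x0 \<in> carrier_vec d" for x0
    using fin[OF x0] up[OF steer_refl[OF x0]] unfolding S_def by (cases "avail_storage A B C D t0 x0") auto
  have S_up: "c \<le> S x0" if "steer x0 T x1 c" for x0 T x1 c
    using up[OF that] eS[OF steer_carrier(1)[OF that]] by (metis ereal_less_eq(3))
  have S_app: "\<exists>T x1 c. steer x0 T x1 c \<and> S x0 - \<epsilon> < c" if x0: "x0 \<in> carrier_vec d" and \<epsilon>: "0 < \<epsilon>" for x0 \<epsilon>
  proof -
    have "ereal (S x0 - \<epsilon>) < ereal (S x0)" using \<epsilon> by simp
    then have "ereal (S x0 - \<epsilon>) < Sup {ereal c | c T x1. steer x0 T x1 c}"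
      unfolding eS[OF x0] avail_storage_steer .
    then obtain e where "e \<in> {ereal c | c T x1. steer x0 T x1 c}" and e: "ereal (S x0 - \<epsilon>) < e" unfolding less_Sup_iff by blast
    then obtain c T x1 where "e = ereal c" "steer x0 T x1 c" by blast
    moreover from this e have "S x0 - \<epsilon> < c" by simp
    ultimately show ?thesis by blast
  qed
  have S_nonneg: "0 \<le> S x0" if "x0 \<in> carrier_vec d" for x0 using S_up[OF steer_refl[OF that]] .
  have S_le: "S x0 \<le> K" if x0: "x0 \<in> carrier_vec d" and K: "\<And>T x1 c. steer x0 T x1 c \<Longrightarrow> c \<le> K" for x0 K
  proof (rule field_le_epsilon)
    fix e :: real assume "0 < e"
    then obtain T x1 c where "steer x0 T x1 c" "S x0 - e < c" using S_app[OF x0] by blast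
    then show "S x0 \<le> K + e" using K by fastforce
  qed
  \<comment> \<open>Scaled segments give one inequality; used for \<open>a x\<close> with the factor
    \<open>1 / a\<close> it gives the converse.\<close>
  have sc1: "a\<^sup>2 * S x \<le> S (a \<cdot>\<^sub>v x)" if x: "x \<in> carrier_vec d" for a x
  proof (cases "a = 0")
    case True
    then show ?thesis using S_nonneg[of "a \<cdot>\<^sub>v x"] x by simp
  next
    case False
    have "S x \<le> S (a \<cdot>\<^sub>v x) / a\<^sup>2"
    proof (rule S_le[OF x])
      fix T x1 c assume "steer x T x1 c"
      then have "a\<^sup>2 * c \<le> S (a \<cdot>\<^sub>v x)" by (rule S_up[OF steer_scale])
      then show "c \<le> S (a \<cdot>\<^sub>v x) / a\<^sup>2" using False by (simp add: field_simps)
    qed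
    then show ?thesis using False by (simp add: field_simps)
  qed
  have S0: "S (0\<^sub>v d) = 0"
  proof -
    \<comment> \<open>As twice the zero vector is zero, this reads \<open>4 * S 0 \<le> S 0\<close>,
      and \<open>S 0\<close> is nonnegative.\<close>
    have "2\<^sup>2 * S (0\<^sub>v d) \<le> S (2 \<cdot>\<^sub>v 0\<^sub>v d)" by (rule sc1) simp
    then show ?thesis using S_nonneg[of "0\<^sub>v d"] by simp
  qed
  have scale: "S (a \<cdot>\<^sub>v x) = a\<^sup>2 * S x" if x: "x \<in> carrier_vec d" for a x
  proof (cases "a = 0")
    case True
    moreover have "0 \<cdot>\<^sub>v x = 0\<^sub>v d" using x by (intro eq_vecI) auto
    ultimately show ?thesis using S0 by simp
  next
    case False
    have "(1 / a) \<cdot>\<^sub>v (a \<cdot>\<^sub>v x) = x" using False by (intro eq_vecI) simp_all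
    then have "(1 / a)\<^sup>2 * S (a \<cdot>\<^sub>v x) \<le> S x" using sc1[of "a \<cdot>\<^sub>v x" "1 / a"] x by simp
    then have "S (a \<cdot>\<^sub>v x) \<le> a\<^sup>2 * S x" using False by (simp add: field_simps)
    then show ?thesis using sc1[OF x, of a] by simp
  qed
  have half1: "c' \<le> (p + q) / 2 - c" if "2 * c + 2 * c' \<le> p + q" for c c' p q :: real using that by (simp add: field_simps)
  have half2: "c \<le> (p + q) / 2 - s" if "s \<le> (p + q) / 2 - c" for c s p q :: real using that by (simp add: field_simps)
  have half3: "2 * s + 2 * s' \<le> p + q" if "s \<le> (p + q) / 2 - s'" for s s' p q :: real using that by (simp add: field_simps)
  have par1: "2 * S x + 2 * S y \<le> S (x + y) + S (x - y)" if x: "x \<in> carrier_vec d" and y: "y \<in> carrier_vec d" for x y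
  proof -
    have two: "2 * c + 2 * c' \<le> S (x + y) + S (x - y)" if 1: "steer x T x1 c" and 2: "steer y T' y1 c'" for T x1 c T' y1 c'
    proof -
      have ext: "\<exists>z1 c2. c \<le> c2 \<and> steer x0 M z1 c2" if s: "steer x0 T x1 c" and TM: "T \<le> M" for x0 T x1 c M
      proof -
        have "0 \<le> M - T" using TM by simp
        from steer_free[OF steer_carrier(2)[OF s] this] obtain z1 c1 where c1: "0 \<le> c1" and s1: "steer x1 (M - T) z1 c1" by blast
        have "steer x0 M z1 (c + c1)" using steer_trans[OF s s1] by simp
        moreover have "c \<le> c + c1" using c1 by simp
        ultimately show ?thesis by blast
      qed
      obtain z1 c1 where 3: "c \<le> c1" "steer x (max T T') z1 c1" using ext[OF 1, of "max T T'"] by auto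
      obtain z2 c2 where 4: "c' \<le> c2" "steer y (max T T') z2 c2" using ext[OF 2, of "max T T'"] by auto
      obtain p q w1 w2 where "steer (x + y) (max T T') w1 p" "steer (x - y) (max T T') w2 q" and pq: "p + q = 2 * c1 + 2 * c2"
        using steer_parallelogram[OF 3(2) 4(2)] by blast
      then have "p \<le> S (x + y)" "q \<le> S (x - y)" using S_up by blast+
      then show ?thesis using pq 3(1) 4(1) by linarith
    qed
    have "S x \<le> (S (x + y) + S (x - y)) / 2 - S y"
    proof (rule S_le[OF x])
      fix T x1 c assume 1: "steer x T x1 c"
      have "S y \<le> (S (x + y) + S (x - y)) / 2 - c"
      proof (rule S_le[OF y])
        fix T' y1 c' assume "steer y T' y1 c'"
        from two[OF 1 this] show "c' \<le> (S (x + y) + S (x - y)) / 2 - c" by (rule half1)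
      qed
      then show "c \<le> (S (x + y) + S (x - y)) / 2 - S y" by (rule half2)
    qed
    then show ?thesis by (rule half3)
  qed
  have par: "S (x + y) + S (x - y) = 2 * S x + 2 * S y" if x: "x \<in> carrier_vec d" and y: "y \<in> carrier_vec d" for x y
  proof -
    have e: "(x + y) + (x - y) = 2 \<cdot>\<^sub>v x" "(x + y) - (x - y) = 2 \<cdot>\<^sub>v y" using x y by (auto intro!: eq_vecI)
    have "2 * S (x + y) + 2 * S (x - y) \<le> S (2 \<cdot>\<^sub>v x) + S (2 \<cdot>\<^sub>v y)"
      using par1[of "x + y" "x - y"] x y unfolding e by simp
    then show ?thesis using par1[OF x y] scale[OF x, of 2] scale[OF y, of 2] by simp
  qed
  obtain Q where Q: "psd d Q" "\<And>x. x \<in> carrier_vec d \<Longrightarrow> S x = x \<bullet> (Q *\<^sub>v x)"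
    using parallelogram_quadratic_form[OF par scale S_nonneg] by blast
  \<comment> \<open>Dynamic programming: every continuation from \<open>x1\<close> can be appended
    to the given segment, so the supremum over continuations is at most
    \<open>S x0 - c\<close>.\<close>
  have diss: "c + S x1 \<le> S x0" if s: "steer x0 T x1 c" for x0 T x1 c
  proof -
    have "S x1 \<le> S x0 - c"
    proof (rule S_le[OF steer_carrier(2)[OF s]])
      fix T' x2 c' assume "steer x1 T' x2 c'"
      from S_up[OF steer_trans[OF s this]] show "c' \<le> S x0 - c" by simp
    qed
    then show ?thesis by simp
  qed
  have "dissipative Q"
  proof (rule dissipative_if_steer)
    fix x0 T x1 c assume s: "steer x0 T x1 c"
    show "c + x1 \<bullet> (Q *\<^sub>v x1) \<le> x0 \<bullet> (Q *\<^sub>v x0)"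
      using diss[OF s] Q(2)[OF steer_carrier(1)[OF s]] Q(2)[OF steer_carrier(2)[OF s]] by simp
  qed (use Q(1) in \<open>simp_all add: psd_def\<close>)
  moreover have "avail_storage A B C D t0 x0 = ereal (x0 \<bullet> (Q *\<^sub>v x0))" if "x0 \<in> carrier_vec d" for x0
    using eS[OF that] Q(2)[OF that] by simp
  \<comment> \<open>Subtracting the free motion of an unobservable state changes neither the input
    nor the output. Every payoff from \<open>z\<close> is thus a payoff from 0, where
    \<open>S\<close> is 0.\<close>
  moreover have "Q *\<^sub>v z = 0\<^sub>v d" if z: "z \<in> carrier_vec d" and k: "\<forall>j. C *\<^sub>v ((*\<^sub>v) A ^^ j) z = 0\<^sub>v m" for z
  proof -
    obtain \<zeta> where \<zeta>: "traj (\<lambda>_. 0\<^sub>v n) \<zeta>" "\<zeta> 0 = z" and \<zeta>C: "\<And>t. (\<forall>j. C *\<^sub>v ((*\<^sub>v) A ^^ j) z = 0\<^sub>v m) \<Longrightarrow> C *\<^sub>v \<zeta> t = 0\<^sub>v m"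
      by (rule free_traj[OF z]) (rule that, assumption, assumption, blast)
    note [simp] = carrier_vecD[OF traj_carrier(2)[OF \<zeta>(1)]]
    have "S z \<le> 0"
    proof (rule S_le[OF z])
      fix T x1 c assume "steer z T x1 c"
      then obtain u x where h: "0 \<le> T" "traj u x" "x 0 = z" "payoff u x 0 T = c" unfolding steer_def by blast
      note [simp] = carrier_vecD[OF traj_carrier(1)[OF h(2)]] carrier_vecD[OF traj_carrier(2)[OF h(2)]]
      have t: "traj (\<lambda>t. u t + (- 1) \<cdot>\<^sub>v 0\<^sub>v n) (\<lambda>t. x t + (- 1) \<cdot>\<^sub>v \<zeta> t)" by (rule traj_lin[OF h(2) \<zeta>(1)])
      have "supply_rate (x t + (- 1) \<cdot>\<^sub>v \<zeta> t) (u t + (- 1) \<cdot>\<^sub>v 0\<^sub>v n) = supply_rate (x t) (u t)" for t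
      proof -
        have "u t + (- 1) \<cdot>\<^sub>v 0\<^sub>v n = u t" by (intro eq_vecI) simp_all
        moreover have "C *\<^sub>v (x t + (- 1) \<cdot>\<^sub>v \<zeta> t) = C *\<^sub>v x t" using \<zeta>C[OF k] by (simp add: mv_add mv_smult)
        ultimately show ?thesis by (simp only: supply_rate_def)
      qed
      then have "payoff (\<lambda>t. u t + (- 1) \<cdot>\<^sub>v 0\<^sub>v n) (\<lambda>t. x t + (- 1) \<cdot>\<^sub>v \<zeta> t) 0 T = c" using h(4) by (simp only: payoff_def)
      moreover have "x 0 + (- 1) \<cdot>\<^sub>v \<zeta> 0 = 0\<^sub>v d" unfolding h(3) \<zeta>(2) using z by (intro eq_vecI) auto
      ultimately have "steer (0\<^sub>v d) T (x T + (- 1) \<cdot>\<^sub>v \<zeta> T) c"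
        unfolding steer_def using h(1) t
        by (intro conjI exI[of _ "\<lambda>t. u t + (- 1) \<cdot>\<^sub>v 0\<^sub>v n"] exI[of _ "\<lambda>t. x t + (- 1) \<cdot>\<^sub>v \<zeta> t"]) simp_all
      from S_up[OF this] show "c \<le> 0" by (simp add: S0)
    qed
    then have "z \<bullet> (Q *\<^sub>v z) = 0" using S_nonneg[OF z] Q(2)[OF z] by simp
    then show ?thesis by (rule psd_ker[OF Q(1) z])
  qed
  ultimately show thesis by (rule that[OF Q(1)])
qed

end

section \<open>Equivalence of finite storage and spectral factorization\<close>

text \<open>This takes the place of the Cayley-Hamilton theorem. The \<open>d + 1\<close> Krylov
  vectors of index at most \<open>d\<close> are dependent; a relation solved for its highest index
  \<open>j\<close> is carried to all later indices by applying \<open>A\<close>.\<close>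

lemma krylov_relation:
  fixes A :: "'a::field mat"
  assumes A: "A \<in> carrier_mat d d" and z: "z \<in> carrier_vec d"
  shows "\<exists>j\<le>d. \<exists>c. \<forall>s. \<forall>i<d. ((*\<^sub>v) A ^^ (j + s)) z $ i = (\<Sum>l<j. c l * ((*\<^sub>v) A ^^ (l + s)) z $ i)"
proof -
  define K where "K k = ((*\<^sub>v) A ^^ k) z" for k
  have Ad[simp]: "dim_row A = d" "dim_col A = d" using carrier_matD[OF A] by simp_all
  have Kd[simp]: "dim_vec (K k) = d" for k using carrier_vecD[OF z] by (cases k) (simp_all add: K_def)
  have KS: "K (Suc k) = A *\<^sub>v K k" for k by (simp add: K_def)
  \<comment> \<open>The Krylov vectors as columns, padded with a zero row to a square matrix, whose
    determinant is 0.\<close>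
  define M where "M = mat (Suc d) (Suc d) (\<lambda>(i,j). if i < d then K j $ i else 0)"
  have Mc: "M \<in> carrier_mat (Suc d) (Suc d)" by (simp add: M_def)
  have "transpose_mat M *\<^sub>v unit_vec (Suc d) d = 0\<^sub>v (Suc d)"
    by (intro eq_vecI) (simp_all add: M_def)
  moreover have "unit_vec (Suc d) d \<noteq> (0\<^sub>v (Suc d) :: 'a vec)" by simp
  ultimately have "Determinant.det (transpose_mat M) = 0"
    using det_0_iff_vec_prod_zero[of "transpose_mat M" "Suc d"] Mc unit_vec_carrier[of "Suc d" d] by fastforce
  then have "Determinant.det M = 0" using det_transpose[OF Mc] by simp
  then obtain v where v: "v \<in> carrier_vec (Suc d)" "v \<noteq> 0\<^sub>v (Suc d)" "M *\<^sub>v v = 0\<^sub>v (Suc d)"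
    using det_0_iff_vec_prod_zero[OF Mc] by blast
  have vd[simp]: "dim_vec v = Suc d" by (rule carrier_vecD[OF v(1)])
  have rel: "(\<Sum>l<Suc d. K l $ i * v $ l) = 0" if i: "i < d" for i
  proof -
    have "(M *\<^sub>v v) $ i = (\<Sum>l<Suc d. M $$ (i,l) * v $ l)" using i by (subst mv_index) (simp_all add: M_def)
    also have "\<dots> = (\<Sum>l<Suc d. K l $ i * v $ l)" using i by (intro sum.cong) (simp_all add: M_def)
    finally show ?thesis using i v(3) by simp
  qed
  define j where "j = Max {l. l \<le> d \<and> v $ l \<noteq> 0}"
  have ne: "{l. l \<le> d \<and> v $ l \<noteq> 0} \<noteq> {}"
  proof
    assume e: "{l. l \<le> d \<and> v $ l \<noteq> 0} = {}"
    have "v = 0\<^sub>v (Suc d)"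
    proof (rule eq_vecI)
      fix i assume "i < dim_vec (0\<^sub>v (Suc d) :: 'a vec)"
      then show "v $ i = 0\<^sub>v (Suc d) $ i" using e by simp
    qed simp
    with v(2) show False by blast
  qed
  have fin: "finite {l. l \<le> d \<and> v $ l \<noteq> 0}" by simp
  have j: "j \<le> d" "v $ j \<noteq> 0" using Max_in[OF fin ne] unfolding j_def by simp_all
  have jmax: "v $ l = 0" if "l \<le> d" "j < l" for l
  proof (rule ccontr)
    assume "v $ l \<noteq> 0"
    then have "l \<le> j" unfolding j_def using that(1) by (intro Max_ge[OF fin]) simp
    with that(2) show False by simp
  qed
  define c where "c l = - v $ l / v $ j" for l
  have base: "K j $ i = (\<Sum>l<j. c l * K l $ i)" if i: "i < d" for i
  proof -
    have "(\<Sum>l<Suc d. K l $ i * v $ l) = (\<Sum>l<Suc j. K l $ i * v $ l)"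
      using j(1) by (intro sum.mono_neutral_right) (simp_all add: jmax)
    then have "K j $ i * v $ j = - (\<Sum>l<j. K l $ i * v $ l)" using rel[OF i] by (simp add: eq_neg_iff_add_eq_0 add.commute)
    then have "K j $ i = (- (\<Sum>l<j. K l $ i * v $ l)) / v $ j" using j(2) by (simp only: nonzero_eq_divide_eq[OF j(2)])
    then show ?thesis by (simp add: c_def sum_divide_distrib sum_negf mult.commute)
  qed
  have "K (j + s) $ i = (\<Sum>l<j. c l * K (l + s) $ i)" if "i < d" for s i
    using that
  proof (induction s arbitrary: i)
    case 0
    then show ?case using base by simp
  next
    case (Suc s)
    have "K (j + Suc s) $ i = (\<Sum>k<d. A $$ (i,k) * K (j + s) $ k)"
      using Suc.prems by (simp add: KS mv_index del: index_mult_mat_vec)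
    also have "\<dots> = (\<Sum>k<d. A $$ (i,k) * (\<Sum>l<j. c l * K (l + s) $ k))" by (intro sum.cong refl) (simp add: Suc.IH)
    also have "\<dots> = (\<Sum>l<j. c l * (\<Sum>k<d. A $$ (i,k) * K (l + s) $ k))"
      unfolding sum_distrib_left by (subst sum.swap) (simp add: mult.left_commute)
    also have "\<dots> = (\<Sum>l<j. c l * K (l + Suc s) $ i)"
      using Suc.prems by (simp add: KS mv_index del: index_mult_mat_vec)
    finally show ?case .
  qed
  then show ?thesis unfolding K_def using j(1) by blast
qed

lemma pow_mat_mv:
  fixes A :: "'a::comm_ring_1 mat"
  assumes A: "A \<in> carrier_mat d d" and z: "z \<in> carrier_vec d"
  shows "(A ^\<^sub>m k) *\<^sub>v z = ((*\<^sub>v) A ^^ k) z"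
  using z
proof (induction k arbitrary: z)
  case 0
  then show ?case using A by simp
next
  case (Suc k)
  have "(A ^\<^sub>m Suc k) *\<^sub>v z = (A ^\<^sub>m k) *\<^sub>v (A *\<^sub>v z)" using A Suc.prems by (simp add: mv_mult)
  also have "\<dots> = ((*\<^sub>v) A ^^ k) (A *\<^sub>v z)" using A by (intro Suc.IH) simp
  finally show ?case by (simp add: funpow_swap1)
qed

lemma zero_mv: "x \<in> carrier_vec k \<Longrightarrow> 0\<^sub>m r k *\<^sub>v x = 0\<^sub>v r"
  for x :: "'a::comm_ring_1 vec"
  by (intro eq_vecI) (simp_all add: sp_sum)

context lti begin

text \<open>Row \<open>k * m + i\<close> of the observability matrix is row \<open>i\<close> of
  \<open>C A^k\<close> for \<open>k < d\<close>. Higher powers reduce to lower ones by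
  \<open>krylov_relation\<close>, in a strong induction on the power.\<close>

lemma obs_mat_kernel:
  assumes z: "z \<in> carrier_vec d"
  shows "obs_mat C A *\<^sub>v z = 0\<^sub>v (m * d) \<longleftrightarrow> (\<forall>k. C *\<^sub>v ((*\<^sub>v) A ^^ k) z = 0\<^sub>v m)"
proof -
  define K where "K k = ((*\<^sub>v) A ^^ k) z" for k
  have Kd[simp]: "dim_vec (K k) = d" for k using carrier_vecD[OF z] by (cases k) (simp_all add: K_def)
  have zd[simp]: "dim_vec z = d" by (rule carrier_vecD[OF z])
  have pd[simp]: "dim_row (A ^\<^sub>m k) = d" "dim_col (A ^\<^sub>m k) = d" for k by (cases k; simp)+
  have od[simp]: "dim_row (obs_mat C A) = m * d" "dim_col (obs_mat C A) = d" by (simp_all add: obs_mat_def)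
  have ent: "(obs_mat C A *\<^sub>v z) $ i = (C *\<^sub>v K (i div m)) $ (i mod m)" if i: "i < m * d" for i
  proof -
    have m: "0 < m" using i by (cases m) simp_all
    have "(obs_mat C A *\<^sub>v z) $ i = (\<Sum>j<d. (C * A ^\<^sub>m (i div m)) $$ (i mod m, j) * z $ j)"
      using i by (subst mv_index) (simp_all add: obs_mat_def)
    also have "\<dots> = ((C * A ^\<^sub>m (i div m)) *\<^sub>v z) $ (i mod m)" using m by (subst mv_index) simp_all
    also have "(C * A ^\<^sub>m (i div m)) *\<^sub>v z = C *\<^sub>v K (i div m)" by (simp add: mv_mult pow_mat_mv[OF A z] K_def)
    finally show ?thesis .
  qed
  show ?thesis
  proof
    assume 0: "obs_mat C A *\<^sub>v z = 0\<^sub>v (m * d)"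
    have low: "(C *\<^sub>v K k) $ i = 0" if k: "k < d" and i: "i < m" for k i
    proof -
      have "k * m + i < Suc k * m" using i by simp
      also have "\<dots> \<le> d * m" using k by (intro mult_right_mono) simp_all
      finally have l: "k * m + i < m * d" by (simp add: mult.commute)
      have "(k * m + i) div m = k" "(k * m + i) mod m = i" using i by simp_all
      then show ?thesis using ent[OF l] l 0 by simp
    qed
    from krylov_relation[OF A z] obtain j c where j: "j \<le> d"
      and c: "\<And>s i. i < d \<Longrightarrow> K (j + s) $ i = (\<Sum>l<j. c l * K (l + s) $ i)" unfolding K_def by blast
    have all: "\<forall>i<m. (C *\<^sub>v K k) $ i = 0" for k
    proof (induction k rule: less_induct)
      case (less k)
      show ?case
      proof (cases "k < d")
        case True
        then show ?thesis using low by simp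
      next
        case False
        define s where "s = k - j"
        have k: "k = j + s" using False j by (simp add: s_def)
        show ?thesis
        proof (intro allI impI)
          fix i assume i: "i < m"
          have "(C *\<^sub>v K k) $ i = (\<Sum>q<d. C $$ (i,q) * (\<Sum>l<j. c l * K (l + s) $ q))"
            using i by (subst mv_index) (simp_all add: k c)
          also have "\<dots> = (\<Sum>l<j. c l * (\<Sum>q<d. C $$ (i,q) * K (l + s) $ q))"
            unfolding sum_distrib_left by (subst sum.swap) (simp add: mult.left_commute)
          also have "\<dots> = (\<Sum>l<j. c l * (C *\<^sub>v K (l + s)) $ i)"
            using i by (simp add: mv_index del: index_mult_mat_vec)
          also have "\<dots> = 0" using less.IH i by (intro sum.neutral ballI) (simp add: k del: index_mult_mat_vec)
          finally show "(C *\<^sub>v K k) $ i = 0" .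
        qed
      qed
    qed
    show "\<forall>k. C *\<^sub>v ((*\<^sub>v) A ^^ k) z = 0\<^sub>v m"
      unfolding K_def[symmetric] using all by (intro allI eq_vecI) (simp_all del: index_mult_mat_vec)
  next
    assume "\<forall>k. C *\<^sub>v ((*\<^sub>v) A ^^ k) z = 0\<^sub>v m"
    then have 0: "C *\<^sub>v K k = 0\<^sub>v m" for k by (simp add: K_def)
    show "obs_mat C A *\<^sub>v z = 0\<^sub>v (m * d)"
    proof (rule eq_vecI)
      fix i assume "i < dim_vec (0\<^sub>v (m * d) :: real vec)"
      then have i: "i < m * d" by simp
      then have "0 < m" by (cases m) simp_all
      then show "(obs_mat C A *\<^sub>v z) $ i = 0\<^sub>v (m * d) $ i" using ent[OF i] i 0 by simp
    qed simp
  qed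
qed

text \<open>The columns of the factor are split as \<open>F = (L W)\<close>. The blocks of
  \<open>M = F^T F\<close> are then the three equations, and independence of the rows of
  \<open>F\<close> becomes the last conjunct.\<close>

lemma lmi_factorization:
  assumes Q: "psd d Q" and diss: "dissipative Q"
  shows "\<exists>r L W. L \<in> carrier_mat r d \<and> W \<in> carrier_mat r n \<and>
    - transpose_mat A * Q - Q * A - transpose_mat C * C = transpose_mat L * L \<and>
    - transpose_mat D * C - transpose_mat B * Q = transpose_mat W * L \<and>
    1\<^sub>m n - transpose_mat D * D = transpose_mat W * W \<and>
    (\<forall>v\<in>carrier_vec r. transpose_mat L *\<^sub>v v = 0\<^sub>v d \<longrightarrow> transpose_mat W *\<^sub>v v = 0\<^sub>v n \<longrightarrow> v = 0\<^sub>v r)"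
proof -
  have Qc: "Q \<in> carrier_mat d d" "transpose_mat Q = Q" using Q by (simp_all add: psd_def)
  have Qd[simp]: "dim_row Q = d" "dim_col Q = d" using carrier_matD[OF Qc(1)] by simp_all
  define P N R where "P = - transpose_mat A * Q - Q * A - transpose_mat C * C"
    and "N = - transpose_mat D * C - transpose_mat B * Q" and "R = 1\<^sub>m n - transpose_mat D * D"
  have Pd[simp]: "dim_row P = d" "dim_col P = d" and Nd[simp]: "dim_row N = n" "dim_col N = d"
    and Rd[simp]: "dim_row R = n" "dim_col R = n" by (simp_all add: P_def N_def R_def)
  have PNR: "P \<in> carrier_mat d d" "N \<in> carrier_mat n d" "R \<in> carrier_mat n n" by (rule carrier_matI; simp)+
  define M where "M = four_block_mat P (transpose_mat N) N R"
  have Md[simp]: "dim_row M = d + n" "dim_col M = d + n" by (simp_all add: M_def)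
  have form: "x \<bullet> (P *\<^sub>v x) + 2 * (u \<bullet> (N *\<^sub>v x)) + u \<bullet> (R *\<^sub>v u) \<ge> 0"
    if x: "x \<in> carrier_vec d" and u: "u \<in> carrier_vec n" for x u
  proof -
    note [simp] = carrier_vecD[OF x] carrier_vecD[OF u]
    have "x \<bullet> (P *\<^sub>v x) = - ((A *\<^sub>v x) \<bullet> (Q *\<^sub>v x)) - x \<bullet> (Q *\<^sub>v (A *\<^sub>v x)) - (C *\<^sub>v x) \<bullet> (C *\<^sub>v x)"
      by (simp add: P_def mv_simps mv_transpose')
    moreover have "u \<bullet> (N *\<^sub>v x) = - ((D *\<^sub>v u) \<bullet> (C *\<^sub>v x)) - (B *\<^sub>v u) \<bullet> (Q *\<^sub>v x)"
      by (simp add: N_def mv_simps mv_transpose')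
    moreover have "u \<bullet> (R *\<^sub>v u) = u \<bullet> u - (D *\<^sub>v u) \<bullet> (D *\<^sub>v u)"
      by (simp add: R_def mv_simps mv_transpose' one_mult_mat_vec[OF u])
    moreover have "(A *\<^sub>v x) \<bullet> (Q *\<^sub>v x) = x \<bullet> (Q *\<^sub>v (A *\<^sub>v x))" "(B *\<^sub>v u) \<bullet> (Q *\<^sub>v x) = x \<bullet> (Q *\<^sub>v (B *\<^sub>v u))"
      by (rule sym_sp[OF Qc]; simp add: x)+
    moreover have "(D *\<^sub>v u) \<bullet> (C *\<^sub>v x) = (C *\<^sub>v x) \<bullet> (D *\<^sub>v u)" by (rule sp_comm) simp
    moreover have "supply_rate x u + 2 * (x \<bullet> (Q *\<^sub>v (A *\<^sub>v x + B *\<^sub>v u))) \<le> 0"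
      using diss x u by (simp add: dissipative_def)
    moreover have "supply_rate x u = (C *\<^sub>v x) \<bullet> (C *\<^sub>v x) + 2 * ((C *\<^sub>v x) \<bullet> (D *\<^sub>v u)) + (D *\<^sub>v u) \<bullet> (D *\<^sub>v u) - u \<bullet> u"
      using sp_comm[of "D *\<^sub>v u" "C *\<^sub>v x"] by (simp add: supply_rate_def mv_simps)
    moreover have "x \<bullet> (Q *\<^sub>v (A *\<^sub>v x + B *\<^sub>v u)) = x \<bullet> (Q *\<^sub>v (A *\<^sub>v x)) + x \<bullet> (Q *\<^sub>v (B *\<^sub>v u))"
      by (simp add: mv_simps)
    ultimately show ?thesis by linarith
  qed
  have "psd (d + n) M"
    unfolding psd_def
  proof (intro conjI ballI)
    show "M \<in> carrier_mat (d + n) (d + n)" by (rule carrier_matI) simp_all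
    have "transpose_mat P = P"
    proof (rule mat_eq_mv[of _ d d])
      fix x :: "real vec" assume x: "x \<in> carrier_vec d"
      note [simp] = carrier_vecD[OF x]
      show "transpose_mat P *\<^sub>v x = P *\<^sub>v x"
      proof (rule vec_eq_sp[of _ d])
        fix y :: "real vec" assume y: "y \<in> carrier_vec d"
        note [simp] = carrier_vecD[OF y]
        have "(transpose_mat P *\<^sub>v x) \<bullet> y = x \<bullet> (P *\<^sub>v y)" by (rule mv_transpose) simp_all
        also have "\<dots> = - ((A *\<^sub>v x) \<bullet> (Q *\<^sub>v y)) - x \<bullet> (Q *\<^sub>v (A *\<^sub>v y)) - (C *\<^sub>v x) \<bullet> (C *\<^sub>v y)"
          by (simp add: P_def mv_simps mv_transpose')
        also have "\<dots> = - ((A *\<^sub>v y) \<bullet> (Q *\<^sub>v x)) - y \<bullet> (Q *\<^sub>v (A *\<^sub>v x)) - (C *\<^sub>v y) \<bullet> (C *\<^sub>v x)"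
          using sym_sp[OF Qc, of "A *\<^sub>v x" y] sym_sp[OF Qc, of "A *\<^sub>v y" x] sp_comm[of "C *\<^sub>v x" "C *\<^sub>v y"] x y by simp
        also have "\<dots> = y \<bullet> (P *\<^sub>v x)" by (simp add: P_def mv_simps mv_transpose')
        also have "\<dots> = (P *\<^sub>v x) \<bullet> y" by (rule sp_comm) simp
        finally show "(transpose_mat P *\<^sub>v x) \<bullet> y = (P *\<^sub>v x) \<bullet> y" .
      qed simp_all
    qed (rule carrier_matI; simp)+
    moreover have "transpose_mat R = R"
      by (intro eq_matI) (simp_all add: R_def sp_sum mult.commute)
    ultimately show "transpose_mat M = M"
      unfolding M_def by (subst transpose_four_block_mat[OF PNR(1) transpose_carrier_mat[THEN iffD2, OF PNR(2)] PNR(2,3)]) simp_all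
    fix w :: "real vec" assume w: "w \<in> carrier_vec (d + n)"
    note [simp] = carrier_vecD[OF w]
    define x u where "x = vec d (\<lambda>i. w $ i)" and "u = vec n (\<lambda>i. w $ (d + i))"
    have [simp]: "dim_vec x = d" "dim_vec u = n" by (simp_all add: x_def u_def)
    have xi: "x $ i = w $ i" if "i < d" for i using that by (simp add: x_def)
    have ui: "u $ i = w $ (d + i)" if "i < n" for i using that by (simp add: u_def)
    have top: "(M *\<^sub>v w) $ a = (P *\<^sub>v x) $ a + (transpose_mat N *\<^sub>v u) $ a" if "a < d" for a
      using that by (simp add: mv_index sum_lessThan_add M_def xi ui del: index_mult_mat_vec)
    have bot: "(M *\<^sub>v w) $ (d + a) = (N *\<^sub>v x) $ a + (R *\<^sub>v u) $ a" if "a < n" for a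
      using that by (simp add: mv_index sum_lessThan_add M_def xi ui del: index_mult_mat_vec)
    have "w \<bullet> (M *\<^sub>v w) = (\<Sum>a<d. w $ a * (M *\<^sub>v w) $ a) + (\<Sum>a<n. w $ (d + a) * (M *\<^sub>v w) $ (d + a))"
      by (simp add: sp_sum[of w] sum_lessThan_add del: index_mult_mat_vec)
    also have "\<dots> = x \<bullet> (P *\<^sub>v x) + x \<bullet> (transpose_mat N *\<^sub>v u) + (u \<bullet> (N *\<^sub>v x) + u \<bullet> (R *\<^sub>v u))"
      by (simp add: top bot xi ui sp_sum[of x] sp_sum[of u] distrib_left sum.distrib del: index_mult_mat_vec)
    also have "x \<bullet> (transpose_mat N *\<^sub>v u) = u \<bullet> (N *\<^sub>v x)" using mv_transpose'[of x N u] sp_comm[of u "N *\<^sub>v x"] by simp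
    finally show "0 \<le> w \<bullet> (M *\<^sub>v w)" using form[of x u] by (simp add: x_def u_def)
  qed
  from rank_factorization[OF this] obtain r F where "F \<in> carrier_mat r (d + n) \<and> M = transpose_mat F * F \<and>
     (\<forall>v\<in>carrier_vec r. transpose_mat F *\<^sub>v v = 0\<^sub>v (d + n) \<longrightarrow> v = 0\<^sub>v r)" by (elim exE)
  then have F: "F \<in> carrier_mat r (d + n)" and MF: "M = transpose_mat F * F"
    and ind: "\<And>v. v \<in> carrier_vec r \<Longrightarrow> transpose_mat F *\<^sub>v v = 0\<^sub>v (d + n) \<Longrightarrow> v = 0\<^sub>v r" by simp_all
  have Fd[simp]: "dim_row F = r" "dim_col F = d + n" using carrier_matD[OF F] by simp_all
  define L W where "L = mat r d (\<lambda>(i,j). F $$ (i,j))" and "W = mat r n (\<lambda>(i,j). F $$ (i,d + j))"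
  have Ld[simp]: "dim_row L = r" "dim_col L = d" "dim_row W = r" "dim_col W = n" by (simp_all add: L_def W_def)
  have ent: "M $$ (i,j) = (\<Sum>k<r. F $$ (k,i) * F $$ (k,j))" if "i < d + n" "j < d + n" for i j
    using that by (simp add: MF sp_sum)
  have "P = transpose_mat L * L"
  proof (rule eq_matI)
    fix i j assume "i < dim_row (transpose_mat L * L)" "j < dim_col (transpose_mat L * L)"
    then show "P $$ (i,j) = (transpose_mat L * L) $$ (i,j)"
      using ent[of i j] by (simp add: M_def sp_sum L_def)
  qed simp_all
  moreover have "N = transpose_mat W * L"
  proof (rule eq_matI)
    fix i j assume "i < dim_row (transpose_mat W * L)" "j < dim_col (transpose_mat W * L)"
    then show "N $$ (i,j) = (transpose_mat W * L) $$ (i,j)"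
      using ent[of "d + i" j] by (simp add: M_def sp_sum L_def W_def)
  qed simp_all
  moreover have "R = transpose_mat W * W"
  proof (rule eq_matI)
    fix i j assume "i < dim_row (transpose_mat W * W)" "j < dim_col (transpose_mat W * W)"
    then show "R $$ (i,j) = (transpose_mat W * W) $$ (i,j)"
      using ent[of "d + i" "d + j"] by (simp add: M_def sp_sum W_def)
  qed simp_all
  moreover have "v = 0\<^sub>v r" if v: "v \<in> carrier_vec r" and 0: "transpose_mat L *\<^sub>v v = 0\<^sub>v d" "transpose_mat W *\<^sub>v v = 0\<^sub>v n" for v
  proof (rule ind[OF v], rule eq_vecI)
    note [simp] = carrier_vecD[OF v]
    fix i assume "i < dim_vec (0\<^sub>v (d + n) :: real vec)"
    then have i: "i < d + n" by simp
    have FL: "(transpose_mat F *\<^sub>v v) $ i = (\<Sum>k<r. F $$ (k,i) * v $ k)"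
      using i by (simp add: mv_index del: index_mult_mat_vec)
    show "(transpose_mat F *\<^sub>v v) $ i = 0\<^sub>v (d + n) $ i"
    proof (cases "i < d")
      case True
      then have "(transpose_mat L *\<^sub>v v) $ i = (\<Sum>k<r. F $$ (k,i) * v $ k)"
        by (simp add: mv_index L_def del: index_mult_mat_vec)
      then show ?thesis unfolding FL 0 using i True by simp
    next
      case False
      define i' where "i' = i - d"
      have i': "i = d + i'" "i' < n" using False i by (simp_all add: i'_def)
      have "(transpose_mat W *\<^sub>v v) $ i' = (\<Sum>k<r. F $$ (k,i) * v $ k)"
        using i' by (simp add: mv_index W_def del: index_mult_mat_vec)
      then show ?thesis unfolding FL 0 using i i' by simp
    qed
  qed simp
  moreover have "L \<in> carrier_mat r d" "W \<in> carrier_mat r n" by (simp_all add: L_def W_def)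
  ultimately show ?thesis unfolding P_def N_def R_def by blast
qed

end

section \<open>The rank condition and minimality of the storage\<close>

lemma (in storage) dissipative_X: "dissipative X"
  unfolding dissipative_def
proof (intro ballI)
  fix x u :: "real vec" assume "x \<in> carrier_vec d" "u \<in> carrier_vec n"
  from lw_quadratic[OF this] show "supply_rate x u + 2 * (x \<bullet> (X *\<^sub>v (A *\<^sub>v x + B *\<^sub>v u))) \<le> 0"
    using sp_self_nonneg[of "L *\<^sub>v x + W *\<^sub>v u"] by linarith
qed

lemma (in storage) spectral_factor_iff_full_row_rank:
  assumes "- transpose_mat A * X - X * A - transpose_mat C * C = transpose_mat L * L"
    and "- transpose_mat D * C - transpose_mat B * X = transpose_mat W * L"
    and "1\<^sub>m n - transpose_mat D * D = transpose_mat W * W"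
  shows "spectral_factor r n (ss_poles A) (\<lambda>s. cmat W + cmat L * resolvent A s * cmat B)
    (\<lambda>s. 1\<^sub>m n - para (transfer A B C D) s * transfer A B C D s) \<longleftrightarrow> full_row_rank_rhp"
proof -
  obtain At where At: "At \<in> carrier_mat d d"
    "\<And>z. z \<in> carrier_vec d \<Longrightarrow> X *\<^sub>v (A *\<^sub>v z - At *\<^sub>v z) = 0\<^sub>v d"
    "\<And>z. z \<in> carrier_vec d \<Longrightarrow> X *\<^sub>v z = 0\<^sub>v d \<Longrightarrow> At *\<^sub>v z = 0\<^sub>v d"
    by (rule stable_reduction) blast
  interpret reduced_storage A B C D d n m L W X r At by unfold_locales (rule At; assumption?)+
  show ?thesis
    by (rule spectral_factor_iff) (rule para_factorization[OF A B C D L W Xc Xsym assms])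
qed

context lti begin

lemma storageI:
  assumes X: "psd d X" and L: "L \<in> carrier_mat r d" and W: "W \<in> carrier_mat r n"
    and obs: "\<And>z. z \<in> carrier_vec d \<Longrightarrow> \<forall>k. C *\<^sub>v ((*\<^sub>v) A ^^ k) z = 0\<^sub>v m \<Longrightarrow> X *\<^sub>v z = 0\<^sub>v d"
    and e: "- transpose_mat A * X - X * A - transpose_mat C * C = transpose_mat L * L"
      "- transpose_mat D * C - transpose_mat B * X = transpose_mat W * L"
      "1\<^sub>m n - transpose_mat D * D = transpose_mat W * W"
  shows "storage A B C D d n m L W X r"
proof -
  have Xc: "X \<in> carrier_mat d d" "transpose_mat X = X" using X by (simp_all add: psd_def)
  show ?thesis
    by unfold_locales (rule L, rule W, rule X, (rule lmi_bilinear[OF A B C D L W Xc e]; assumption), rule obs, assumption, blast)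
qed

lemma psd_minus:
  assumes X: "psd d X" and Y: "psd d Y" and le: "\<And>z. z \<in> carrier_vec d \<Longrightarrow> z \<bullet> (Y *\<^sub>v z) \<le> z \<bullet> (X *\<^sub>v z)"
  shows "psd d (X - Y)"
proof -
  have c: "X \<in> carrier_mat d d" "transpose_mat X = X" "Y \<in> carrier_mat d d" "transpose_mat Y = Y" using X Y by (simp_all add: psd_def)
  note [simp] = carrier_matD[OF c(1)] carrier_matD[OF c(3)]
  have "transpose_mat (X - Y) = X - Y"
  proof (rule eq_matI)
    fix i j assume "i < dim_row (X - Y)" "j < dim_col (X - Y)"
    then have ij: "i < d" "j < d" by simp_all
    have "transpose_mat X $$ (i,j) = X $$ (i,j)" "transpose_mat Y $$ (i,j) = Y $$ (i,j)" by (simp_all only: c)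
    then show "transpose_mat (X - Y) $$ (i,j) = (X - Y) $$ (i,j)" using ij by simp
  qed simp_all
  moreover have "0 \<le> z \<bullet> ((X - Y) *\<^sub>v z)" if z: "z \<in> carrier_vec d" for z
    using le[OF z] carrier_vecD[OF z] by (simp add: mv_simps)
  ultimately show ?thesis unfolding psd_def using minus_carrier_mat[OF c(3)] by simp
qed

text \<open>A slack \<open>E\<close> makes \<open>Q - E\<close> another dissipative positive
  semidefinite matrix, which bounds the available storage from above. That storage is the form of
  \<open>Q\<close> itself, so \<open>E = 0\<close>, and this is the minimality from which the rank
  condition follows.\<close>

lemma finite_storage_imp_spectral_factorization:
  assumes fin: "\<And>x0. x0 \<in> carrier_vec d \<Longrightarrow> avail_storage A B C D t0 x0 < \<infinity>"
  shows "\<exists>X r L W. psd d X \<and> (\<forall>z\<in>carrier_vec d. (\<forall>k. C *\<^sub>v ((*\<^sub>v) A ^^ k) z = 0\<^sub>v m) \<longrightarrow> X *\<^sub>v z = 0\<^sub>v d) \<and>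
    L \<in> carrier_mat r d \<and> W \<in> carrier_mat r n \<and>
    - transpose_mat A * X - X * A - transpose_mat C * C = transpose_mat L * L \<and>
    - transpose_mat D * C - transpose_mat B * X = transpose_mat W * L \<and>
    1\<^sub>m n - transpose_mat D * D = transpose_mat W * W \<and>
    spectral_factor r n (ss_poles A) (\<lambda>s. cmat W + cmat L * resolvent A s * cmat B)
      (\<lambda>s. 1\<^sub>m n - para (transfer A B C D) s * transfer A B C D s)"
proof -
  obtain Q where Qp: "psd d Q" and Qd: "dissipative Q"
    and Qv: "\<And>x0. x0 \<in> carrier_vec d \<Longrightarrow> avail_storage A B C D t0 x0 = ereal (x0 \<bullet> (Q *\<^sub>v x0))"
    and Qo: "\<And>z. z \<in> carrier_vec d \<Longrightarrow> \<forall>k. C *\<^sub>v ((*\<^sub>v) A ^^ k) z = 0\<^sub>v m \<Longrightarrow> Q *\<^sub>v z = 0\<^sub>v d"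
    by (rule available_storage_matrix[of t0]) (erule fin, blast)
  from lmi_factorization[OF Qp Qd] obtain r L W where LW: "L \<in> carrier_mat r d" "W \<in> carrier_mat r n"
    and e: "- transpose_mat A * Q - Q * A - transpose_mat C * C = transpose_mat L * L"
      "- transpose_mat D * C - transpose_mat B * Q = transpose_mat W * L"
      "1\<^sub>m n - transpose_mat D * D = transpose_mat W * W"
    and ind: "\<forall>v\<in>carrier_vec r. transpose_mat L *\<^sub>v v = 0\<^sub>v d \<longrightarrow> transpose_mat W *\<^sub>v v = 0\<^sub>v n \<longrightarrow> v = 0\<^sub>v r"
    by (elim exE conjE) (rule that; assumption)
  interpret storage A B C D d n m L W Q r by (rule storageI[OF Qp LW Qo e])
  have "E = 0\<^sub>m d d" if E: "slack E" for E
  proof -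
    have Ep: "psd d E" and El: "\<And>z. z \<in> carrier_vec d \<Longrightarrow> z \<bullet> (E *\<^sub>v z) \<le> z \<bullet> (Q *\<^sub>v z)" using E by (simp_all add: slack_def)
    have Ec: "E \<in> carrier_mat d d" using Ep by (simp add: psd_def)
    note [simp] = carrier_matD[OF Ec]
    have QE: "psd d (Q - E)" by (rule psd_minus[OF Qp Ep El])
    have "dissipative (Q - E)"
      unfolding dissipative_def
    proof (intro ballI)
      fix x u :: "real vec" assume xu: "x \<in> carrier_vec d" "u \<in> carrier_vec n"
      note [simp] = carrier_vecD[OF xu(1)] carrier_vecD[OF xu(2)]
      have "0 \<le> (L *\<^sub>v x + W *\<^sub>v u) \<bullet> (L *\<^sub>v x + W *\<^sub>v u) + 2 * (x \<bullet> (E *\<^sub>v (A *\<^sub>v x + B *\<^sub>v u)))"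
        using E xu by (simp add: slack_def)
      moreover have "x \<bullet> ((Q - E) *\<^sub>v (A *\<^sub>v x + B *\<^sub>v u)) = x \<bullet> (Q *\<^sub>v (A *\<^sub>v x + B *\<^sub>v u)) - x \<bullet> (E *\<^sub>v (A *\<^sub>v x + B *\<^sub>v u))"
        by (simp add: mv_mminus sp_minus_right)
      ultimately show "supply_rate x u + 2 * (x \<bullet> ((Q - E) *\<^sub>v (A *\<^sub>v x + B *\<^sub>v u))) \<le> 0"
        using lw_quadratic[OF xu] by linarith
    qed
    then have le: "x0 \<bullet> (Q *\<^sub>v x0) \<le> x0 \<bullet> ((Q - E) *\<^sub>v x0)" if "x0 \<in> carrier_vec d" for x0
      using avail_storage_le[OF QE _ that, of t0] Qv[OF that] by simp
    have "E *\<^sub>v x = 0\<^sub>v d" if x: "x \<in> carrier_vec d" for x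
    proof -
      note [simp] = carrier_vecD[OF x]
      have "x \<bullet> ((Q - E) *\<^sub>v x) = x \<bullet> (Q *\<^sub>v x) - x \<bullet> (E *\<^sub>v x)" by (simp add: mv_mminus sp_minus_right)
      moreover have "0 \<le> x \<bullet> (E *\<^sub>v x)" using Ep x by (simp add: psd_def)
      ultimately have "x \<bullet> (E *\<^sub>v x) = 0" using le[OF x] by linarith
      then show ?thesis by (rule psd_ker[OF Ep x])
    qed
    then show ?thesis by (intro mat_eq_mv[OF Ec]) (simp_all add: zero_mv)
  qed
  then have full_row_rank_rhp using ind by (intro full_row_rank_if_minimal) simp_all
  then have "spectral_factor r n (ss_poles A) (\<lambda>s. cmat W + cmat L * resolvent A s * cmat B)
      (\<lambda>s. 1\<^sub>m n - para (transfer A B C D) s * transfer A B C D s)"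
    unfolding spectral_factor_iff_full_row_rank[OF e] .
  then show ?thesis using Qp Qo LW e by (intro exI[of _ Q] exI[of _ r] exI[of _ L] exI[of _ W] conjI ballI impI)
qed

lemma avail_storage_spectral_factor:
  assumes X: "psd d X" and LW: "L \<in> carrier_mat r d" "W \<in> carrier_mat r n"
    and obs: "\<And>z. z \<in> carrier_vec d \<Longrightarrow> \<forall>k. C *\<^sub>v ((*\<^sub>v) A ^^ k) z = 0\<^sub>v m \<Longrightarrow> X *\<^sub>v z = 0\<^sub>v d"
    and e: "- transpose_mat A * X - X * A - transpose_mat C * C = transpose_mat L * L"
      "- transpose_mat D * C - transpose_mat B * X = transpose_mat W * L"
      "1\<^sub>m n - transpose_mat D * D = transpose_mat W * W"
    and sf: "spectral_factor r n (ss_poles A) (\<lambda>s. cmat W + cmat L * resolvent A s * cmat B)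
      (\<lambda>s. 1\<^sub>m n - para (transfer A B C D) s * transfer A B C D s)"
    and x0: "x0 \<in> carrier_vec d"
  shows "avail_storage A B C D t0 x0 = ereal (x0 \<bullet> (X *\<^sub>v x0))"
proof -
  interpret storage A B C D d n m L W X r by (rule storageI[OF X LW obs e])
  have fr: full_row_rank_rhp using sf unfolding spectral_factor_iff_full_row_rank[OF e] .
  have le: "avail_storage A B C D t0 x \<le> ereal (x \<bullet> (X *\<^sub>v x))" if "x \<in> carrier_vec d" for x
    by (rule avail_storage_le[OF X dissipative_X that])
  have fin: "avail_storage A B C D t0 x < \<infinity>" if "x \<in> carrier_vec d" for x
    by (rule le_less_trans[OF le[OF that]]) simp
  obtain Q where Qp: "psd d Q" and Qd: "dissipative Q"
    and Qv: "\<And>x0. x0 \<in> carrier_vec d \<Longrightarrow> avail_storage A B C D t0 x0 = ereal (x0 \<bullet> (Q *\<^sub>v x0))"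
    by (rule available_storage_matrix[of t0]) (erule fin, blast)
  have Qc: "Q \<in> carrier_mat d d" using Qp by (simp add: psd_def)
  note [simp] = carrier_matD[OF Qc]
  have QX: "z \<bullet> (Q *\<^sub>v z) \<le> z \<bullet> (X *\<^sub>v z)" if "z \<in> carrier_vec d" for z
    using le[OF that] Qv[OF that] by simp
  \<comment> \<open>By \<open>lw_quadratic\<close> the last slack condition for \<open>X - Q\<close>
    is exactly dissipativity of \<open>Q\<close>.\<close>
  have "slack (X - Q)"
    unfolding slack_def
  proof (intro conjI ballI)
    show "psd d (X - Q)" by (rule psd_minus[OF X Qp QX])
    fix z :: "real vec" assume z: "z \<in> carrier_vec d"
    note [simp] = carrier_vecD[OF z]
    have sub: "z \<bullet> ((X - Q) *\<^sub>v y) = z \<bullet> (X *\<^sub>v y) - z \<bullet> (Q *\<^sub>v y)" if "dim_vec y = d" for y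
      using that by (simp add: mv_mminus sp_minus_right)
    have "0 \<le> z \<bullet> (Q *\<^sub>v z)" using Qp z by (simp add: psd_def)
    then show "z \<bullet> ((X - Q) *\<^sub>v z) \<le> z \<bullet> (X *\<^sub>v z)" by (simp add: sub)
    fix u :: "real vec" assume u: "u \<in> carrier_vec n"
    have "supply_rate z u + 2 * (z \<bullet> (Q *\<^sub>v (A *\<^sub>v z + B *\<^sub>v u))) \<le> 0" using Qd z u by (simp add: dissipative_def)
    then show "0 \<le> (L *\<^sub>v z + W *\<^sub>v u) \<bullet> (L *\<^sub>v z + W *\<^sub>v u) + 2 * (z \<bullet> ((X - Q) *\<^sub>v (A *\<^sub>v z + B *\<^sub>v u)))"
      using lw_quadratic[OF z u] sub[of "A *\<^sub>v z + B *\<^sub>v u"] by simp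
  qed
  from slack_zero[OF fr this] have 0: "X - Q = 0\<^sub>m d d" .
  have "x0 \<bullet> (X *\<^sub>v x0) - x0 \<bullet> (Q *\<^sub>v x0) = x0 \<bullet> ((X - Q) *\<^sub>v x0)"
    using carrier_vecD[OF x0] by (simp add: mv_mminus sp_minus_right)
  also have "\<dots> = 0" unfolding 0 using x0 by (simp add: zero_mv)
  finally show ?thesis using Qv[OF x0] by simp
qed

end

theorem theorem23:
  fixes A B C D :: "real mat" and d n m :: nat and t0 :: real
  assumes "A \<in> carrier_mat d d" and "B \<in> carrier_mat d n"
    and "C \<in> carrier_mat m d" and "D \<in> carrier_mat m n"
  defines "cond2 \<equiv> \<lambda>X::real mat.
      X \<in> carrier_mat d d \<and> transpose_mat X = X \<and>
      (\<forall>z\<in>carrier_vec d. 0 \<le> z \<bullet> (X *\<^sub>v z)) \<and>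
      (\<forall>z\<in>carrier_vec d. obs_mat C A *\<^sub>v z = 0\<^sub>v (m * d) \<longrightarrow> X *\<^sub>v z = 0\<^sub>v d) \<and>
      (\<exists>r L W. L \<in> carrier_mat r d \<and> W \<in> carrier_mat r n \<and>
         - transpose_mat A * X - X * A - transpose_mat C * C = transpose_mat L * L \<and>
         - transpose_mat D * C - transpose_mat B * X = transpose_mat W * L \<and>
         1\<^sub>m n - transpose_mat D * D = transpose_mat W * W \<and>
         spectral_factor r n (ss_poles A)
           (\<lambda>s. cmat W + cmat L * resolvent A s * cmat B)
           (\<lambda>s. 1\<^sub>m n - para (transfer A B C D) s * transfer A B C D s))"
  shows "((\<forall>x0\<in>carrier_vec d. avail_storage A B C D t0 x0 < \<infinity>) \<longleftrightarrow> (\<exists>X. cond2 X)) \<and>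
         (\<forall>X. cond2 X \<longrightarrow>
           (\<forall>x0\<in>carrier_vec d. avail_storage A B C D t0 x0 = ereal (x0 \<bullet> (X *\<^sub>v x0))))"
proof -
  interpret lti A B C D d n m by unfold_locales fact+
  \<comment> \<open>The value formula contains the finiteness asserted by the converse half of the
    equivalence, so it is established for every admissible \<open>X\<close> beforehand.\<close>
  have av: "avail_storage A B C D t0 x0 = ereal (x0 \<bullet> (X *\<^sub>v x0))" if "cond2 X" and x0: "x0 \<in> carrier_vec d" for X x0
  proof -
    from that(1) obtain r L W where LW: "L \<in> carrier_mat r d" "W \<in> carrier_mat r n"
      and X: "X \<in> carrier_mat d d" "transpose_mat X = X" "\<forall>z\<in>carrier_vec d. 0 \<le> z \<bullet> (X *\<^sub>v z)"
      and o: "\<forall>z\<in>carrier_vec d. obs_mat C A *\<^sub>v z = 0\<^sub>v (m * d) \<longrightarrow> X *\<^sub>v z = 0\<^sub>v d"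
      and e: "- transpose_mat A * X - X * A - transpose_mat C * C = transpose_mat L * L"
        "- transpose_mat D * C - transpose_mat B * X = transpose_mat W * L"
        "1\<^sub>m n - transpose_mat D * D = transpose_mat W * W"
      and sf: "spectral_factor r n (ss_poles A) (\<lambda>s. cmat W + cmat L * resolvent A s * cmat B)
        (\<lambda>s. 1\<^sub>m n - para (transfer A B C D) s * transfer A B C D s)"
      unfolding cond2_def by (elim exE conjE) (rule that; assumption)
    have "psd d X" unfolding psd_def using X by (intro conjI)
    then show ?thesis
    proof (rule avail_storage_spectral_factor[OF _ LW _ e sf x0])
      fix z assume "z \<in> carrier_vec d" "\<forall>k. C *\<^sub>v ((*\<^sub>v) A ^^ k) z = 0\<^sub>v m"
      then show "X *\<^sub>v z = 0\<^sub>v d" using o obs_mat_kernel by blast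
    qed
  qed
  have "\<exists>X. cond2 X" if fin: "\<forall>x0\<in>carrier_vec d. avail_storage A B C D t0 x0 < \<infinity>"
  proof -
    from finite_storage_imp_spectral_factorization[of t0] fin obtain X r L W where
      X: "psd d X" and o: "\<forall>z\<in>carrier_vec d. (\<forall>k. C *\<^sub>v ((*\<^sub>v) A ^^ k) z = 0\<^sub>v m) \<longrightarrow> X *\<^sub>v z = 0\<^sub>v d"
      and LW: "L \<in> carrier_mat r d" "W \<in> carrier_mat r n"
      and e: "- transpose_mat A * X - X * A - transpose_mat C * C = transpose_mat L * L"
        "- transpose_mat D * C - transpose_mat B * X = transpose_mat W * L"
        "1\<^sub>m n - transpose_mat D * D = transpose_mat W * W"
      and sf: "spectral_factor r n (ss_poles A) (\<lambda>s. cmat W + cmat L * resolvent A s * cmat B)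
        (\<lambda>s. 1\<^sub>m n - para (transfer A B C D) s * transfer A B C D s)"
      by blast
    have "\<forall>z\<in>carrier_vec d. obs_mat C A *\<^sub>v z = 0\<^sub>v (m * d) \<longrightarrow> X *\<^sub>v z = 0\<^sub>v d"
      using o obs_mat_kernel by blast
    then have "cond2 X"
      unfolding cond2_def using X LW e sf unfolding psd_def by blast
    then show ?thesis ..
  qed
  moreover have "avail_storage A B C D t0 x0 < \<infinity>" if "cond2 X" "x0 \<in> carrier_vec d" for X x0
    using av[OF that] by simp
  ultimately show ?thesis using av by blast
qed

end
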